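(* Let $X\to\mathbb{P}^1\setminus\{0,1,a,\infty\}$ be one of the extremal families of elliptic curves with parameters $(a,q)$ listed in the context. Apply to $X$ the twist with generalized functional invariant $(1,1,1)$ to obtain a family of elliptic K3 surfaces, and apply to the latter again the twist with generalized functional invariant $(k,l,\beta)=(1,1,1)$. The result is a family over $\mathbb{P}^1\setminus\{0,1,a,\infty\}$ of Jacobian elliptic Calabi-Yau threefolds over $\mathbb{P}^1\times\mathbb{P}^1$. For each family, the period integrals are annihilated by the Picard-Fuchs operator $${}_1L^{(4)}_t\!\left(\tfrac14;a,q\right)=\theta^4-\frac t{4a}(2\theta+1)^2\big((a+1)\theta^2+(a+1)\theta+q\big)+\frac{t^2}{4a}(2\theta+1)(2\theta+3)\big(\theta+\tfrac12\big)\big(\theta+\tfrac32\big).$$ In particular, the period over $\Sigma_3(t)$ is holomorphic at $t=0$ and given by $$\omega=(2\pi i)^3\;{}_1F_0\!\left(\tfrac12\,\big|\,t\right)\star\left[H\ell\!\left(a,\tfrac q4;\tfrac14,\tfrac34,1,\tfrac12\,\big|\,t\right)\right]^2 .$$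
   Context: $\theta=t\frac d{dt}$; $\star$ is the Hadamard product of power series in $t$; ${}_1F_0(\frac12|t)=(1-t)^{-1/2}$. $H\ell(a,q;\alpha,\beta,\gamma,\delta\,|\,t)$ is the unique solution, holomorphic and equal to $1$ at $t=0$, of Heun's equation $\omega''+\big(\frac\gamma t+\frac\delta{t-1}+\frac\epsilon{t-a}\big)\omega'+\frac{\alpha\beta t-q}{t(t-1)(t-a)}\omega=0$, $\epsilon=\alpha+\beta-\gamma-\delta+1$. The families $X$: $y^2=4x^3-g_2(t)x-g_3(t)$ ($\deg g_2\le4$, $\deg g_3\le6$) are the extremal rational elliptic surfaces with four singular fibers (Miranda-Persson; $X_{n_1n_2n_3n_4}$ has fibers $I_{n_1},\dots,I_{n_4}$), with singular fibers placed as follows (in the order $t=0,1,a,\infty$): $X_{8211}$: $(a,q)=(2,1)$, fibers $I_1,I_2,I_1,I_8$; $(\frac12,\frac12)$, fibers $I_8,I_2,I_1,I_1$; $X_{9111}$: $\big(\frac{1\pm i\sqrt3}2,\frac{3\pm i\sqrt3}6\big)$, fibers $I_1,I_1,I_1,I_9$; $X_{5511}$: $\big(\frac{-123\pm55\sqrt5}2,\frac{-33\pm15\sqrt5}2\big)$, fibers $I_5,I_1,I_1,I_5$; $X_{6321}$: $(-8,-2)$, fibers $I_6,I_1,I_2,I_3$; $(-\frac18,\frac14)$, fibers $I_3,I_1,I_2,I_6$; $(9,3)$, fibers $I_1,I_6,I_2,I_3$; $(\frac19,\frac13)$, fibers $I_3,I_6,I_2,I_1$; $(\frac98,\frac34)$,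 fibers $I_2,I_6,I_1,I_3$; $(\frac89,\frac23)$, fibers $I_2,I_1,I_6,I_3$. Periods of $dx/y$ on $X$ are annihilated by $\theta^2-\frac ta((a+1)\theta^2+(a+1)\theta+q)+\frac{t^2}a(\theta+1)^2$; the holomorphic one-form is normalized by a constant so that its period over the A-cycle $\Sigma_1(t)$ near $t=0$ is $(2\pi i)H\ell(a,q;1,1,1,1|t)$. The twist with generalized functional invariant $(1,1,1)$ of $y^2=4x^3-g_2(t,\cdot)x-g_3(t,\cdot)$ is $Y^2=4X^3-g_2(-\frac t{4v(v+1)},\cdot)v^4(v+1)^4X-g_3(-\frac t{4v(v+1)},\cdot)v^6(v+1)^6$ with additional base coordinate $v$; the holomorphic form is the wedge product of the differentials of the base coordinates with $dX/Y$; periods transform as $\omega(t)\mapsto\oint_C\frac{dv}{v(v+1)}\omega(-\frac t{4v(v+1)})$, and cycles are warped products of the circle $|v|=\frac12$ with the previous cycles at parameter $-\frac t{4v(v+1)}$, rescaled by $(X,Y)\mapsto(v^2(v+1)^2X,v^3(v+1)^3Y)$. $\Sigma_3(t)$ is obtained from $\Sigma_1(t)$ by applying this twice, for $|t|$ small. *)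

theory Defs
  imports
    "HOL-Complex_Analysis.Complex_Analysis"
    "HOL-Computational_Algebra.Computational_Algebra"
    "HOL-Library.Poly_Mapping"
begin

section \<open>Heun functions, Hadamard products and the Picard-Fuchs operator\<close>

definition heun_equation ::
  "complex \<Rightarrow> complex \<Rightarrow> complex \<Rightarrow> complex \<Rightarrow> complex \<Rightarrow> complex \<Rightarrow> (complex \<Rightarrow> complex) \<Rightarrow> complex \<Rightarrow> bool" where
  "heun_equation a q \<alpha> \<beta> \<gamma> \<delta> \<omega> t \<longleftrightarrow>
     (let \<epsilon> = \<alpha> + \<beta> - \<gamma> - \<delta> + 1 in
       deriv (deriv \<omega>) t + (\<gamma> / t + \<delta> / (t - 1) + \<epsilon> / (t - a)) * deriv \<omega> t
         + (\<alpha> * \<beta> * t - q) / (t * (t - 1) * (t - a)) * \<omega> t = 0)"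

text \<open>The local Heun function is represented by its Taylor series at \<open>t = 0\<close>.\<close>

definition heun_local ::
  "complex \<Rightarrow> complex \<Rightarrow> complex \<Rightarrow> complex \<Rightarrow> complex \<Rightarrow> complex \<Rightarrow> complex fps" where
  "heun_local a q \<alpha> \<beta> \<gamma> \<delta> =
     (THE F. fps_conv_radius F > 0 \<and> fps_nth F 0 = 1 \<and>
        (\<forall>\<^sub>F t in at 0. heun_equation a q \<alpha> \<beta> \<gamma> \<delta> (eval_fps F) t))"

definition hadamard :: "complex fps \<Rightarrow> complex fps \<Rightarrow> complex fps"  (infixl \<open>\<star>\<close> 70) where
  "F \<star> G = Abs_fps (\<lambda>n. fps_nth F n * fps_nth G n)"

definition hyp1F0_half :: "complex fps" where
  "hyp1F0_half = fps_expansion (\<lambda>t. (1 - t) powr (- 1 / 2)) 0"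

definition theta :: "(complex \<Rightarrow> complex) \<Rightarrow> complex \<Rightarrow> complex" where
  "theta f t = t * deriv f t"

text \<open>\<open>theta_poly P\<close> is the differential operator \<open>P(\<theta>)\<close>.\<close>

definition theta_poly :: "complex poly \<Rightarrow> (complex \<Rightarrow> complex) \<Rightarrow> complex \<Rightarrow> complex" where
  "theta_poly P f t = (\<Sum>i\<le>degree P. coeff P i * (theta ^^ i) f t)"

definition picard_fuchs4 :: "complex \<Rightarrow> complex \<Rightarrow> (complex \<Rightarrow> complex) \<Rightarrow> complex \<Rightarrow> complex" where
  "picard_fuchs4 a q f t =
     theta_poly ([:0, 1:] ^ 4) f t
     - t / (4 * a) * theta_poly ([:1, 2:] ^ 2 * [:q, a + 1, a + 1:]) f t
     + t\<^sup>2 / (4 * a) * theta_poly ([:1, 2:] * [:3, 2:] * [:1 / 2, 1:] * [:3 / 2, 1:]) f t"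


section \<open>Extremal rational elliptic surfaces with four singular fibers\<close>

definition wdiscr :: "'a::comm_ring_1 \<Rightarrow> 'a \<Rightarrow> 'a" where
  "wdiscr g2 g3 = g2 ^ 3 - 27 * g3 ^ 2"

text \<open>
  Fibers of type \<open>I\<^sub>n\<close> (\<open>n \<ge> 1\<close>) are recognised as in Kodaira's table for Weierstrass models:
  \<open>g2\<close> (hence \<open>g3\<close>) does not vanish and the discriminant vanishes to order \<open>n\<close>.
  At infinity, \<open>g2\<close>, \<open>g3\<close> and the discriminant are sections of \<open>O(4)\<close>, \<open>O(6)\<close>, \<open>O(12)\<close>.
\<close>

definition fiber_I :: "nat \<Rightarrow> complex poly \<Rightarrow> complex poly \<Rightarrow> complex \<Rightarrow> bool" where
  "fiber_I n g2 g3 t0 \<longleftrightarrow> n \<ge> 1 \<and> poly g2 t0 \<noteq> 0 \<and> order t0 (wdiscr g2 g3) = n"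

definition fiber_I_infinity :: "nat \<Rightarrow> complex poly \<Rightarrow> complex poly \<Rightarrow> bool" where
  "fiber_I_infinity n g2 g3 \<longleftrightarrow> n \<ge> 1 \<and> coeff g2 4 \<noteq> 0 \<and> degree (wdiscr g2 g3) + n = 12"

text \<open>
  The second argument lists the fiber types at \<open>0, 1, a, \<infinity>\<close>. When they add up to 12, as they do
  below, all other fibers are smooth.
\<close>

definition rational_elliptic_surface ::
  "complex \<Rightarrow> nat \<times> nat \<times> nat \<times> nat \<Rightarrow> complex poly \<Rightarrow> complex poly \<Rightarrow> bool" where
  "rational_elliptic_surface a = (\<lambda>(n0, n1, na, ni) g2 g3.
     degree g2 \<le> 4 \<and> degree g3 \<le> 6 \<and> wdiscr g2 g3 \<noteq> 0 \<and>
     fiber_I n0 g2 g3 0 \<and> fiber_I n1 g2 g3 1 \<and> fiber_I na g2 g3 a \<and> fiber_I_infinity ni g2 g3)"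

definition extremal_data :: "(complex \<times> complex \<times> nat \<times> nat \<times> nat \<times> nat) set" where
  "extremal_data =
     {(2, 1, 1, 2, 1, 8), (1 / 2, 1 / 2, 8, 2, 1, 1)}
   \<union> {((1 + \<i> * sqrt 3) / 2, (3 + \<i> * sqrt 3) / 6, 1, 1, 1, 9),
      ((1 - \<i> * sqrt 3) / 2, (3 - \<i> * sqrt 3) / 6, 1, 1, 1, 9)}
   \<union> {((- 123 + 55 * sqrt 5) / 2, (- 33 + 15 * sqrt 5) / 2, 5, 1, 1, 5),
      ((- 123 - 55 * sqrt 5) / 2, (- 33 - 15 * sqrt 5) / 2, 5, 1, 1, 5)}
   \<union> {(- 8, - 2, 6, 1, 2, 3), (- 1 / 8, 1 / 4, 3, 1, 2, 6),
      (9, 3, 1, 6, 2, 3), (1 / 9, 1 / 3, 3, 6, 2, 1),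
      (9 / 8, 3 / 4, 2, 6, 1, 3), (8 / 9, 2 / 3, 2, 1, 6, 3)}"


section \<open>Weierstrass families and the twist with generalized functional invariant (1,1,1)\<close>

text \<open>
  A Weierstrass coefficient is a function of the parameter \<open>t\<close> and of the list of base
  coordinates; a point of the total space is \<open>(bs, X, Y)\<close> with \<open>bs\<close> its base coordinates.
  Each twist puts one new base coordinate in front of the list.
\<close>

type_synonym wcoeff = "complex \<Rightarrow> complex list \<Rightarrow> complex"
type_synonym point = "complex list \<times> complex \<times> complex"

definition base_coeff :: "complex poly \<Rightarrow> wcoeff" where
  "base_coeff g = (\<lambda>t bs. poly g t)"

definition twist_param :: "complex \<Rightarrow> complex \<Rightarrow> complex" where
  "twist_param t v = - t / (4 * v * (v + 1))"

text \<open>Here \<open>w = 4\<close> for \<open>g2\<close> and \<open>w = 6\<close> for \<open>g3\<close>. Because of the division the formula is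
  meaningful only for \<open>v \<noteq> 0, -1\<close>.\<close>

definition twist_coeff :: "nat \<Rightarrow> wcoeff \<Rightarrow> wcoeff" where
  "twist_coeff w g = (\<lambda>t bs. let v = hd bs in
     g (twist_param t v) (tl bs) * (v * (v + 1)) ^ w)"

definition k3_coeff :: "nat \<Rightarrow> complex poly \<Rightarrow> wcoeff" where
  "k3_coeff w g = twist_coeff w (base_coeff g)"

definition cy3_coeff :: "nat \<Rightarrow> complex poly \<Rightarrow> wcoeff" where
  "cy3_coeff w g = twist_coeff w (k3_coeff w g)"

text \<open>
  A Weierstrass model over \<open>B\<close> with fundamental line bundle \<open>L\<close> has dualizing sheaf the pull-back
  of \<open>K\<^sub>B + L\<close>. It is therefore Calabi-Yau if \<open>L = -K\<^sub>B\<close>, so that \<open>G2\<close>, \<open>G3\<close> are sections of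
  \<open>-4K\<^sub>B\<close>, \<open>-6K\<^sub>B\<close>, and if it is minimal: along no divisor do \<open>G2\<close>, \<open>G3\<close> vanish to orders 4, 6.
  For \<open>B = P\<^sup>1\<close> this means sections of \<open>O(8)\<close>, \<open>O(12)\<close>, and for \<open>B = P\<^sup>1 \<times> P\<^sup>1\<close> sections of
  \<open>O(8,8)\<close>, \<open>O(12,12)\<close>; the vanishing order at infinity is 8 (or 12) minus the degree.
\<close>

definition jacobian_elliptic_K3 :: "complex poly \<Rightarrow> complex poly \<Rightarrow> bool" where
  "jacobian_elliptic_K3 G2 G3 \<longleftrightarrow>
     degree G2 \<le> 8 \<and> degree G3 \<le> 12 \<and> wdiscr G2 G3 \<noteq> 0 \<and>
     (\<nexists>p. \<not> p dvd 1 \<and> p ^ 4 dvd G2 \<and> p ^ 6 dvd G3) \<and>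
     \<not> (degree G2 \<le> 4 \<and> degree G3 \<le> 6)"

text \<open>Polynomials in \<open>v\<close> whose coefficients are polynomials in \<open>u\<close>.\<close>

definition jacobian_elliptic_CY3 :: "complex poly poly \<Rightarrow> complex poly poly \<Rightarrow> bool" where
  "jacobian_elliptic_CY3 G2 G3 \<longleftrightarrow>
     degree G2 \<le> 8 \<and> (\<forall>i. degree (coeff G2 i) \<le> 8) \<and>
     degree G3 \<le> 12 \<and> (\<forall>i. degree (coeff G3 i) \<le> 12) \<and> wdiscr G2 G3 \<noteq> 0 \<and>
     (\<nexists>p. \<not> p dvd 1 \<and> p ^ 4 dvd G2 \<and> p ^ 6 dvd G3) \<and>
     \<not> (degree G2 \<le> 4 \<and> degree G3 \<le> 6) \<and>
     \<not> ((\<forall>i. degree (coeff G2 i) \<le> 4) \<and> (\<forall>i. degree (coeff G3 i) \<le> 6))"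

definition eval2 :: "complex poly poly \<Rightarrow> complex \<Rightarrow> complex \<Rightarrow> complex" where
  "eval2 G u v = poly (poly G [:v:]) u"

definition is_K3_fiber :: "complex poly \<Rightarrow> complex poly \<Rightarrow> complex \<Rightarrow> bool" where
  "is_K3_fiber g2 g3 t \<longleftrightarrow> (\<exists>G2 G3. jacobian_elliptic_K3 G2 G3 \<and>
     (\<forall>v. v \<notin> {0, -1} \<longrightarrow>
        poly G2 v = k3_coeff 4 g2 t [v] \<and> poly G3 v = k3_coeff 6 g3 t [v]))"

definition is_CY3_fiber :: "complex poly \<Rightarrow> complex poly \<Rightarrow> complex \<Rightarrow> bool" where
  "is_CY3_fiber g2 g3 t \<longleftrightarrow> (\<exists>G2 G3. jacobian_elliptic_CY3 G2 G3 \<and>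
     (\<forall>u v. u \<notin> {0, -1} \<longrightarrow> v \<notin> {0, -1} \<longrightarrow>
        eval2 G2 u v = cy3_coeff 4 g2 t [u, v] \<and> eval2 G3 u v = cy3_coeff 6 g3 t [u, v]))"


section \<open>Periods of the elliptic curves over the A-cycle\<close>

text \<open>
  The fiber over \<open>t = 0\<close> is \<open>y\<^sup>2 = 4 (x - e)\<^sup>2 (x + 2e)\<close> with \<open>e\<close> as below. The A-cycle is the
  cycle vanishing at the node: a lift of a circle that encloses, for \<open>t\<close> close to 0, exactly the
  two roots that merge at \<open>e\<close>.
\<close>

definition node :: "complex poly \<Rightarrow> complex poly \<Rightarrow> complex" where
  "node g2 g3 = - 3 * poly g3 0 / (2 * poly g2 0)"

definition A_cycle ::
  "complex poly \<Rightarrow> complex poly \<Rightarrow> real \<Rightarrow> (complex \<Rightarrow> real \<Rightarrow> point) \<Rightarrow> bool" where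
  "A_cycle g2 g3 \<rho> \<Sigma>\<^sub>1 \<longleftrightarrow>
     (\<exists>r > 0. r < 3 * norm (node g2 g3) \<and>
       (\<forall>t \<in> ball 0 \<rho>. \<forall>s \<in> {0..1}. \<exists>x y. \<Sigma>\<^sub>1 t s = ([], x, y) \<and>
          x = circlepath (node g2 g3) r s \<and> y \<noteq> 0 \<and>
          y\<^sup>2 = 4 * x ^ 3 - poly g2 t * x - poly g3 t)) \<and>
     (\<forall>t \<in> ball 0 \<rho>. \<Sigma>\<^sub>1 t 0 = \<Sigma>\<^sub>1 t 1) \<and>
     continuous_on (ball 0 \<rho> \<times> {0..1}) (\<lambda>(t, s). snd (snd (\<Sigma>\<^sub>1 t s)))"

text \<open>The integral of \<open>dx/y\<close>.\<close>

definition period1 :: "(real \<Rightarrow> point) \<Rightarrow> complex" where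
  "period1 c = integral {0..1}
     (\<lambda>s. vector_derivative (\<lambda>s. fst (snd (c s))) (at s) / snd (snd (c s)))"


section \<open>Three-cycles and their periods\<close>

type_synonym cube = "real \<times> real \<times> real \<Rightarrow> point"

abbreviation unit_cube :: "(real \<times> real \<times> real) set" where
  "unit_cube \<equiv> cbox (0, 0, 0) (1, 1, 1)"

abbreviation unit_square :: "(real \<times> real) set" where
  "unit_square \<equiv> cbox (0, 0) (1, 1)"

abbreviation coord_u :: "point \<Rightarrow> complex" where "coord_u P \<equiv> fst P ! 0"
abbreviation coord_v :: "point \<Rightarrow> complex" where "coord_v P \<equiv> fst P ! 1"
abbreviation coord_X :: "point \<Rightarrow> complex" where "coord_X P \<equiv> fst (snd P)"
abbreviation coord_Y :: "point \<Rightarrow> complex" where "coord_Y P \<equiv> snd (snd P)"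

text \<open>The integral of \<open>du \<and> dv \<and> dX/Y\<close> over a singular cube.\<close>

definition period3 :: "cube \<Rightarrow> complex" where
  "period3 c = integral unit_cube (\<lambda>p.
     (let D = (\<lambda>f e. frechet_derivative (\<lambda>p. f (c p)) (at p) e);
          row = (\<lambda>f. vector [D f (1, 0, 0), D f (0, 1, 0), D f (0, 0, 1)] :: complex ^ 3)
      in det (vector [row coord_u, row coord_v, row coord_X] :: complex ^ 3 ^ 3)) / coord_Y (c p))"

primrec Ck_on :: "nat \<Rightarrow> ('a::real_normed_vector \<Rightarrow> 'b::real_normed_vector) \<Rightarrow> 'a set \<Rightarrow> bool" where
  "Ck_on 0 f S \<longleftrightarrow> continuous_on S f"
| "Ck_on (Suc k) f S \<longleftrightarrow>
     f differentiable_on S \<and> (\<forall>e. Ck_on k (\<lambda>x. frechet_derivative f (at x) e) S)"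

definition smooth_on_cube :: "(real \<times> real \<times> real \<Rightarrow> complex) \<Rightarrow> bool" where
  "smooth_on_cube f \<longleftrightarrow>
     (\<exists>S F. open S \<and> unit_cube \<subseteq> S \<and> (\<forall>k. Ck_on k F S) \<and> (\<forall>p \<in> unit_cube. F p = f p))"

text \<open>
  The affine part \<open>u, v \<noteq> 0, -1\<close>, \<open>Y \<noteq> 0\<close> of the threefold over \<open>t\<close>. It is smooth, and locally
  \<open>(u, v, X)\<close> are coordinates on it.
\<close>

definition threefold :: "complex poly \<Rightarrow> complex poly \<Rightarrow> complex \<Rightarrow> point set" where
  "threefold g2 g3 t = {([u, v], X, Y) | u v X Y. u \<notin> {0, -1} \<and> v \<notin> {0, -1} \<and> Y \<noteq> 0 \<and>
     Y\<^sup>2 = 4 * X ^ 3 - cy3_coeff 4 g2 t [u, v] * X - cy3_coeff 6 g3 t [u, v]}"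

text \<open>Normalized cubical singular chains: integral combinations of cubes, modulo degenerate ones.\<close>

definition face :: "cube \<Rightarrow> (real \<times> real \<Rightarrow> real \<times> real \<times> real) \<Rightarrow> (real \<times> real \<Rightarrow> point) \<Rightarrow>\<^sub>0 int" where
  "face c \<iota> = frag_of (restrict (c \<circ> \<iota>) unit_square)"

definition cube_boundary :: "cube \<Rightarrow> (real \<times> real \<Rightarrow> point) \<Rightarrow>\<^sub>0 int" where
  "cube_boundary c =
     (face c (\<lambda>(x, y). (1, x, y)) - face c (\<lambda>(x, y). (0, x, y)))
   - (face c (\<lambda>(x, y). (x, 1, y)) - face c (\<lambda>(x, y). (x, 0, y)))
   + (face c (\<lambda>(x, y). (x, y, 1)) - face c (\<lambda>(x, y). (x, y, 0)))"

definition degenerate :: "(real \<times> real \<Rightarrow> point) \<Rightarrow> bool" where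
  "degenerate \<sigma> \<longleftrightarrow>
     (\<forall>x \<in> {0..1}. \<forall>y \<in> {0..1}. \<sigma> (x, y) = \<sigma> (0, y)) \<or>
     (\<forall>x \<in> {0..1}. \<forall>y \<in> {0..1}. \<sigma> (x, y) = \<sigma> (x, 0))"

definition three_cycle :: "complex poly \<Rightarrow> complex poly \<Rightarrow> complex \<Rightarrow> (cube \<Rightarrow>\<^sub>0 int) \<Rightarrow> bool" where
  "three_cycle g2 g3 t \<Gamma> \<longleftrightarrow>
     (\<forall>c \<in> Poly_Mapping.keys \<Gamma>. c ` unit_cube \<subseteq> threefold g2 g3 t \<and>
        (\<forall>f \<in> {coord_u, coord_v, coord_X, coord_Y}. smooth_on_cube (\<lambda>p. f (c p)))) \<and>
     (\<forall>\<sigma> \<in> Poly_Mapping.keys (frag_extend cube_boundary \<Gamma>). degenerate \<sigma>)"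

text \<open>
  Locally constant continuation of a cycle from the threefold over \<open>t0\<close> to the one over a nearby
  \<open>t\<close>: the coordinates \<open>u, v, X\<close> of a point are kept and \<open>Y\<close> follows the branch of the square root
  that is continuous in \<open>t\<close>; the quotient under the root is 1 at \<open>t = t0\<close>. Since cycles are compact,
  this is defined on a whole cycle for \<open>t\<close> close to \<open>t0\<close>.
\<close>

definition transport :: "complex poly \<Rightarrow> complex poly \<Rightarrow> complex \<Rightarrow> complex \<Rightarrow> point \<Rightarrow> point" where
  "transport g2 g3 t0 t = (\<lambda>(bs, X, Y).
     let f = (\<lambda>t. 4 * X ^ 3 - cy3_coeff 4 g2 t bs * X - cy3_coeff 6 g3 t bs)
     in (bs, X, Y * csqrt (f t / f t0)))"

text \<open>The germ at \<open>t0\<close> of the period function of a 3-cycle on the threefold over \<open>t0\<close>.\<close>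

definition period_function ::
  "complex poly \<Rightarrow> complex poly \<Rightarrow> complex \<Rightarrow> (cube \<Rightarrow>\<^sub>0 int) \<Rightarrow> complex \<Rightarrow> complex" where
  "period_function g2 g3 t0 \<Gamma> t =
     (\<Sum>c \<in> Poly_Mapping.keys \<Gamma>.
        of_int (Poly_Mapping.lookup \<Gamma> c) * period3 (transport g2 g3 t0 t \<circ> c))"


section \<open>Warped products\<close>

text \<open>
  Warped product of the circle \<open>|v| = 1/2\<close> with a family of (parametrised) cycles: the cycle over
  the point \<open>v\<close> is the given one at parameter \<open>twist_param t v\<close>, rescaled. Note that
  \<open>|twist_param t v| \<le> |t|\<close> on the circle.
\<close>

definition warped_product :: "(complex \<Rightarrow> 'p \<Rightarrow> point) \<Rightarrow> complex \<Rightarrow> real \<times> 'p \<Rightarrow> point" where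
  "warped_product \<Sigma> t = (\<lambda>(r, p). let v = circlepath 0 (1 / 2) r in
     case \<Sigma> (twist_param t v) p of (bs, x, y) \<Rightarrow>
       (v # bs, (v * (v + 1))\<^sup>2 * x, (v * (v + 1)) ^ 3 * y))"

definition Sigma3 :: "(complex \<Rightarrow> real \<Rightarrow> point) \<Rightarrow> complex \<Rightarrow> cube" where
  "Sigma3 \<Sigma>\<^sub>1 = warped_product (warped_product \<Sigma>\<^sub>1)"

end

(*
  The one-form dx/y of a surface with four multiplicative fibres and Euler number 12 satisfies the
  Gauss-Manin system with regular polynomial data; eliminating the second-kind form gives Heun's
  operator applied to 1/y as an x-derivative that is regular wherever y is nonzero. The accessory
  parameter of this operator is identified by the normalized period over the A-cycle.
  Each twist contributes an exact form that replaces multiplication by s under the integral by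
  t (theta + 1/2) / theta, so that theta^2 composed with Heun's operator becomes the fourth-order operator;
  Stokes' theorem on singular cubes removes the exact forms.
  On power series the twist multiplies the n-th coefficient by 2 pi i (1/2)_n / n!, and the
  symmetric square of Heun's equation with delta = epsilon = 1/2 accounts for one of the two factors.
*)

theory Submission
  imports Defs "HOL-Computational_Algebra.Field_as_Ring"
begin

section \<open>Weierstrass coefficients and the Gauss-Manin system\<close>

text \<open>No explicit Weierstrass equations enter. Fibre types and degree bounds alone make the
  connection matrix polynomial up to the denominator t (t - 1) (t - a), and they fix the operator
  except for one constant; this is why the tabulated q has to be recovered from a single known
  period. A general three-cycle is not a warped product, so its period cannot be integrated one
  twist at a time. All relations are proved for three-forms in u, v, x, where x, y are the unscaled
  coordinates of the elliptic curve and s = t / (16 u (u + 1) v (v + 1)) is its parameter. Division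
  by theta has no meaning for such integrals; after composition with theta^2 on the left only
  multiplications by t and powers of theta + 1/2 remain, and two weights in u, v suffice to express
  the reduction. Cubes are closed, so derivatives are taken within them and carried along as
  explicit families. The coordinate y is a branch of a square root; it stays continuous and nonzero
  because t is kept close to t0.\<close>

lemma nonunit_poly_has_root:
  fixes p :: "complex poly"
  assumes "\<not> p dvd 1"
  shows "\<exists>z. poly p z = 0"
proof (cases "degree p = 0")
  case True
  then obtain k where "p = [:k:]" by (rule degree_eq_zeroE)
  with assms have "p = 0" by (cases "k = 0") (auto simp: is_unit_const_poly_iff dvd_field_iff)
  then show ?thesis by simp
next
  case False
  then show ?thesis
    using fundamental_theorem_of_algebra[of p] by (simp add: constant_degree)
qed

lemma coprime_poly_no_common_root:
  fixes p r :: "complex poly"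
  assumes "\<And>z. poly p z = 0 \<Longrightarrow> poly r z \<noteq> 0"
  shows "coprime p r"
proof (rule coprimeI)
  fix c assume "c dvd p" "c dvd r"
  then show "c dvd 1"
    using assms nonunit_poly_has_root[of c] by (metis dvd_trans poly_eq_0_iff_dvd)
qed

definition cubic_discr :: "complex \<Rightarrow> complex poly" where
  "cubic_discr a = [:0, 1:] * [:- 1, 1:] * [:- a, 1:]"

lemma poly_cubic_discr: "poly (cubic_discr a) z = z * (z - 1) * (z - a)"
  by (simp add: cubic_discr_def algebra_simps)

definition log_deriv_num :: "complex \<Rightarrow> nat \<Rightarrow> nat \<Rightarrow> nat \<Rightarrow> complex poly" where
  "log_deriv_num a n0 n1 na =
     of_nat n0 * ([:- 1, 1:] * [:- a, 1:]) + of_nat n1 * ([:0, 1:] * [:- a, 1:])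
       + of_nat na * ([:0, 1:] * [:- 1, 1:])"

lemma poly_eqI_poly:
  fixes p r :: "complex poly"
  assumes "\<And>z. poly p z = poly r z"
  shows "p = r"
  using assms by (metis poly_eq_poly_eq_iff ext)

lemma coeff_mult_degree_le:
  assumes "degree p \<le> m" "degree r \<le> n"
  shows "coeff (p * r) (m + n) = coeff p m * coeff r n"
proof (cases "degree p = m \<and> degree r = n")
  case True
  then show ?thesis using coeff_mult_degree_sum[of p r] by auto
next
  case False
  then have "degree (p * r) < m + n"
    using assms degree_mult_le[of p r] by linarith
  moreover have "coeff p m = 0 \<or> coeff r n = 0"
    using False assms by (metis coeff_eq_0 le_neq_implies_less)
  ultimately show ?thesis by (auto simp: coeff_eq_0)
qed

text \<open>Three pairwise coprime powers divide the discriminant, and n0 + n1 + na = 12 - ni is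
  already its degree. The cofactor is therefore constant.\<close>

lemma surface_discriminant:
  assumes surface: "rational_elliptic_surface a (n0, n1, na, ni) g2 g3"
    and a: "a \<noteq> 0" "a \<noteq> 1" and sum: "n0 + n1 + na + ni = 12"
  obtains C where "C \<noteq> 0"
    "wdiscr g2 g3 = smult C ([:0, 1:] ^ n0 * [:- 1, 1:] ^ n1 * [:- a, 1:] ^ na)"
proof -
  let ?P = "[:0, 1:] ^ n0 * [:- 1, 1:] ^ n1 * [:- a, 1:] ^ na"
  let ?W = "wdiscr g2 g3"
  have W: "?W \<noteq> 0" and o: "order 0 ?W = n0" "order 1 ?W = n1" "order a ?W = na"
    and deg: "degree ?W + ni = 12"
    using surface by (auto simp: rational_elliptic_surface_def fiber_I_def fiber_I_infinity_def)
  have d: "[:0, 1:] ^ n0 dvd ?W" "[:- 1, 1:] ^ n1 dvd ?W" "[:- a, 1:] ^ na dvd ?W"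
    using order_1[of 0 ?W] order_1[of 1 ?W] order_1[of a ?W] o by simp_all
  have c: "coprime [:0, 1:] [:- 1, 1::complex:]" "coprime [:0, 1:] [:- a, 1:]"
      "coprime [:- 1, 1:] [:- a, 1:]"
    using a by (auto intro!: coprime_poly_no_common_root)
  have "[:0, 1:] ^ n0 * [:- 1, 1:] ^ n1 dvd ?W"
    using d c by (auto intro!: divides_mult simp: coprime_power_left_iff coprime_power_right_iff)
  then have "?P dvd ?W"
    using d c by (auto intro!: divides_mult
        simp: coprime_power_left_iff coprime_power_right_iff simp del: mult_pCons_left mult_pCons_right)
  then obtain k where k: "?W = ?P * k" by (auto elim: dvdE)
  have "degree ?P = n0 + n1 + na"
    by (simp add: degree_mult_eq degree_power_eq)
  moreover have "degree ?W = degree ?P + degree k"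
    using k W by (auto simp: degree_mult_eq)
  ultimately have "degree k = 0" using deg sum by simp
  then obtain C where "k = [:C:]" by (rule degree_eq_zeroE)
  with k W have "?W = smult C ?P" "C \<noteq> 0" by (auto simp: mult_ac)
  then show ?thesis using that by blast
qed

lemma poly_pderiv_linear_power:
  "poly (pderiv ([:- c, 1:] ^ n)) z * (z - c) = of_nat n * (z - c) ^ n" for c z :: complex
proof (cases n)
  case (Suc m)
  have "pderiv ([:- c, 1:] ^ Suc m) = smult (of_nat (Suc m)) ([:- c, 1:] ^ m)"
    by (subst pderiv_power_Suc) (simp add: pderiv_pCons)
  then show ?thesis using Suc by simp
qed simp

lemma poly_linear: "poly [:- c, 1:] z = z - c" "poly [:0, 1:] z = z" "poly [:- 1, 1:] z = z - 1"
  for c z :: complex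
  by simp_all

lemma log_deriv_algebra:
  fixes z :: complex
  assumes "p0 * z = m0 * e0" "p1 * (z - 1) = m1 * e1" "pa * (z - a) = ma * ea"
  shows "z * (z - 1) * (z - a) * (C * (e0 * e1 * pa + ea * (e0 * p1 + e1 * p0)))
    = (m0 * ((z - 1) * (z - a)) + m1 * (z * (z - a)) + ma * (z * (z - 1))) * (C * (e0 * e1 * ea))"
proof -
  have "z * (z - 1) * (z - a) * (C * (e0 * e1 * pa + ea * (e0 * p1 + e1 * p0)))
    = C * (z * (z - 1) * e0 * e1 * (pa * (z - a)) + z * (z - a) * ea * e0 * (p1 * (z - 1))
        + (z - 1) * (z - a) * ea * e1 * (p0 * z))"
    by (simp add: algebra_simps)
  also have "\<dots> = (m0 * ((z - 1) * (z - a)) + m1 * (z * (z - a)) + ma * (z * (z - 1)))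
      * (C * (e0 * e1 * ea))"
    unfolding assms by (simp add: algebra_simps)
  finally show ?thesis .
qed

lemma surface_discriminant_pderiv:
  assumes "wdiscr g2 g3 = smult C ([:0, 1:] ^ n0 * [:- 1, 1:] ^ n1 * [:- a, 1:] ^ na)"
  shows "cubic_discr a * pderiv (wdiscr g2 g3) = log_deriv_num a n0 n1 na * wdiscr g2 g3"
proof (rule poly_eqI_poly)
  fix z
  have p: "poly (pderiv ([:0, 1:] ^ n0)) z * z = of_nat n0 * z ^ n0"
    "poly (pderiv ([:- 1, 1:] ^ n1)) z * (z - 1) = of_nat n1 * (z - 1) ^ n1"
    "poly (pderiv ([:- a, 1:] ^ na)) z * (z - a) = of_nat na * (z - a) ^ na"
    using poly_pderiv_linear_power[of 0 n0 z] poly_pderiv_linear_power[of 1 n1 z]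
      poly_pderiv_linear_power[of a na z] by simp_all
  show "poly (cubic_discr a * pderiv (wdiscr g2 g3)) z
      = poly (log_deriv_num a n0 n1 na * wdiscr g2 g3) z"
    unfolding assms pderiv_smult pderiv_mult poly_mult poly_smult poly_add poly_cubic_discr poly_power
      log_deriv_num_def poly_of_nat poly_linear by (rule log_deriv_algebra[OF p])
qed

text \<open>Write D for \<open>cubic_discr a\<close>. Modulo exact forms, omega = dx/y and eta = x
  dx/y satisfy D omega' = A omega + b eta and D eta' = - (b/12) g2 omega - A eta; the first two
  equations express this through g2 and g3. The product D E is minus the determinant of this matrix,
  so (D omega')' = (A' + E) omega, and the last equation turns this into Heun's equation with
  accessory parameter q.\<close>

definition gauss_manin :: "complex \<Rightarrow> complex \<Rightarrow> complex poly \<Rightarrow> complex poly \<Rightarrow>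
    complex poly \<Rightarrow> complex poly \<Rightarrow> complex \<Rightarrow> bool" where
  "gauss_manin a q g2 g3 A E b \<longleftrightarrow>
     cubic_discr a * pderiv g2 = smult (6 * b) g3 - 4 * A * g2 \<and>
     cubic_discr a * pderiv g3 = smult (b / 3) (g2 ^ 2) - 6 * A * g3 \<and>
     cubic_discr a * E = A ^ 2 - smult (b ^ 2 / 12) g2 \<and>
     pderiv A + E = [:q, - 1:]"

text \<open>Replacing N W by D W' cancels the terms free of y. With x = g2 and y = g3 this exhibits
  the factor g3 on the right, from which divisibility of 3 D g2' - g2 N by g3 follows.\<close>

lemma gauss_manin_algebra1:
  fixes D :: complex
  assumes "D * (3 * x ^ 2 * x' - 54 * y * y') = N * (x ^ 3 - 27 * y ^ 2)"
  shows "(x ^ 3 - 27 * y ^ 2) * (3 * D * x' - x * N) = y * (- 27 * D * (3 * y * x' - 2 * x * y'))"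
proof -
  have "(x ^ 3 - 27 * y ^ 2) * (3 * D * x' - x * N)
      = (x ^ 3 - 27 * y ^ 2) * 3 * D * x' - x * (N * (x ^ 3 - 27 * y ^ 2))"
    by (simp add: algebra_simps)
  also have "\<dots> = y * (- 27 * D * (3 * y * x' - 2 * x * y'))"
    unfolding assms[symmetric] by (simp add: algebra_simps power2_eq_square power3_eq_cube)
  finally show ?thesis .
qed

lemma gauss_manin_algebra2:
  fixes D :: complex
  assumes "D * (3 * x ^ 2 * x' - 54 * y * y') = - 12 * A * (x ^ 3 - 27 * y ^ 2)"
    and r1: "D * x' = 6 * b * y - 4 * A * x"
  shows "y * (D * y') = y * (b / 3 * x ^ 2 - 6 * A * y)"
proof -
  have "54 * (y * (D * y')) = 3 * x ^ 2 * (D * x') - D * (3 * x ^ 2 * x' - 54 * y * y')"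
    by (simp add: algebra_simps)
  also have "\<dots> = 54 * (y * (b / 3 * x ^ 2 - 6 * A * y))"
    unfolding assms by (simp add: algebra_simps power2_eq_square power3_eq_cube)
  finally show ?thesis by simp
qed

text \<open>Here x, y, A stand for the top coefficients of g2, g3 and A. The second hypothesis is
  the vanishing of the discriminant at infinity; with 6 b y = 4 x (1 + A) it gives b^2 x = 12 (1 +
  A)^2.\<close>

lemma infinity_algebra:
  fixes b :: complex
  assumes "4 * x = 6 * b * y - 4 * A * x" "27 * y ^ 2 = x ^ 3" "x \<noteq> 0"
  shows "A ^ 2 - b ^ 2 / 12 * x = - 1 - 2 * A"
proof -
  have 1: "6 * b * y = 4 * x * (1 + A)" using assms(1) by (simp add: algebra_simps)
  have "x ^ 2 * (b ^ 2 * x) = b ^ 2 * (27 * y ^ 2)"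
    unfolding assms(2) by (simp add: power2_eq_square power3_eq_cube mult_ac)
  also have "\<dots> = 3 / 4 * (6 * b * y) ^ 2"
    by (simp add: power_mult_distrib)
  also have "\<dots> = x ^ 2 * (12 * (1 + A) ^ 2)"
    unfolding 1 power_mult_distrib by simp
  finally have "b ^ 2 * x = 12 * (1 + A) ^ 2"
    using assms(3) mult_left_cancel[of "x ^ 2" "b ^ 2 * x"] by simp
  moreover have "b ^ 2 / 12 * x = (b ^ 2 * x) / 12" by simp
  ultimately have "A ^ 2 - b ^ 2 / 12 * x = A ^ 2 - (1 + A) ^ 2" by simp
  then show ?thesis by (simp add: power2_eq_square algebra_simps)
qed

text \<open>The multiplicative fibres force the quotients that define b and E to be polynomials:
  wherever the discriminant vanishes, infinity included, g2 and hence g3 does not. Comparison at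
  infinity fixes the linear coefficient of A' + E, and its constant term is returned as q.\<close>

lemma surface_gauss_manin:
  assumes surface: "rational_elliptic_surface a (n0, n1, na, ni) g2 g3"
    and a: "a \<noteq> 0" "a \<noteq> 1" and sum: "n0 + n1 + na + ni = 12"
  obtains q A E b where "gauss_manin a q g2 g3 A E b"
proof -
  let ?W = "wdiscr g2 g3" and ?D = "cubic_discr a" and ?N = "log_deriv_num a n0 n1 na"
  from surface_discriminant[OF assms] obtain C where C: "C \<noteq> 0" and
    WC: "?W = smult C ([:0, 1:] ^ n0 * [:- 1, 1:] ^ n1 * [:- a, 1:] ^ na)" .
  have D': "?D * pderiv ?W = ?N * ?W" by (rule surface_discriminant_pderiv[OF WC])
  have surf: "degree g2 \<le> 4" "degree g3 \<le> 6" "?W \<noteq> 0" "n0 \<ge> 1" "n1 \<ge> 1" "na \<ge> 1" "ni \<ge> 1"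
    "poly g2 0 \<noteq> 0" "poly g2 1 \<noteq> 0" "poly g2 a \<noteq> 0" "coeff g2 4 \<noteq> 0" "degree ?W + ni = 12"
    using surface by (auto simp: rational_elliptic_surface_def fiber_I_def fiber_I_infinity_def)
  have W0: "poly ?W z = 0 \<longleftrightarrow> z \<in> {0, 1, a}" for z
    unfolding WC using C surf by (auto simp: poly_power)
  have g20: "poly g2 z \<noteq> 0" if "z \<in> {0, 1, a}" for z using that surf by auto
  have pW: "poly ?W z = poly g2 z ^ 3 - 27 * poly g3 z ^ 2" for z
    unfolding wdiscr_def by (simp only: poly_diff poly_mult poly_power poly_numeral)
  have "coprime g3 ?W"
  proof (rule coprime_poly_no_common_root, rule notI)
    fix z assume z: "poly g3 z = 0" "poly ?W z = 0"
    then have "poly g2 z \<noteq> 0" using W0 g20 by blast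
    then show False using z by (simp add: pW)
  qed
  define R where "R = 3 * ?D * pderiv g2 - g2 * ?N"
  have "?W * R = g3 * (- 27 * ?D * (3 * g3 * pderiv g2 - 2 * g2 * pderiv g3))"
  proof (rule poly_eqI_poly)
    fix z
    have *: "poly ?D z * (3 * poly g2 z ^ 2 * poly (pderiv g2) z
         - 54 * poly g3 z * poly (pderiv g3) z) = poly ?N z * (poly g2 z ^ 3 - 27 * poly g3 z ^ 2)"
      using arg_cong[OF D', of "\<lambda>p. poly p z"]
      by (simp add: wdiscr_def pderiv_diff pderiv_mult power3_eq_cube power2_eq_square algebra_simps)
    show "poly (?W * R) z = poly (g3 * (- 27 * ?D * (3 * g3 * pderiv g2 - 2 * g2 * pderiv g3))) z"
      unfolding R_def poly_mult poly_diff poly_minus poly_numeral pW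
      by (rule gauss_manin_algebra1[OF *])
  qed
  then have "g3 dvd ?W * R" by simp
  with \<open>coprime g3 ?W\<close> have "g3 dvd R" by (simp add: coprime_dvd_mult_right_iff)
  then obtain k where k: "R = g3 * k" by (auto elim: dvdE)
  have degD: "degree ?D = 3" "coeff ?D 3 = 1"
    by (simp_all add: cubic_discr_def numeral_3_eq_3)
  have c12: "coeff ?W 12 = coeff g2 4 ^ 3 - 27 * coeff g3 6 ^ 2"
  proof -
    have "coeff (g2 * g2) 8 = coeff g2 4 * coeff g2 4" "degree (g2 * g2) \<le> 8"
      using coeff_mult_degree_le[of g2 4 g2 4] surf degree_mult_le[of g2 g2] by auto
    then have "coeff (g2 * (g2 * g2)) 12 = coeff g2 4 ^ 3"
      using coeff_mult_degree_le[of g2 4 "g2 * g2" 8] surf by (simp add: power3_eq_cube)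
    moreover have "coeff (g3 * g3) 12 = coeff g3 6 ^ 2"
      using coeff_mult_degree_le[of g3 6 g3 6] surf by (simp add: power2_eq_square)
    moreover have "wdiscr g2 g3 = g2 * (g2 * g2) - smult 27 (g3 * g3)"
      by (simp add: wdiscr_def power3_eq_cube power2_eq_square numeral_mult_conv_smult mult.assoc)
    ultimately show ?thesis by simp
  qed
  \<comment> \<open>A fibre of type I_n with n > 0 at infinity keeps the degree of the discriminant
    below 12, so its coefficient at 12 vanishes.\<close>
  have g36: "27 * coeff g3 6 ^ 2 = coeff g2 4 ^ 3"
    using c12 surf coeff_eq_0[of ?W 12] by simp
  then have "coeff g3 6 \<noteq> 0" using surf by auto
  then have "degree g3 = 6" using surf le_degree by (metis le_antisym)
  have degN: "degree ?N \<le> 2"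
    unfolding log_deriv_num_def
    by (intro degree_add_le order_trans[OF degree_mult_le]) (simp_all add: degree_of_nat)
  have degg2': "degree (pderiv g2) \<le> 3" using surf by (simp add: degree_pderiv)
  have "degree (3 * ?D * pderiv g2) \<le> 6"
    using degD degg2' degree_mult_le[of ?D "pderiv g2"]
    by (simp add: numeral_mult_conv_smult mult.assoc)
  moreover have "degree (g2 * ?N) \<le> 6"
    using degN surf degree_mult_le[of g2 ?N] by simp
  \<comment> \<open>Since \<open>g3\<close> has degree exactly 6 and divides \<open>R\<close>, the
    quotient is constant.\<close>
  ultimately have "degree R \<le> 6" unfolding R_def by (intro degree_diff_le)
  moreover have "degree R = 6 + degree k" if "k \<noteq> 0"
    using that k \<open>degree g3 = 6\<close> by (metis degree_0 degree_mult_eq zero_neq_numeral)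
  ultimately have "degree k = 0" by (cases "k = 0") auto
  then obtain b0 where "k = [:b0:]" by (rule degree_eq_zeroE)
  \<comment> \<open>Dividing \<open>R\<close> = 18 b g3 by 3 produces the coefficient 6 b, and the
    term g2 N / 3 becomes - 4 A g2 with A = - N / 12; the 12 is the weight of the
    discriminant.\<close>
  define b where "b = b0 / 18"
  define A where "A = smult (- 1 / 12) ?N"
  have "R = smult (18 * b) g3" using k \<open>k = [:b0:]\<close> by (simp add: b_def)
  have r1z: "poly ?D z * poly (pderiv g2) z = 6 * b * poly g3 z - 4 * poly A z * poly g2 z" for z
    using arg_cong[OF \<open>R = smult (18 * b) g3\<close>, of "\<lambda>p. poly p z"]
    by (simp add: R_def A_def field_simps)
  have r1: "?D * pderiv g2 = smult (6 * b) g3 - 4 * A * g2"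
    by (rule poly_eqI_poly) (simp add: r1z)
  have r2: "?D * pderiv g3 = smult (b / 3) (g2 ^ 2) - 6 * A * g3"
  proof -
    have "g3 * (?D * pderiv g3) = g3 * (smult (b / 3) (g2 ^ 2) - 6 * A * g3)"
    proof (rule poly_eqI_poly)
      fix z
      have *: "poly ?D z * (3 * poly g2 z ^ 2 * poly (pderiv g2) z
         - 54 * poly g3 z * poly (pderiv g3) z) = - 12 * poly A z * (poly g2 z ^ 3 - 27 * poly g3 z ^ 2)"
        using arg_cong[OF D', of "\<lambda>p. poly p z"]
        by (simp add: A_def wdiscr_def pderiv_diff pderiv_mult power3_eq_cube power2_eq_square algebra_simps)
      show "poly (g3 * (?D * pderiv g3)) z = poly (g3 * (smult (b / 3) (g2 ^ 2) - 6 * A * g3)) z"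
        using gauss_manin_algebra2[OF * r1z] by (simp add: poly_power)
    qed
    moreover have "g3 \<noteq> 0" using \<open>degree g3 = 6\<close> by auto
    ultimately show ?thesis by simp
  qed
  let ?T = "A ^ 2 - smult (b ^ 2 / 12) g2"
  \<comment> \<open>At a root of \<open>?D\<close> the first relation reads 6 b g3 = 4 A g2, and
    there g2^3 = 27 g3^2. Squaring the former gives 16 g2^2 times \<open>?T\<close> equal to 0, with
    g2 nonzero.\<close>
  have T0: "poly ?T z = 0" if "z \<in> {0, 1, a}" for z
  proof -
    have "poly ?D z = 0" using that by (auto simp: poly_cubic_discr)
    with r1z[of z] have 1: "6 * b * poly g3 z = 4 * poly A z * poly g2 z" by simp
    have 2: "poly g2 z ^ 3 = 27 * poly g3 z ^ 2" using W0[of z] that pW[of z] by auto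
    have "16 * poly g2 z ^ 2 * (poly A z ^ 2 - b ^ 2 / 12 * poly g2 z) =
        (4 * poly A z * poly g2 z) ^ 2 - 4 / 3 * b ^ 2 * poly g2 z ^ 3"
      by (simp add: field_simps power2_eq_square power3_eq_cube)
    also have "\<dots> = 0"
      unfolding 1[symmetric] 2 by (simp add: power2_eq_square)
    finally have "16 * poly g2 z ^ 2 * (poly A z ^ 2 - b ^ 2 / 12 * poly g2 z) = 0" .
    then show ?thesis using g20[OF that] by (simp add: poly_power)
  qed
  have c: "coprime [:0, 1:] [:- 1, 1::complex:]" "coprime [:0, 1:] [:- a, 1:]"
      "coprime [:- 1, 1:] [:- a, 1:]"
    using a by (auto intro!: coprime_poly_no_common_root)
  have dT: "[:- z, 1:] dvd ?T" if "z \<in> {0, 1, a}" for z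
    using T0[OF that] unfolding poly_eq_0_iff_dvd .
  have dT: "[:0, 1:] dvd ?T" "[:- 1, 1:] dvd ?T" "[:- a, 1:] dvd ?T"
    using dT[of 0] dT[of 1] dT[of a] by auto
  have "coprime ([:0, 1:] * [:- 1, 1:]) [:- a, 1:]"
    using c unfolding coprime_mult_left_iff by blast
  then have "?D dvd ?T"
    unfolding cubic_discr_def by (rule divides_mult[OF divides_mult[OF dT(1,2) c(1)] dT(3)])
  then obtain E where "?T = ?D * E" by (rule dvdE)
  then have E: "?D * E = ?T" by (rule sym)
  have degA: "degree A \<le> 2" using degN by (simp add: A_def)
  have "degree (A ^ 2) \<le> 4" using degA degree_mult_le[of A A] by (simp add: power2_eq_square)
  then have "degree ?T \<le> 4" using surf by (intro degree_diff_le) (auto intro: order_trans[OF degree_smult_le])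
  have "degree E \<le> 1"
  proof (cases "E = 0")
    case False
    then have "degree (?D * E) = 3 + degree E" using degD by (subst degree_mult_eq) auto
    then show ?thesis using E \<open>degree ?T \<le> 4\<close> by simp
  qed simp
  with degD have "coeff (?D * E) (3 + 1) = coeff ?D 3 * coeff E 1"
    by (intro coeff_mult_degree_le) simp_all
  then have E1: "coeff E 1 = coeff ?T 4"
    unfolding E degD by simp
  have "coeff (A ^ 2) 4 = coeff A 2 ^ 2"
    using coeff_mult_degree_le[OF degA degA] by (simp add: power2_eq_square)
  then have E1': "coeff E 1 = coeff A 2 ^ 2 - b ^ 2 / 12 * coeff g2 4"
    unfolding E1 coeff_diff coeff_smult by (rule arg_cong2[where f = minus]) (rule refl)
  have "coeff (?D * pderiv g2) (3 + 3) = coeff ?D 3 * coeff (pderiv g2) 3"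
    using degD(1) degg2' by (intro coeff_mult_degree_le) simp_all
  then have c1: "coeff (?D * pderiv g2) 6 = 4 * coeff g2 4"
    unfolding degD(2) by (simp add: coeff_pderiv)
  have "coeff (A * g2) (2 + 4) = coeff A 2 * coeff g2 4"
    by (rule coeff_mult_degree_le[OF degA surf(1)])
  then have c2: "coeff (4 * A * g2) 6 = 4 * coeff A 2 * coeff g2 4"
    unfolding mult.assoc[of 4] numeral_mult_conv_smult coeff_smult by simp
  have "4 * coeff g2 4 = 6 * b * coeff g3 6 - 4 * coeff A 2 * coeff g2 4"
    using c1 unfolding r1 coeff_diff coeff_smult c2 by (rule sym)
  from infinity_algebra[OF this g36 surf(11)]
  have e1: "coeff E 1 = - 1 - 2 * coeff A 2"
    unfolding E1' .
  \<comment> \<open>The linear coefficient is 2 A_2 + (- 1 - 2 A_2) = - 1, whatever the fibre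
    numbers are.\<close>
  have "pderiv A + E = [:coeff (pderiv A + E) 0, - 1:]"
  proof (rule poly_eqI)
    fix n :: nat
    consider "n = 0" | "n = 1" | "n \<ge> 2" by linarith
    then show "coeff (pderiv A + E) n = coeff [:coeff (pderiv A + E) 0, - 1:] n"
    proof cases
      case 2
      then show ?thesis using e1 by (simp add: coeff_pderiv numeral_2_eq_2)
    next
      case 3
      have "coeff E n = 0" using 3 \<open>degree E \<le> 1\<close> by (intro coeff_eq_0) linarith
      moreover have "coeff A (Suc n) = 0" using 3 degA by (intro coeff_eq_0) linarith
      ultimately show ?thesis using 3
        by (cases n) (auto simp: coeff_pderiv coeff_pCons split: nat.split)
    qed simp
  qed
  then show ?thesis using that r1 r2 E unfolding gauss_manin_def by blast
qed

section \<open>Exactness of the Heun operator applied to the one-form\<close>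

definition weier :: "complex poly \<Rightarrow> complex poly \<Rightarrow> complex \<Rightarrow> complex \<Rightarrow> complex" where
  "weier g2 g3 s x = 4 * x ^ 3 - poly g2 s * x - poly g3 s"

text \<open>
  Expressions in \<open>s\<close>, \<open>x\<close> and \<open>1 / y\<close>, with their total derivatives on the surface
  \<open>y\<^sup>2 = 4 x\<^sup>3 - g2(s) x - g3(s)\<close>.
\<close>

datatype rexp = RPoly "complex poly" | RX | RIY | RAdd rexp rexp | RMul rexp rexp

primrec reval :: "rexp \<Rightarrow> complex \<Rightarrow> complex \<Rightarrow> complex \<Rightarrow> complex" where
  "reval (RPoly p) s x y = poly p s"
| "reval RX s x y = x"
| "reval RIY s x y = inverse y"
| "reval (RAdd e f) s x y = reval e s x y + reval f s x y"
| "reval (RMul e f) s x y = reval e s x y * reval f s x y"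

text \<open>The clause for 1/y is implicit differentiation at fixed x: 2 y y_s = - (g2' x + g3'),
  hence the factor y^-3. \<open>deriv_x\<close> treats 1/y in the same way at fixed s.\<close>

primrec deriv_s :: "complex poly \<Rightarrow> complex poly \<Rightarrow> rexp \<Rightarrow> rexp" where
  "deriv_s g2 g3 (RPoly p) = RPoly (pderiv p)"
| "deriv_s g2 g3 RX = RPoly 0"
| "deriv_s g2 g3 RIY = RMul (RAdd (RMul (RPoly (smult (1 / 2) (pderiv g2))) RX)
     (RPoly (smult (1 / 2) (pderiv g3)))) (RMul RIY (RMul RIY RIY))"
| "deriv_s g2 g3 (RAdd e f) = RAdd (deriv_s g2 g3 e) (deriv_s g2 g3 f)"
| "deriv_s g2 g3 (RMul e f) = RAdd (RMul (deriv_s g2 g3 e) f) (RMul e (deriv_s g2 g3 f))"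

primrec deriv_x :: "complex poly \<Rightarrow> complex poly \<Rightarrow> rexp \<Rightarrow> rexp" where
  "deriv_x g2 g3 (RPoly p) = RPoly 0"
| "deriv_x g2 g3 RX = RPoly 1"
| "deriv_x g2 g3 RIY = RMul (RAdd (RPoly (smult (1 / 2) g2)) (RMul (RPoly [:- 6:]) (RMul RX RX)))
     (RMul RIY (RMul RIY RIY))"
| "deriv_x g2 g3 (RAdd e f) = RAdd (deriv_x g2 g3 e) (deriv_x g2 g3 f)"
| "deriv_x g2 g3 (RMul e f) = RAdd (RMul (deriv_x g2 g3 e) f) (RMul e (deriv_x g2 g3 f))"

abbreviation RConst :: "complex \<Rightarrow> rexp" where "RConst c \<equiv> RPoly [:c:]"
abbreviation RS :: rexp where "RS \<equiv> RPoly [:0, 1:]"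

definition theta_s :: "complex poly \<Rightarrow> complex poly \<Rightarrow> rexp \<Rightarrow> rexp" where
  "theta_s g2 g3 e = RMul RS (deriv_s g2 g3 e)"

text \<open>The third hypothesis is the differentiated curve equation, for arbitrary dependence of s
  and x on p. One chain rule thus serves for differentiation in t, along the A-cycle and along
  cubes.\<close>

lemma has_derivative_reval:
  assumes "(\<sigma> has_derivative \<sigma>') (at p within S)" "(\<xi> has_derivative \<xi>') (at p within S)"
    and "(\<eta> has_derivative (\<lambda>h. (- (poly (pderiv g2) (\<sigma> p) * \<xi> p + poly (pderiv g3) (\<sigma> p)) * \<sigma>' h
          + (12 * \<xi> p ^ 2 - poly g2 (\<sigma> p)) * \<xi>' h) / (2 * \<eta> p))) (at p within S)"
    and y: "\<eta> p \<noteq> 0"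
  shows "((\<lambda>z. reval e (\<sigma> z) (\<xi> z) (\<eta> z)) has_derivative
           (\<lambda>h. reval (deriv_s g2 g3 e) (\<sigma> p) (\<xi> p) (\<eta> p) * \<sigma>' h
              + reval (deriv_x g2 g3 e) (\<sigma> p) (\<xi> p) (\<eta> p) * \<xi>' h)) (at p within S)"
proof (induction e)
  case (RPoly q)
  have "((\<lambda>z. poly q z) has_field_derivative poly (pderiv q) (\<sigma> p)) (at (\<sigma> p))"
    by (rule poly_DERIV)
  from has_derivative_compose[OF assms(1) this[unfolded has_field_derivative_def]]
  show ?case by (simp add: mult.commute)
next
  case RX
  then show ?case using assms(2) by simp
next
  case RIY
  show ?case
    by (rule has_derivative_eq_rhs, simp, rule Deriv.has_derivative_inverse[OF y assms(3)])
       (use y in \<open>auto simp: fun_eq_iff field_simps power2_eq_square\<close>)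
next
  case (RAdd e f)
  show ?case
    by (rule has_derivative_eq_rhs, simp, rule has_derivative_add[OF RAdd])
       (auto simp: algebra_simps)
next
  case (RMul e f)
  show ?case
    by (rule has_derivative_eq_rhs, simp, rule has_derivative_mult[OF RMul])
       (auto simp: algebra_simps)
qed

text \<open>Heun's operator applied to 1/y, multiplied by y^5, with F = y^2; p, r and p3, r3 are
  first and second derivatives of g2 and g3. The right side is y^5 times the x-derivative of
  (linear)/y + (cubic)/y^3. The hypotheses are the connection equations, their derivatives, the Heun
  condition and two syzygies.\<close>

lemma picard_fuchs_algebra:
  fixes x :: complex
  assumes h1: "D * p = 6 * b * g3 - 4 * A * g2"
    and h2: "D * p3 = b / 3 * g2 ^ 2 - 6 * A * g3"
    and h3: "d * p + D * r = 6 * b * p3 - 4 * A' * g2 - 4 * A * p"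
    and h4: "d * p3 + D * r3 = 2 * b / 3 * g2 * p - 6 * A' * g3 - 6 * A * p3"
    and h5: "A' + E = q - s"
    and h6: "A * p + b * p3 = - 4 * g2 * E"
    and h7: "A * p3 + b / 12 * g2 * p = - 6 * g3 * E"
    and F: "F = 4 * x ^ 3 - g2 * x - g3"
  shows "D * (3 / 4 * (p * x + p3) ^ 2 + (r * x + r3) / 2 * F) + d * (p * x + p3) / 2 * F + (s - q) * F ^ 2
    = 2 * (q - s) * F ^ 2 + (b / 4 * p + 2 * (q - s) * x) * (g2 / 2 - 6 * x ^ 2) * F
      + ((2 * A - 4 * b * x) * (p * x + p3) / 2 + (b / 3 * g2 + 2 * A * x - 2 * b * x ^ 2) * p / 2) * F
      + 3 * (b / 3 * g2 + 2 * A * x - 2 * b * x ^ 2) * (p * x + p3) / 2 * (g2 / 2 - 6 * x ^ 2)"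
    (is "?L = ?R")
proof -
  have q: "s - q = - (A' + E)" "q - s = A' + E" using h5 by (auto simp: algebra_simps)
  have "?L = 3 / 4 * (p * x + p3) * ((D * p) * x + D * p3)
      + F / 2 * ((d * p + D * r) * x + (d * p3 + D * r3)) + (s - q) * F ^ 2"
    by (simp add: algebra_simps power2_eq_square add_divide_distrib)
  also have "\<dots> = 3 / 4 * (p * x + p3) * ((6 * b * g3 - 4 * A * g2) * x + (b / 3 * g2 ^ 2 - 6 * A * g3))
      + F / 2 * ((6 * b * p3 - 4 * A' * g2 - 4 * A * p) * x
          + (2 * b / 3 * g2 * p - 6 * A' * g3 - 6 * A * p3)) - (A' + E) * F ^ 2"
    unfolding h1 h2 h3 h4 q by (simp add: algebra_simps)
  \<comment> \<open>Once derivatives of g2 and g3 are eliminated as far as possible, the two sides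
    differ exactly by multiples of the syzygies \<open>h6\<close> and \<open>h7\<close>.\<close>
  also have "\<dots> = ?R + x * F / 2 * (A * p + b * p3 + 4 * g2 * E)
      + F / 2 * (A * p3 + b / 12 * g2 * p + 6 * g3 * E)"
    unfolding q F by (simp add: field_simps power2_eq_square power3_eq_cube)
  also have "\<dots> = ?R" unfolding h6 h7 by simp
  finally show ?thesis .
qed

text \<open>After multiplication by \<open>cubic_discr a\<close> the connection equations apply, the
  mixed terms in A b cancel and A^2 - b^2 g2 / 12 splits off. Cancelling the nonzero cubic leaves
  E.\<close>

lemma gauss_manin_syzygies:
  assumes "gauss_manin a q g2 g3 A E b"
  shows "A * pderiv g2 + smult b (pderiv g3) = - 4 * g2 * E"
    and "A * pderiv g3 + smult (b / 12) (g2 * pderiv g2) = - 6 * g3 * E"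
proof -
  let ?D = "cubic_discr a"
  have D: "?D \<noteq> 0" by (simp add: cubic_discr_def)
  have r: "poly ?D z * poly (pderiv g2) z = 6 * b * poly g3 z - 4 * poly A z * poly g2 z"
    "poly ?D z * poly (pderiv g3) z = b / 3 * poly g2 z ^ 2 - 6 * poly A z * poly g3 z"
    "poly ?D z * poly E z = poly A z ^ 2 - b ^ 2 / 12 * poly g2 z" for z
    using assms unfolding gauss_manin_def
    by (metis poly_mult poly_diff poly_smult poly_power poly_numeral)+
  have "?D * (A * pderiv g2 + smult b (pderiv g3)) = ?D * (- 4 * g2 * E)"
  proof (rule poly_eqI_poly)
    fix z
    have "poly (?D * (A * pderiv g2 + smult b (pderiv g3))) z
        = poly A z * (poly ?D z * poly (pderiv g2) z) + b * (poly ?D z * poly (pderiv g3) z)"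
      by (simp add: algebra_simps)
    also have "\<dots> = - 4 * poly g2 z * (poly ?D z * poly E z)"
      unfolding r by (simp add: algebra_simps power2_eq_square)
    also have "\<dots> = poly (?D * (- 4 * g2 * E)) z" by simp
    finally show "poly (?D * (A * pderiv g2 + smult b (pderiv g3))) z = poly (?D * (- 4 * g2 * E)) z" .
  qed
  with D show "A * pderiv g2 + smult b (pderiv g3) = - 4 * g2 * E" by (simp only: mult_cancel_left) simp
  have "?D * (A * pderiv g3 + smult (b / 12) (g2 * pderiv g2)) = ?D * (- 6 * g3 * E)"
  proof (rule poly_eqI_poly)
    fix z
    have "poly (?D * (A * pderiv g3 + smult (b / 12) (g2 * pderiv g2))) z
        = poly A z * (poly ?D z * poly (pderiv g3) z)
          + b / 12 * poly g2 z * (poly ?D z * poly (pderiv g2) z)"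
      by (simp add: algebra_simps)
    also have "\<dots> = - 6 * poly g3 z * (poly ?D z * poly E z)"
      unfolding r by (simp add: algebra_simps power2_eq_square)
    also have "\<dots> = poly (?D * (- 6 * g3 * E)) z" by simp
    finally show "poly (?D * (A * pderiv g3 + smult (b / 12) (g2 * pderiv g2))) z
      = poly (?D * (- 6 * g3 * E)) z" .
  qed
  with D show "A * pderiv g3 + smult (b / 12) (g2 * pderiv g2) = - 6 * g3 * E"
    by (simp only: mult_cancel_left) simp
qed

text \<open>With w, w' the first two s-derivatives of i, one has theta i = s w and theta^2 i = s (w
  + s w'). The theta form of the operator is s / a times Heun's form.\<close>

lemma theta_combination:
  fixes a :: complex
  assumes "a \<noteq> 0"
  shows "s * (w + s * w') - s / a * ((a + 1) * (s * (w + s * w')) + (a + 1) * (s * w) + q * i)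
      + s ^ 2 / a * (s * (w + s * w') + 2 * (s * w) + i)
    = s / a * ((s * (s - 1) * (s - a)) * w' + ((s - 1) * (s - a) + s * (s - a) + s * (s - 1)) * w
        + (s - q) * i)"
  using assms by (simp add: field_simps power2_eq_square)

text \<open>This is the s-derivative of \<open>exact_quadratic\<close> plus S = 2 E x - b g2' / 12.
  The second summand comes from (A + b x) (1/y)_s = E/y + (S/y)_x, which restates the two syzygies;
  A' + E = q - s merges the terms in x.\<close>

definition exact_linear :: "complex \<Rightarrow> complex poly \<Rightarrow> complex \<Rightarrow> rexp" where
  "exact_linear q g2 b =
     RAdd (RPoly (smult (b / 4) (pderiv g2))) (RMul (RPoly [:2 * q, - 2:]) RX)"

text \<open>Calling this expression R, one has D (1/y)_s = (A + b x)/y + (R/y)_x. It is the exact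
  term that is lost when the connection is written modulo exact forms.\<close>

definition exact_quadratic :: "complex poly \<Rightarrow> complex poly \<Rightarrow> complex \<Rightarrow> rexp" where
  "exact_quadratic g2 A b =
     RAdd (RPoly (smult (b / 3) g2)) (RAdd (RMul (RPoly (smult 2 A)) RX)
        (RMul (RConst (- 2 * b)) (RMul RX RX)))"

definition exact_cubic :: "complex poly \<Rightarrow> complex poly \<Rightarrow> complex poly \<Rightarrow> complex \<Rightarrow> rexp" where
  "exact_cubic g2 g3 A b = RMul (exact_quadratic g2 A b)
     (RAdd (RMul (RPoly (smult (1 / 2) (pderiv g2))) RX) (RPoly (smult (1 / 2) (pderiv g3))))"

definition exact_primitive :: "complex \<Rightarrow> complex \<Rightarrow> complex poly \<Rightarrow> complex poly \<Rightarrow>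
    complex poly \<Rightarrow> complex \<Rightarrow> rexp" where
  "exact_primitive a q g2 g3 A b = RMul (RPoly [:0, 1 / a:])
     (RAdd (RMul (exact_linear q g2 b) RIY)
        (RMul (exact_cubic g2 g3 A b) (RMul RIY (RMul RIY RIY))))"

text \<open>Differentiating D (1/y)_s = (A + b x)/y + (R/y)_x once more in s and reducing the new
  first-order terms leaves (q - s)/y and an x-derivative. The denominators of the primitive are only
  y and y^3, so it is regular wherever y is nonzero.\<close>

lemma heun_exact:
  assumes gm: "gauss_manin a q g2 g3 A E b" and a: "a \<noteq> 0"
    and y: "y \<noteq> 0" "y ^ 2 = weier g2 g3 s x"
  shows "reval (theta_s g2 g3 (theta_s g2 g3 RIY)) s x y
     - s / a * ((a + 1) * reval (theta_s g2 g3 (theta_s g2 g3 RIY)) s x y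
         + (a + 1) * reval (theta_s g2 g3 RIY) s x y + q * reval RIY s x y)
     + s ^ 2 / a * (reval (theta_s g2 g3 (theta_s g2 g3 RIY)) s x y
         + 2 * reval (theta_s g2 g3 RIY) s x y + reval RIY s x y)
    = reval (deriv_x g2 g3 (exact_primitive a q g2 g3 A b)) s x y"
proof -
  define i where "i = inverse y"
  define F where "F = weier g2 g3 s x"
  define D where "D = s * (s - 1) * (s - a)"
  define d where "d = (s - 1) * (s - a) + s * (s - a) + s * (s - 1)"
  define p r p3 r3 where "p = poly (pderiv g2) s" and "r = poly (pderiv (pderiv g2)) s"
    and "p3 = poly (pderiv g3) s" and "r3 = poly (pderiv (pderiv g3)) s"
  have F: "F = 4 * x ^ 3 - poly g2 s * x - poly g3 s" by (simp add: F_def weier_def)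
  have iF: "i ^ 2 * F = 1" using y by (simp add: i_def F_def power_inverse flip: y(2))
  have D: "D = poly (cubic_discr a) s" by (simp add: D_def poly_cubic_discr)
  have d: "d = poly (pderiv (cubic_discr a)) s"
    unfolding cubic_discr_def pderiv_mult d_def by (simp add: pderiv_pCons algebra_simps)
  note gm' = gm[unfolded gauss_manin_def]
  have h1: "D * p = 6 * b * poly g3 s - 4 * poly A s * poly g2 s"
    using arg_cong[OF gm'[THEN conjunct1], of "\<lambda>f. poly f s"] by (simp add: D p_def)
  have h2: "D * p3 = b / 3 * poly g2 s ^ 2 - 6 * poly A s * poly g3 s"
    using arg_cong[OF gm'[THEN conjunct2, THEN conjunct1], of "\<lambda>f. poly f s"]
    by (simp add: D p3_def poly_power)
  have h3: "d * p + D * r = 6 * b * p3 - 4 * poly (pderiv A) s * poly g2 s - 4 * poly A s * p"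
    using arg_cong[OF gm'[THEN conjunct1], of "\<lambda>f. poly (pderiv f) s"]
    by (simp add: D d p_def r_def p3_def pderiv_mult pderiv_diff pderiv_smult numeral_mult_conv_smult algebra_simps)
  have h4: "d * p3 + D * r3 = 2 * b / 3 * poly g2 s * p - 6 * poly (pderiv A) s * poly g3 s - 6 * poly A s * p3"
    using arg_cong[OF gm'[THEN conjunct2, THEN conjunct1], of "\<lambda>f. poly (pderiv f) s"]
    by (simp add: D d p_def r3_def p3_def pderiv_mult pderiv_diff pderiv_smult power2_eq_square
        numeral_mult_conv_smult algebra_simps)
  have h5: "poly (pderiv A) s + poly E s = q - s"
    using arg_cong[OF gm'[THEN conjunct2, THEN conjunct2, THEN conjunct2], of "\<lambda>f. poly f s"] by simp
  have h6: "poly A s * p + b * p3 = - 4 * poly g2 s * poly E s"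
    using arg_cong[OF gauss_manin_syzygies(1)[OF gm], of "\<lambda>f. poly f s"] by (simp add: p_def p3_def)
  have h7: "poly A s * p3 + b / 12 * poly g2 s * p = - 6 * poly g3 s * poly E s"
    using arg_cong[OF gauss_manin_syzygies(2)[OF gm], of "\<lambda>f. poly f s"] by (simp add: p_def p3_def mult.assoc)
  define w where "w = (p * x + p3) / 2 * i ^ 3"
  define w' where "w' = (r * x + r3) / 2 * i ^ 3 + 3 / 4 * (p * x + p3) ^ 2 * i ^ 5"
  have e: "reval RIY s x y = i" "reval (theta_s g2 g3 RIY) s x y = s * w"
    "reval (theta_s g2 g3 (theta_s g2 g3 RIY)) s x y = s * (w + s * w')"
    unfolding theta_s_def deriv_s.simps reval.simps i_def[symmetric] w_def w'_def
    by (simp_all add: p_def p3_def r_def r3_def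
        pderiv_smult pderiv_pCons eval_nat_numeral field_simps)
  \<comment> \<open>All terms are brought to the common factor y^-5, using y^2 = F.\<close>
  have i: "i = i ^ 5 * F ^ 2" "i ^ 3 = i ^ 5 * F"
    using iF by (simp_all add: eval_nat_numeral) (metis mult.assoc mult.commute mult_1)+
  have "D * w' + d * w + (s - q) * i
      = i ^ 5 * (D * (3 / 4 * (p * x + p3) ^ 2 + (r * x + r3) / 2 * F) + d * (p * x + p3) / 2 * F
          + (s - q) * F ^ 2)"
    unfolding w_def w'_def i(2) by (subst (3) i(1)) (simp add: field_simps)
  also have "\<dots> = i ^ 5 * (2 * (q - s) * F ^ 2
      + (b / 4 * p + 2 * (q - s) * x) * (poly g2 s / 2 - 6 * x ^ 2) * F
      + ((2 * poly A s - 4 * b * x) * (p * x + p3) / 2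
          + (b / 3 * poly g2 s + 2 * poly A s * x - 2 * b * x ^ 2) * p / 2) * F
      + 3 * (b / 3 * poly g2 s + 2 * poly A s * x - 2 * b * x ^ 2) * (p * x + p3) / 2
          * (poly g2 s / 2 - 6 * x ^ 2))"
    unfolding picard_fuchs_algebra[OF h1 h2 h3 h4 h5 h6 h7 F] ..
  also have "\<dots> = 2 * (q - s) * (i ^ 5 * F ^ 2)
      + (b / 4 * p + 2 * (q - s) * x) * (poly g2 s / 2 - 6 * x ^ 2) * (i ^ 5 * F)
      + ((2 * poly A s - 4 * b * x) * (p * x + p3) / 2
          + (b / 3 * poly g2 s + 2 * poly A s * x - 2 * b * x ^ 2) * p / 2) * (i ^ 5 * F)
      + 3 * (b / 3 * poly g2 s + 2 * poly A s * x - 2 * b * x ^ 2) * (p * x + p3) / 2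
          * (poly g2 s / 2 - 6 * x ^ 2) * i ^ 5"
    by (simp only: distrib_left mult_ac)
  finally have main: "D * w' + d * w + (s - q) * i = \<dots>" .
  define R where "R = b / 3 * poly g2 s + 2 * poly A s * x - 2 * b * x ^ 2"
  define G where "G = (poly g2 s / 2 - 6 * x ^ 2) * i ^ 3"
  have x1: "reval (exact_linear q g2 b) s x y = b / 4 * p + 2 * (q - s) * x"
    "reval (deriv_x g2 g3 (exact_linear q g2 b)) s x y = 2 * (q - s)"
    by (simp_all add: exact_linear_def p_def algebra_simps)
  have x2: "reval (exact_cubic g2 g3 A b) s x y = R * ((p * x + p3) / 2)"
    by (simp add: exact_cubic_def exact_quadratic_def p_def p3_def R_def power2_eq_square add_divide_distrib)
  have x3: "reval (deriv_x g2 g3 (exact_cubic g2 g3 A b)) s x y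
      = (2 * poly A s - 4 * b * x) * ((p * x + p3) / 2) + R * (p / 2)"
    by (simp add: exact_cubic_def exact_quadratic_def p_def p3_def R_def power2_eq_square field_simps)
  have x4: "reval (deriv_x g2 g3 RIY) s x y = G"
    unfolding deriv_x.simps reval.simps i_def[symmetric] G_def
    by (simp add: power2_eq_square power3_eq_cube algebra_simps)
  have x5: "reval (deriv_x g2 g3 (RMul RIY (RMul RIY RIY))) s x y = 3 * i ^ 2 * G"
    unfolding deriv_x.simps(5) reval.simps x4 i_def[symmetric]
    by (simp add: power2_eq_square algebra_simps)
  have x6: "reval (deriv_x g2 g3 (exact_primitive a q g2 g3 A b)) s x y
    = s / a * (2 * (q - s) * i + (b / 4 * p + 2 * (q - s) * x) * G
        + (((2 * poly A s - 4 * b * x) * ((p * x + p3) / 2) + R * (p / 2)) * i ^ 3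
           + R * ((p * x + p3) / 2) * (3 * i ^ 2 * G)))"
    unfolding exact_primitive_def deriv_x.simps(1,4) deriv_x.simps(5)[of _ _ "RPoly _"]
      deriv_x.simps(5)[of _ _ "exact_linear _ _ _"] deriv_x.simps(5)[of _ _ "exact_cubic _ _ _ _"]
      reval.simps x1 x2 x3 x4 x5 i_def[symmetric]
    by (simp add: power3_eq_cube)
  have "s / a * (D * w' + d * w + (s - q) * i)
      = reval (deriv_x g2 g3 (exact_primitive a q g2 g3 A b)) s x y"
    unfolding main i[symmetric] x6 R_def[symmetric] G_def
    by (rule arg_cong[where f = "(*) (s / a)"]) (simp add: eval_nat_numeral field_simps)
  then show ?thesis
    unfolding e theta_combination[OF a] D_def d_def by simp
qed

section \<open>Stokes' theorem on a cube\<close>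

text \<open>The derivative family is an argument, so one-sided derivatives on the boundary need not
  be shown unique, and continuity is asked direction by direction. \<open>C2_on\<close> likewise
  differentiates each directional derivative separately.\<close>

definition C1_on :: "'a::real_normed_vector set \<Rightarrow> ('a \<Rightarrow> complex) \<Rightarrow> ('a \<Rightarrow> 'a \<Rightarrow> complex) \<Rightarrow> bool" where
  "C1_on K f D \<longleftrightarrow>
     (\<forall>p \<in> K. (f has_derivative D p) (at p within K)) \<and> (\<forall>h. continuous_on K (\<lambda>p. D p h))"

definition C2_on :: "'a::real_normed_vector set \<Rightarrow> ('a \<Rightarrow> complex) \<Rightarrow> ('a \<Rightarrow> 'a \<Rightarrow> complex) \<Rightarrow> bool" where
  "C2_on K f D \<longleftrightarrow> C1_on K f D \<and> (\<forall>h. \<exists>E. C1_on K (\<lambda>p. D p h) E)"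

lemma C1_onD:
  assumes "C1_on K f D"
  shows "p \<in> K \<Longrightarrow> (f has_derivative D p) (at p within K)" "continuous_on K (\<lambda>p. D p h)"
    "continuous_on K f"
  using assms unfolding C1_on_def
  by (auto intro: has_derivative_continuous_on)

lemma C2_onD: "C2_on K f D \<Longrightarrow> C1_on K f D"
  by (simp add: C2_on_def)

lemma C1_on_const: "C1_on K (\<lambda>p. c) (\<lambda>p h. 0)"
  by (simp add: C1_on_def)

lemma C1_on_add:
  assumes "C1_on K f D" "C1_on K g E"
  shows "C1_on K (\<lambda>p. f p + g p) (\<lambda>p h. D p h + E p h)"
  using assms unfolding C1_on_def by (auto intro!: has_derivative_add continuous_intros)

lemma C1_on_mult:
  assumes "C1_on K f D" "C1_on K g E"
  shows "C1_on K (\<lambda>p. f p * g p) (\<lambda>p h. f p * E p h + D p h * g p)"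
proof -
  have "continuous_on K f" "continuous_on K g" using assms C1_onD(3) by auto
  then show ?thesis
    using assms unfolding C1_on_def by (auto intro!: has_derivative_mult continuous_intros)
qed

lemma C1_on_inverse:
  assumes "C1_on K f D" "\<And>p. p \<in> K \<Longrightarrow> f p \<noteq> 0"
  shows "C1_on K (\<lambda>p. inverse (f p)) (\<lambda>p h. - (inverse (f p) * D p h * inverse (f p)))"
proof -
  have "continuous_on K f" using assms C1_onD(3) by auto
  then show ?thesis
    using assms unfolding C1_on_def
    by (auto intro!: Deriv.has_derivative_inverse continuous_intros)
qed

lemma C1_on_minus:
  assumes "C1_on K f D" shows "C1_on K (\<lambda>p. - f p) (\<lambda>p h. - D p h)"
  using assms unfolding C1_on_def by (auto intro!: has_derivative_minus continuous_intros)

lemma C2_on_const: "C2_on K (\<lambda>p. c) (\<lambda>p h. 0)"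
  unfolding C2_on_def using C1_on_const by blast

lemma C2_on_add:
  assumes "C2_on K f D" "C2_on K g E"
  shows "C2_on K (\<lambda>p. f p + g p) (\<lambda>p h. D p h + E p h)"
  using assms C1_on_add unfolding C2_on_def by blast

lemma C2_on_mult:
  assumes "C2_on K f D" "C2_on K g E"
  shows "C2_on K (\<lambda>p. f p * g p) (\<lambda>p h. f p * E p h + D p h * g p)"
  unfolding C2_on_def
proof (intro conjI allI)
  have fg: "C1_on K f D" "C1_on K g E" using assms by (auto simp: C2_on_def)
  then show "C1_on K (\<lambda>p. f p * g p) (\<lambda>p h. f p * E p h + D p h * g p)" by (rule C1_on_mult)
  fix h
  obtain D' E' where "C1_on K (\<lambda>p. D p h) D'" "C1_on K (\<lambda>p. E p h) E'"
    using assms unfolding C2_on_def by blast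
  with fg show "\<exists>F. C1_on K (\<lambda>p. f p * E p h + D p h * g p) F"
    using C1_on_add C1_on_mult by blast
qed

lemma C2_on_inverse:
  assumes "C2_on K f D" "\<And>p. p \<in> K \<Longrightarrow> f p \<noteq> 0"
  shows "C2_on K (\<lambda>p. inverse (f p)) (\<lambda>p h. - (inverse (f p) * D p h * inverse (f p)))"
  unfolding C2_on_def
proof (intro conjI allI)
  have f: "C1_on K f D" using assms by (auto simp: C2_on_def)
  then show i: "C1_on K (\<lambda>p. inverse (f p)) (\<lambda>p h. - (inverse (f p) * D p h * inverse (f p)))"
    using assms(2) by (rule C1_on_inverse)
  fix h
  obtain D' where "C1_on K (\<lambda>p. D p h) D'"
    using assms unfolding C2_on_def by blast
  with i show "\<exists>F. C1_on K (\<lambda>p. - (inverse (f p) * D p h * inverse (f p))) F"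
    using C1_on_minus C1_on_mult by blast
qed

lemma C1_on_cong:
  assumes "C1_on K f D" "\<And>p. p \<in> K \<Longrightarrow> f p = g p"
  shows "C1_on K g D"
  using assms unfolding C1_on_def by (metis has_derivative_transform)

lemma C1_on_line:
  fixes f :: "'a::real_normed_vector \<Rightarrow> complex"
  assumes "C1_on K f D" and "\<And>x. x \<in> {a..b} \<Longrightarrow> p + x *\<^sub>R h \<in> K" and "x \<in> {a..b}"
  shows "((\<lambda>x. f (p + x *\<^sub>R h)) has_vector_derivative D (p + x *\<^sub>R h) h) (at x within {a..b})"
proof -
  have lin: "linear (D (p + x *\<^sub>R h))"
    using C1_onD(1)[OF assms(1)] assms(2,3) has_derivative_linear by blast
  have "((\<lambda>x. f (p + x *\<^sub>R h)) has_derivative (\<lambda>y. D (p + x *\<^sub>R h) (y *\<^sub>R h))) (at x within {a..b})"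
  proof (rule has_derivative_in_compose2[of K f D])
    show "((\<lambda>x. p + x *\<^sub>R h) has_derivative (\<lambda>y. y *\<^sub>R h)) (at x within {a..b})"
      by (auto intro!: derivative_eq_intros)
  qed (use assms C1_onD in auto)
  then show ?thesis
    unfolding has_vector_derivative_def by (simp add: linear_scale[OF lin])
qed

lemma C1_on_line_integral:
  fixes f :: "'a::real_normed_vector \<Rightarrow> complex"
  assumes "C1_on K f D" and "\<And>x. x \<in> {a..b} \<Longrightarrow> p + x *\<^sub>R h \<in> K" and "a \<le> b"
  shows "integral {a..b} (\<lambda>x. D (p + x *\<^sub>R h) h) = f (p + b *\<^sub>R h) - f (p + a *\<^sub>R h)"
  using fundamental_theorem_of_calculus[OF assms(3) C1_on_line[OF assms(1,2)]]
  by (simp add: integral_unique)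

text \<open>Over any parallelogram p + [0,r] h + [0,r] k both mixed derivatives have the same
  integral, namely the alternating sum of f over the corners. If they differed at p, their
  difference would stay close to a nonzero value on a small parallelogram.\<close>

lemma C2_on_symmetric:
  assumes "C2_on K f D" "C1_on K (\<lambda>p. D p h) E" "C1_on K (\<lambda>p. D p k) E'" "p \<in> interior K"
  shows "E p k = E' p h"
proof (rule ccontr)
  assume ne: "E p k \<noteq> E' p h"
  define G where "G = (\<lambda>q. E q k - E' q h)"
  have Gc: "continuous_on K G"
    unfolding G_def using C1_onD(2)[OF assms(2), of k] C1_onD(2)[OF assms(3), of h]
    by (rule continuous_on_diff)
  have pK: "p \<in> K" using assms(4) interior_subset by blast
  have pos: "norm (G p) > 0" using ne by (simp add: G_def)
  obtain d where d: "d > 0" "\<And>q. q \<in> K \<Longrightarrow> dist q p < d \<Longrightarrow> dist (G q) (G p) < norm (G p)"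
    using Gc pK pos unfolding continuous_on_iff by blast
  obtain e where e: "e > 0" "ball p e \<subseteq> K"
    using assms(4) by (meson mem_interior)
  \<comment> \<open>The summand 1 keeps N positive when both directions vanish; the factor 1/2 in r
    makes the parallelogram fit strictly into both balls.\<close>
  define N where "N = norm h + norm k + 1"
  have n: "N > 0" unfolding N_def by (smt (verit) norm_ge_zero)
  define r where "r = min d e / (2 * N)"
  have r: "r > 0" "r * (norm h + norm k) < min d e"
  proof -
    show "r > 0" unfolding r_def using d e n by simp
    then have "r * (norm h + norm k) \<le> r * N"
      unfolding N_def by (intro mult_left_mono) auto
    also have "\<dots> = min d e / 2" using n by (simp add: r_def)
    also have "\<dots> < min d e" using d e by (simp add: min_def)
    finally show "r * (norm h + norm k) < min d e" .
  qed
  define q where "q = (\<lambda>x y. p + x *\<^sub>R h + y *\<^sub>R k)"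
  have dist: "dist (q x y) p < min d e" if "x \<in> {0..r}" "y \<in> {0..r}" for x y
  proof -
    have "dist (q x y) p \<le> x * norm h + y * norm k"
      unfolding q_def dist_norm using that norm_triangle_ineq[of "x *\<^sub>R h" "y *\<^sub>R k"] by simp
    also have "\<dots> \<le> r * (norm h + norm k)"
      unfolding distrib_left using that by (intro add_mono mult_right_mono) auto
    finally show ?thesis using r by simp
  qed
  have qK: "q x y \<in> K" if "x \<in> {0..r}" "y \<in> {0..r}" for x y
    using dist[OF that] e by (auto simp: dist_commute)
  have cq: "continuous_on ({0..r} \<times> {0..r}) (\<lambda>z. H (q (fst z) (snd z)))" if "continuous_on K H" for H :: "_ \<Rightarrow> complex"
    by (rule continuous_on_compose2[OF that])
       (use qK in \<open>auto simp: q_def intro!: continuous_intros\<close>)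
  have I1: "integral {0..r} (\<lambda>x. integral {0..r} (\<lambda>y. E (q x y) k))
      = f (q r r) - f (q 0 r) - (f (q r 0) - f (q 0 0))"
  proof -
    have 1: "integral {0..r} (\<lambda>y. E (q x y) k) = D (q x r) h - D (q x 0) h" if "x \<in> {0..r}" for x
      unfolding q_def
      by (rule C1_on_line_integral[OF assms(2)]) (use qK that r in \<open>auto simp: q_def\<close>)
    have 2: "integral {0..r} (\<lambda>x. D (q x y) h) = f (q r y) - f (q 0 y)"
      and 3: "(\<lambda>x. D (q x y) h) integrable_on {0..r}" if y: "y \<in> {0..r}" for y
    proof -
      have eq: "q x y = (p + y *\<^sub>R k) + x *\<^sub>R h" for x by (simp add: q_def algebra_simps)
      show "integral {0..r} (\<lambda>x. D (q x y) h) = f (q r y) - f (q 0 y)"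
        unfolding eq by (rule C1_on_line_integral[OF C2_onD[OF assms(1)]])
          (use qK y r in \<open>auto simp flip: eq\<close>)
      have "continuous_on {0..r} (\<lambda>x. D (q x y) h)"
        by (rule continuous_on_compose2[OF C1_onD(2)[OF C2_onD[OF assms(1)]]])
           (use qK y in \<open>auto simp: q_def intro!: continuous_intros\<close>)
      then show "(\<lambda>x. D (q x y) h) integrable_on {0..r}" by (rule integrable_continuous_real)
    qed
    have "integral {0..r} (\<lambda>x. integral {0..r} (\<lambda>y. E (q x y) k))
        = integral {0..r} (\<lambda>x. D (q x r) h - D (q x 0) h)"
      by (rule integral_cong) (simp add: 1)
    also have "\<dots> = integral {0..r} (\<lambda>x. D (q x r) h) - integral {0..r} (\<lambda>x. D (q x 0) h)"
      by (rule integral_diff) (use 3 r in auto)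
    finally show ?thesis using 2[of r] 2[of 0] r by simp
  qed
  have I2: "integral {0..r} (\<lambda>y. integral {0..r} (\<lambda>x. E' (q x y) h))
      = f (q r r) - f (q r 0) - (f (q 0 r) - f (q 0 0))"
  proof -
    have eq: "q x y = (p + y *\<^sub>R k) + x *\<^sub>R h" for x y by (simp add: q_def algebra_simps)
    have 1: "integral {0..r} (\<lambda>x. E' (q x y) h) = D (q r y) k - D (q 0 y) k" if "y \<in> {0..r}" for y
      unfolding eq
      by (rule C1_on_line_integral[OF assms(3)]) (use qK that r in \<open>auto simp flip: eq\<close>)
    have 2: "integral {0..r} (\<lambda>y. D (q x y) k) = f (q x r) - f (q x 0)"
      and 3: "(\<lambda>y. D (q x y) k) integrable_on {0..r}" if x: "x \<in> {0..r}" for x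
    proof -
      show "integral {0..r} (\<lambda>y. D (q x y) k) = f (q x r) - f (q x 0)"
        unfolding q_def by (rule C1_on_line_integral[OF C2_onD[OF assms(1)]])
          (use qK x r in \<open>auto simp: q_def\<close>)
      have "continuous_on {0..r} (\<lambda>y. D (q x y) k)"
        by (rule continuous_on_compose2[OF C1_onD(2)[OF C2_onD[OF assms(1)]]])
           (use qK x in \<open>auto simp: q_def intro!: continuous_intros\<close>)
      then show "(\<lambda>y. D (q x y) k) integrable_on {0..r}" by (rule integrable_continuous_real)
    qed
    have "integral {0..r} (\<lambda>y. integral {0..r} (\<lambda>x. E' (q x y) h))
        = integral {0..r} (\<lambda>y. D (q r y) k - D (q 0 y) k)"
      by (rule integral_cong) (simp add: 1)
    also have "\<dots> = integral {0..r} (\<lambda>y. D (q r y) k) - integral {0..r} (\<lambda>y. D (q 0 y) k)"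
      by (rule integral_diff) (use 3 r in auto)
    finally show ?thesis using 2[of r] 2[of 0] r by simp
  qed
  have box: "cbox (0, 0) (r, r) = {0..r} \<times> {0..r}" by (simp add: cbox_Pair_eq)
  have c1: "continuous_on (cbox (0, 0) (r, r)) (\<lambda>z. E (q (fst z) (snd z)) k)"
    unfolding box using cq[OF C1_onD(2)[OF assms(2)]] .
  have c2: "continuous_on (cbox (0, 0) (r, r)) (\<lambda>z. E' (q (fst z) (snd z)) h)"
    unfolding box using cq[OF C1_onD(2)[OF assms(3)]] .
  have "integral {0..r} (\<lambda>y. integral {0..r} (\<lambda>x. E' (q x y) h))
      = integral {0..r} (\<lambda>x. integral {0..r} (\<lambda>y. E' (q x y) h))"
    using integral_swap_continuous[of 0 0 r r "\<lambda>x y. E' (q x y) h"] c2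
    by (simp add: split_beta)
  with I1 I2 have "integral (cbox (0, 0) (r, r)) (\<lambda>z. E (q (fst z) (snd z)) k)
      = integral (cbox (0, 0) (r, r)) (\<lambda>z. E' (q (fst z) (snd z)) h)"
    using integral_prod_continuous[OF c1] integral_prod_continuous[OF c2] by simp
  then have i0: "((\<lambda>z. G (q (fst z) (snd z))) has_integral 0) (cbox (0, 0) (r, r))"
    unfolding G_def
    using has_integral_diff[OF integrable_integral[OF integrable_continuous[OF c1]]
        integrable_integral[OF integrable_continuous[OF c2]]] by simp
  have "((\<lambda>z. G (q (fst z) (snd z)) - G p) has_integral 0 - measure lborel (cbox (0, 0) (r, r)) *\<^sub>R G p) (cbox (0, 0) (r, r))"
    by (intro has_integral_diff i0 has_integral_const)
  have cn: "continuous_on (cbox (0, 0) (r, r)) (\<lambda>z. norm (G (q (fst z) (snd z)) - G p))"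
    unfolding box by (intro continuous_intros cq Gc)
  \<comment> \<open>A point of maximal deviation from \<open>G p\<close> exists by compactness. This
    makes the bound uniform and strict: the zero integral would give norm (G p) at most this
    deviation, which is below norm (G p).\<close>
  have "cbox (0, 0) (r, r) \<noteq> {}" using r by (simp add: box)
  then obtain z0 where z0: "z0 \<in> cbox (0, 0) (r, r)"
    "\<And>z. z \<in> cbox (0, 0) (r, r) \<Longrightarrow> norm (G (q (fst z) (snd z)) - G p) \<le> norm (G (q (fst z0) (snd z0)) - G p)"
    using continuous_attains_sup[OF compact_cbox _ cn] by blast
  have "norm (0 - measure lborel (cbox (0, 0) (r, r)) *\<^sub>R G p)
      \<le> norm (G (q (fst z0) (snd z0)) - G p) * measure lborel (cbox (0, 0) (r, r))"
    by (rule has_integral_bound[OF _ \<open>((\<lambda>z. G (q (fst z) (snd z)) - G p) has_integral _) _\<close>])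
       (use z0 in auto)
  moreover have "measure lborel (cbox (0, 0) (r, r)) > 0" using r by (simp add: content_Pair)
  ultimately have "norm (G p) \<le> norm (G (q (fst z0) (snd z0)) - G p)"
    by (simp add: mult.commute)
  moreover have "dist (G (q (fst z0) (snd z0))) (G p) < norm (G p)"
    using z0(1) dist qK by (intro d(2)) (auto simp: box)
  ultimately show False by (simp add: dist_norm)
qed

lemma C1_on_diff:
  assumes "C1_on K f D" "C1_on K g E"
  shows "C1_on K (\<lambda>p. f p - g p) (\<lambda>p h. D p h - E p h)"
  using assms unfolding C1_on_def by (auto intro!: has_derivative_diff continuous_intros)

section \<open>The fundamental theorem of calculus in the three directions of the cube\<close>

lemma continuous_on_cube_slice:
  assumes "continuous_on unit_cube (F :: real \<times> real \<times> real \<Rightarrow> complex)" "x \<in> {0..1}"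
  shows "continuous_on unit_square (\<lambda>q. F (x, q))"
    "continuous_on unit_square (\<lambda>q. F (fst q, x, snd q))"
    "continuous_on unit_square (\<lambda>q. F (fst q, snd q, x))"
  by (rule continuous_on_compose2[OF assms(1)];
      use assms(2) in \<open>force simp: cbox_Pair_eq intro!: continuous_intros\<close>)+

lemma cube_FTC1:
  assumes V: "C1_on unit_cube V D"
  shows "integral unit_cube (\<lambda>p. D p (1, 0, 0))
    = integral unit_square (\<lambda>q. V (1, q)) - integral unit_square (\<lambda>q. V (0, q))"
proof -
  have c: "continuous_on unit_cube (\<lambda>p. D p (1, 0, 0))" by (rule C1_onD[OF V])
  have "integral unit_cube (\<lambda>p. D p (1, 0, 0))
      = integral {0..1} (\<lambda>x. integral unit_square (\<lambda>q. D (x, q) (1, 0, 0)))"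
    using integral_prod_continuous[of 0 "(0, 0)" 1 "(1, 1)", OF c] by simp
  also have "\<dots> = integral unit_square (\<lambda>q. integral {0..1} (\<lambda>x. D (x, q) (1, 0, 0)))"
    using integral_swap_continuous[of 0 "(0, 0)" 1 "(1, 1)" "\<lambda>x q. D (x, q) (1, 0, 0)"] c
    by (simp add: split_beta)
  also have "\<dots> = integral unit_square (\<lambda>q. V (1, q) - V (0, q))"
  proof (rule integral_cong)
    fix q :: "real \<times> real" assume q: "q \<in> unit_square"
    have "integral {0..1} (\<lambda>x. D ((0, q) + x *\<^sub>R (1, 0, 0)) (1, 0, 0))
        = V ((0, q) + 1 *\<^sub>R (1, 0, 0)) - V ((0, q) + 0 *\<^sub>R (1, 0, 0))"
      by (rule C1_on_line_integral[OF V]) (use q in \<open>auto simp: cbox_Pair_eq\<close>)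
    then show "integral {0..1} (\<lambda>x. D (x, q) (1, 0, 0)) = V (1, q) - V (0, q)"
      by (cases q) simp
  qed
  also have "\<dots> = integral unit_square (\<lambda>q. V (1, q)) - integral unit_square (\<lambda>q. V (0, q))"
    by (intro integral_diff integrable_continuous continuous_on_cube_slice C1_onD[OF V]) auto
  finally show ?thesis .
qed

lemma cube_FTC2:
  assumes V: "C1_on unit_cube V D"
  shows "integral unit_cube (\<lambda>p. D p (0, 1, 0))
    = integral unit_square (\<lambda>q. V (fst q, 1, snd q)) - integral unit_square (\<lambda>q. V (fst q, 0, snd q))"
proof -
  have c: "continuous_on unit_cube (\<lambda>p. D p (0, 1, 0))" by (rule C1_onD[OF V])
  have cV: "continuous_on unit_square (\<lambda>q. V (fst q, x, snd q))" if "x \<in> {0..1}" for x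
    by (intro continuous_on_cube_slice C1_onD[OF V] that)
  have "integral unit_cube (\<lambda>p. D p (0, 1, 0))
      = integral {0..1} (\<lambda>x. integral unit_square (\<lambda>q. D (x, q) (0, 1, 0)))"
    using integral_prod_continuous[of 0 "(0, 0)" 1 "(1, 1)", OF c] by simp
  also have "\<dots> = integral {0..1} (\<lambda>x. integral {0..1} (\<lambda>z. V (x, 1, z) - V (x, 0, z)))"
  proof (rule integral_cong)
    fix x :: real assume x: "x \<in> {0..1}"
    have cx: "continuous_on unit_square (\<lambda>q. D (x, q) (0, 1, 0))"
      by (intro continuous_on_cube_slice c x)
    have "integral unit_square (\<lambda>q. D (x, q) (0, 1, 0))
        = integral {0..1} (\<lambda>y. integral {0..1} (\<lambda>z. D (x, y, z) (0, 1, 0)))"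
      using integral_prod_continuous[OF cx] by simp
    also have "\<dots> = integral {0..1} (\<lambda>z. integral {0..1} (\<lambda>y. D (x, y, z) (0, 1, 0)))"
      using integral_swap_continuous[of 0 0 1 1 "\<lambda>y z. D (x, y, z) (0, 1, 0)"] cx
      by (simp add: split_beta)
    also have "\<dots> = integral {0..1} (\<lambda>z. V (x, 1, z) - V (x, 0, z))"
    proof (rule integral_cong)
      fix z :: real assume z: "z \<in> {0..1}"
      have "integral {0..1} (\<lambda>y. D ((x, 0, z) + y *\<^sub>R (0, 1, 0)) (0, 1, 0))
          = V ((x, 0, z) + 1 *\<^sub>R (0, 1, 0)) - V ((x, 0, z) + 0 *\<^sub>R (0, 1, 0))"
        by (rule C1_on_line_integral[OF V]) (use x z in \<open>auto simp: cbox_Pair_eq\<close>)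
      then show "integral {0..1} (\<lambda>y. D (x, y, z) (0, 1, 0)) = V (x, 1, z) - V (x, 0, z)"
        by simp
    qed
    finally show "integral unit_square (\<lambda>q. D (x, q) (0, 1, 0))
        = integral {0..1} (\<lambda>z. V (x, 1, z) - V (x, 0, z))" .
  qed
  also have "\<dots> = integral unit_square (\<lambda>q. V (fst q, 1, snd q) - V (fst q, 0, snd q))"
    using integral_prod_continuous[OF continuous_on_diff[OF cV[of 1] cV[of 0]]] by simp
  also have "\<dots> = integral unit_square (\<lambda>q. V (fst q, 1, snd q)) - integral unit_square (\<lambda>q. V (fst q, 0, snd q))"
    by (intro integral_diff integrable_continuous cV) auto
  finally show ?thesis .
qed

lemma cube_FTC3:
  assumes V: "C1_on unit_cube V D"
  shows "integral unit_cube (\<lambda>p. D p (0, 0, 1))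
    = integral unit_square (\<lambda>q. V (fst q, snd q, 1)) - integral unit_square (\<lambda>q. V (fst q, snd q, 0))"
proof -
  have c: "continuous_on unit_cube (\<lambda>p. D p (0, 0, 1))" by (rule C1_onD[OF V])
  have cV: "continuous_on unit_square (\<lambda>q. V (fst q, snd q, x))" if "x \<in> {0..1}" for x
    by (intro continuous_on_cube_slice C1_onD[OF V] that)
  have "integral unit_cube (\<lambda>p. D p (0, 0, 1))
      = integral {0..1} (\<lambda>x. integral unit_square (\<lambda>q. D (x, q) (0, 0, 1)))"
    using integral_prod_continuous[of 0 "(0, 0)" 1 "(1, 1)", OF c] by simp
  also have "\<dots> = integral {0..1} (\<lambda>x. integral {0..1} (\<lambda>y. V (x, y, 1) - V (x, y, 0)))"
  proof (rule integral_cong)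
    fix x :: real assume x: "x \<in> {0..1}"
    have cx: "continuous_on unit_square (\<lambda>q. D (x, q) (0, 0, 1))"
      by (intro continuous_on_cube_slice c x)
    have "integral unit_square (\<lambda>q. D (x, q) (0, 0, 1))
        = integral {0..1} (\<lambda>y. integral {0..1} (\<lambda>z. D (x, y, z) (0, 0, 1)))"
      using integral_prod_continuous[OF cx] by simp
    also have "\<dots> = integral {0..1} (\<lambda>y. V (x, y, 1) - V (x, y, 0))"
    proof (rule integral_cong)
      fix y :: real assume y: "y \<in> {0..1}"
      have "integral {0..1} (\<lambda>z. D ((x, y, 0) + z *\<^sub>R (0, 0, 1)) (0, 0, 1))
          = V ((x, y, 0) + 1 *\<^sub>R (0, 0, 1)) - V ((x, y, 0) + 0 *\<^sub>R (0, 0, 1))"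
        by (rule C1_on_line_integral[OF V]) (use x y in \<open>auto simp: cbox_Pair_eq\<close>)
      then show "integral {0..1} (\<lambda>z. D (x, y, z) (0, 0, 1)) = V (x, y, 1) - V (x, y, 0)"
        by simp
    qed
    finally show "integral unit_square (\<lambda>q. D (x, q) (0, 0, 1))
        = integral {0..1} (\<lambda>y. V (x, y, 1) - V (x, y, 0))" .
  qed
  also have "\<dots> = integral unit_square (\<lambda>q. V (fst q, snd q, 1) - V (fst q, snd q, 0))"
    using integral_prod_continuous[OF continuous_on_diff[OF cV[of 1] cV[of 0]]] by simp
  also have "\<dots> = integral unit_square (\<lambda>q. V (fst q, snd q, 1)) - integral unit_square (\<lambda>q. V (fst q, snd q, 0))"
    by (intro integral_diff integrable_continuous cV) auto
  finally show ?thesis .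
qed

definition minor :: "('a \<Rightarrow> 'b \<Rightarrow> complex) \<Rightarrow> ('a \<Rightarrow> 'b \<Rightarrow> complex) \<Rightarrow> 'b \<Rightarrow> 'b \<Rightarrow> 'a \<Rightarrow> complex" where
  "minor B C h k p = B p h * C p k - B p k * C p h"

text \<open>The value of the wedge product of three covector fields on the standard basis, expanded
  along the first so that the 2 x 2 minors are those seen on the faces.\<close>

definition jacobian3 :: "('a \<Rightarrow> real \<times> real \<times> real \<Rightarrow> complex) \<Rightarrow> ('a \<Rightarrow> real \<times> real \<times> real \<Rightarrow> complex) \<Rightarrow>
    ('a \<Rightarrow> real \<times> real \<times> real \<Rightarrow> complex) \<Rightarrow> 'a \<Rightarrow> complex" where
  "jacobian3 A B C p = A p (1, 0, 0) * minor B C (0, 1, 0) (0, 0, 1) p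
     - A p (0, 1, 0) * minor B C (1, 0, 0) (0, 0, 1) p
     + A p (0, 0, 1) * minor B C (1, 0, 0) (0, 1, 0) p"

text \<open>The cofactors of d\<beta> and d\<gamma> form a divergence-free field because second
  derivatives commute. The integrand is therefore the divergence of \<alpha> times these cofactors,
  and each direction contributes one pair of faces.\<close>

lemma stokes_cube:
  assumes \<alpha>: "C1_on unit_cube \<alpha> A" and \<beta>: "C2_on unit_cube \<beta> B" and \<gamma>: "C2_on unit_cube \<gamma> C"
  shows "integral unit_cube (jacobian3 A B C)
    = (integral unit_square (\<lambda>q. \<alpha> (1, q) * minor B C (0, 1, 0) (0, 0, 1) (1, q))
       - integral unit_square (\<lambda>q. \<alpha> (0, q) * minor B C (0, 1, 0) (0, 0, 1) (0, q)))
     - (integral unit_square (\<lambda>q. \<alpha> (fst q, 1, snd q) * minor B C (1, 0, 0) (0, 0, 1) (fst q, 1, snd q))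
       - integral unit_square (\<lambda>q. \<alpha> (fst q, 0, snd q) * minor B C (1, 0, 0) (0, 0, 1) (fst q, 0, snd q)))
     + (integral unit_square (\<lambda>q. \<alpha> (fst q, snd q, 1) * minor B C (1, 0, 0) (0, 1, 0) (fst q, snd q, 1))
       - integral unit_square (\<lambda>q. \<alpha> (fst q, snd q, 0) * minor B C (1, 0, 0) (0, 1, 0) (fst q, snd q, 0)))"
proof -
  obtain B2 where B2: "\<And>h. C1_on unit_cube (\<lambda>p. B p h) (B2 h)"
    using \<beta> unfolding C2_on_def by metis
  obtain C2 where C2: "\<And>h. C1_on unit_cube (\<lambda>p. C p h) (C2 h)"
    using \<gamma> unfolding C2_on_def by metis
  define M where "M = (\<lambda>h k p l. (B p h * C2 k p l + B2 h p l * C p k) - (B p k * C2 h p l + B2 k p l * C p h))"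
  define V where "V = (\<lambda>h k p. \<alpha> p * minor B C h k p)"
  define DV where "DV = (\<lambda>h k p l. \<alpha> p * M h k p l + A p l * minor B C h k p)"
  have V: "C1_on unit_cube (V h k) (DV h k)" for h k
    unfolding V_def DV_def M_def minor_def
    by (intro C1_on_mult[OF \<alpha>] C1_on_diff[OF C1_on_mult C1_on_mult] B2 C2)
  have sym: "B2 h p k = B2 k p h" "C2 h p k = C2 k p h" if "p \<in> box (0, 0, 0) (1, 1, 1)" for p h k
    using that C2_on_symmetric[OF \<beta> B2 B2] C2_on_symmetric[OF \<gamma> C2 C2] by auto
  have int: "(\<lambda>p. DV h k p l) integrable_on unit_cube" for h k l
    by (intro integrable_continuous C1_onD[OF V])
  \<comment> \<open>Symmetry of second derivatives is known at interior points only, so the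
    integrands are compared on the open box, which has the same integrals.\<close>
  have "integral unit_cube (jacobian3 A B C)
      = integral (box (0, 0, 0) (1, 1, 1)) (jacobian3 A B C)"
    by (rule integral_open_interval[symmetric])
  also have "\<dots> = integral (box (0, 0, 0) (1, 1, 1)) (\<lambda>p.
      DV (0, 1, 0) (0, 0, 1) p (1, 0, 0) - DV (1, 0, 0) (0, 0, 1) p (0, 1, 0)
      + DV (1, 0, 0) (0, 1, 0) p (0, 0, 1))"
  proof (rule integral_cong)
    fix p :: "real \<times> real \<times> real" assume p: "p \<in> box (0, 0, 0) (1, 1, 1)"
    show "jacobian3 A B C p = DV (0, 1, 0) (0, 0, 1) p (1, 0, 0) - DV (1, 0, 0) (0, 0, 1) p (0, 1, 0)
      + DV (1, 0, 0) (0, 1, 0) p (0, 0, 1)"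
      unfolding jacobian3_def DV_def M_def minor_def
        sym[OF p, of "(0, 1, 0)" "(1, 0, 0)"] sym[OF p, of "(0, 0, 1)" "(1, 0, 0)"]
        sym[OF p, of "(0, 0, 1)" "(0, 1, 0)"]
      by (simp add: algebra_simps)
  qed
  also have "\<dots> = integral unit_cube (\<lambda>p.
      DV (0, 1, 0) (0, 0, 1) p (1, 0, 0) - DV (1, 0, 0) (0, 0, 1) p (0, 1, 0)
      + DV (1, 0, 0) (0, 1, 0) p (0, 0, 1))"
    by (rule integral_open_interval)
  also have "\<dots> = integral unit_cube (\<lambda>p. DV (0, 1, 0) (0, 0, 1) p (1, 0, 0))
      - integral unit_cube (\<lambda>p. DV (1, 0, 0) (0, 0, 1) p (0, 1, 0))
      + integral unit_cube (\<lambda>p. DV (1, 0, 0) (0, 1, 0) p (0, 0, 1))"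
    by (simp add: integral_add integral_diff integrable_diff int)
  finally show ?thesis
    unfolding cube_FTC1[OF V] cube_FTC2[OF V] cube_FTC3[OF V] unfolding V_def .
qed

lemma smooth_on_cube_C2:
  assumes "smooth_on_cube f"
  obtains D where "C2_on unit_cube f D"
proof -
  obtain S F where S: "open S" "unit_cube \<subseteq> S" and F: "\<And>k. Ck_on k F S"
    and eq: "\<And>p. p \<in> unit_cube \<Longrightarrow> F p = f p"
    using assms unfolding smooth_on_cube_def by blast
  have 1: "C1_on unit_cube G (\<lambda>p. frechet_derivative G (at p))" if "Ck_on 1 G S" for G
  proof -
    have d: "G differentiable_on S" and c: "continuous_on S (\<lambda>p. frechet_derivative G (at p) h)" for h
      using that by (auto simp: One_nat_def simp del: split_paired_All)
    have "(G has_derivative frechet_derivative G (at p)) (at p within unit_cube)" if "p \<in> unit_cube" for p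
    proof -
      have "p \<in> S" using that S by blast
      then have "G differentiable (at p)"
        using d S at_within_open[of p S] unfolding differentiable_on_def by metis
      then show ?thesis using frechet_derivative_works has_derivative_at_withinI by blast
    qed
    then show ?thesis
      unfolding C1_on_def using c S by (blast intro: continuous_on_subset)
  qed
  have F2: "Ck_on 2 F S" by (rule F)
  have "C1_on unit_cube f (\<lambda>p. frechet_derivative F (at p))"
    by (rule C1_on_cong[OF 1[OF F] eq])
  moreover have "\<exists>E. C1_on unit_cube (\<lambda>p. frechet_derivative F (at p) h) E" for h
    using 1[of "\<lambda>p. frechet_derivative F (at p) h"] F2 by (auto simp: numeral_2_eq_2 One_nat_def simp del: split_paired_All)
  ultimately have "C2_on unit_cube f (\<lambda>p. frechet_derivative F (at p))"
    unfolding C2_on_def by blast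
  then show ?thesis by (rule that)
qed

section \<open>Forms on singular squares and Stokes' theorem for cubical cycles\<close>

definition chain_eval :: "('a \<Rightarrow> complex) \<Rightarrow> ('a \<Rightarrow>\<^sub>0 int) \<Rightarrow> complex" where
  "chain_eval b z = (\<Sum>\<sigma> \<in> Poly_Mapping.keys z. of_int (Poly_Mapping.lookup z \<sigma>) * b \<sigma>)"

lemma chain_eval_superset:
  assumes "finite S" "Poly_Mapping.keys z \<subseteq> S"
  shows "chain_eval b z = (\<Sum>\<sigma> \<in> S. of_int (Poly_Mapping.lookup z \<sigma>) * b \<sigma>)"
  unfolding chain_eval_def
  by (rule sum.mono_neutral_left) (use assms in \<open>auto simp: in_keys_iff\<close>)

lemma chain_eval_add: "chain_eval b (x + y) = chain_eval b x + chain_eval b y"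
proof -
  let ?S = "Poly_Mapping.keys x \<union> Poly_Mapping.keys y"
  have "Poly_Mapping.keys (x + y) \<subseteq> ?S" by (rule keys_add)
  then show ?thesis
    by (simp add: chain_eval_superset[of ?S] lookup_add sum.distrib algebra_simps)
qed

lemma chain_eval_diff: "chain_eval b (x - y) = chain_eval b x - chain_eval b y"
  using chain_eval_add[of b "x - y" y] by simp

lemma chain_eval_sum: "chain_eval b (sum f A) = (\<Sum>i\<in>A. chain_eval b (f i))"
proof (induction A rule: infinite_finite_induct)
  case (insert x F)
  then show ?case by (simp add: chain_eval_add)
qed (simp_all add: chain_eval_def)

lemma chain_eval_cmul: "chain_eval b (frag_cmul k z) = of_int k * chain_eval b z"
  by (subst chain_eval_superset[of "Poly_Mapping.keys z"])
     (auto simp: keys_cmul chain_eval_def sum_distrib_left mult.assoc)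

lemma chain_eval_frag_of: "chain_eval b (frag_of \<sigma>) = b \<sigma>"
  by (simp add: chain_eval_def)

lemma chain_eval_frag_extend:
  "chain_eval b (frag_extend f \<Gamma>) =
     (\<Sum>c \<in> Poly_Mapping.keys \<Gamma>. of_int (Poly_Mapping.lookup \<Gamma> c) * chain_eval b (f c))"
  by (simp add: frag_extend_def chain_eval_sum chain_eval_cmul)

text \<open>The integral of \<open>\<alpha> d\<beta> \<and> d\<gamma>\<close> over a singular square.\<close>

definition square_form ::
  "(point \<Rightarrow> complex) \<Rightarrow> (point \<Rightarrow> complex) \<Rightarrow> (point \<Rightarrow> complex) \<Rightarrow> (real \<times> real \<Rightarrow> point) \<Rightarrow> complex" where
  "square_form \<alpha> \<beta> \<gamma> \<sigma> = integral (box (0, 0) (1, 1)) (\<lambda>(x, y). \<alpha> (\<sigma> (x, y)) *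
     (vector_derivative (\<lambda>x. \<beta> (\<sigma> (x, y))) (at x) * vector_derivative (\<lambda>y. \<gamma> (\<sigma> (x, y))) (at y)
      - vector_derivative (\<lambda>y. \<beta> (\<sigma> (x, y))) (at y) * vector_derivative (\<lambda>x. \<gamma> (\<sigma> (x, y))) (at x)))"

lemma vector_derivative_locally_const:
  fixes f :: "real \<Rightarrow> complex"
  assumes "\<And>z. z \<in> {a<..<b} \<Longrightarrow> f z = c" "x \<in> {a<..<b}"
  shows "vector_derivative f (at x) = 0"
proof -
  have "(f has_vector_derivative 0) (at x)"
    by (rule has_vector_derivative_transform_within_open[of "\<lambda>_. c" 0 x "{a<..<b}"])
       (use assms in auto)
  then show ?thesis by (rule vector_derivative_at)
qed

text \<open>A square that is constant in one variable has a vanishing column in the 2 x 2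
  determinant.\<close>

lemma square_form_degenerate:
  assumes "degenerate \<sigma>"
  shows "square_form \<alpha> \<beta> \<gamma> \<sigma> = 0"
proof -
  have "square_form \<alpha> \<beta> \<gamma> \<sigma> = integral (box (0, 0) (1, 1)) (\<lambda>q :: real \<times> real. 0)"
    unfolding square_form_def
  proof (rule integral_cong)
    fix q :: "real \<times> real" assume "q \<in> box (0, 0) (1, 1)"
    then obtain x y where q: "q = (x, y)" and xy: "x \<in> {0<..<1}" "y \<in> {0<..<1}"
      by (cases q) (auto simp: mem_box Basis_prod_def)
    from assms consider
      "\<And>x y. x \<in> {0..1} \<Longrightarrow> y \<in> {0..1} \<Longrightarrow> \<sigma> (x, y) = \<sigma> (0, y)"
      | "\<And>x y. x \<in> {0..1} \<Longrightarrow> y \<in> {0..1} \<Longrightarrow> \<sigma> (x, y) = \<sigma> (x, 0)"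
      unfolding degenerate_def by blast
    then show "(case q of (x, y) \<Rightarrow> \<alpha> (\<sigma> (x, y)) *
     (vector_derivative (\<lambda>x. \<beta> (\<sigma> (x, y))) (at x) * vector_derivative (\<lambda>y. \<gamma> (\<sigma> (x, y))) (at y)
      - vector_derivative (\<lambda>y. \<beta> (\<sigma> (x, y))) (at y) * vector_derivative (\<lambda>x. \<gamma> (\<sigma> (x, y))) (at x))) = 0"
    proof cases
      case 1
      have "vector_derivative (\<lambda>x. h (\<sigma> (x, y))) (at x) = 0" for h :: "point \<Rightarrow> complex"
      proof (rule vector_derivative_locally_const[where a = 0 and b = 1 and c = "h (\<sigma> (0, y))"])
        fix z :: real assume "z \<in> {0<..<1}"
        then show "h (\<sigma> (z, y)) = h (\<sigma> (0, y))" using 1[of z y] xy by simp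
      qed (use xy in auto)
      then show ?thesis by (simp add: q)
    next
      case 2
      have "vector_derivative (\<lambda>y. h (\<sigma> (x, y))) (at y) = 0" for h :: "point \<Rightarrow> complex"
      proof (rule vector_derivative_locally_const[where a = 0 and b = 1 and c = "h (\<sigma> (x, 0))"])
        fix z :: real assume "z \<in> {0<..<1}"
        then show "h (\<sigma> (x, z)) = h (\<sigma> (x, 0))" using 2[of x z] xy by simp
      qed (use xy in auto)
      then show ?thesis by (simp add: q)
    qed
  qed
  then show ?thesis by simp
qed

text \<open>Faces enter chains as restricted maps, so two-sided derivatives are meaningful only
  inside the square; \<open>square_form\<close> integrates over the open box for this reason. There
  they agree with derivatives within the closed cube.\<close>

lemma square_form_face:
  assumes \<beta>: "C1_on unit_cube (\<lambda>p. \<beta> (c p)) B" and \<gamma>: "C1_on unit_cube (\<lambda>p. \<gamma> (c p)) C"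
    and \<iota>: "\<And>x y. \<iota> (x, y) = o' + x *\<^sub>R h + y *\<^sub>R k" "\<And>q. q \<in> unit_square \<Longrightarrow> \<iota> q \<in> unit_cube"
  shows "square_form \<alpha> \<beta> \<gamma> (restrict (c \<circ> \<iota>) unit_square)
    = integral unit_square (\<lambda>q. \<alpha> (c (\<iota> q)) * minor B C h k (\<iota> q))"
proof -
  let ?\<sigma> = "restrict (c \<circ> \<iota>) unit_square"
  have vd: "vector_derivative (\<lambda>x. \<delta> (?\<sigma> (x, y))) (at x) = D (\<iota> (x, y)) h"
    "vector_derivative (\<lambda>y. \<delta> (?\<sigma> (x, y))) (at y) = D (\<iota> (x, y)) k"
    if \<delta>: "C1_on unit_cube (\<lambda>p. \<delta> (c p)) D" and xy: "x \<in> {0<..<1}" "y \<in> {0<..<1}" for \<delta> D x y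
  proof -
    have s: "(x, y) \<in> unit_square \<longleftrightarrow> x \<in> {0..1} \<and> y \<in> {0..1}" for x y :: real
      by (auto simp: cbox_Pair_eq)
    have e1: "\<iota> (x, y) = (o' + y *\<^sub>R k) + x *\<^sub>R h" for x y
      unfolding \<iota> by (simp add: algebra_simps)
    have "((\<lambda>x. \<delta> (c ((o' + y *\<^sub>R k) + x *\<^sub>R h))) has_vector_derivative D (\<iota> (x, y)) h) (at x within {0..1})"
      unfolding e1 by (rule C1_on_line[OF \<delta>]) (use \<iota>(2) xy s in \<open>auto simp flip: e1\<close>)
    then have "((\<lambda>x. \<delta> (c (\<iota> (x, y)))) has_vector_derivative D (\<iota> (x, y)) h) (at x within {0<..<1})"
      unfolding e1[symmetric] by (rule has_vector_derivative_within_subset) auto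
    then have "((\<lambda>x. \<delta> (c (\<iota> (x, y)))) has_vector_derivative D (\<iota> (x, y)) h) (at x)"
      using xy at_within_open[of x "{0<..<1}"] by simp
    then have "((\<lambda>x. \<delta> (?\<sigma> (x, y))) has_vector_derivative D (\<iota> (x, y)) h) (at x)"
      by (rule has_vector_derivative_transform_within_open[where S = "{0<..<1}"])
         (use xy s in auto)
    then show "vector_derivative (\<lambda>x. \<delta> (?\<sigma> (x, y))) (at x) = D (\<iota> (x, y)) h"
      by (rule vector_derivative_at)
    have "((\<lambda>y. \<delta> (c ((o' + x *\<^sub>R h) + y *\<^sub>R k))) has_vector_derivative D (\<iota> (x, y)) k) (at y within {0..1})"
      unfolding \<iota> by (rule C1_on_line[OF \<delta>]) (use \<iota>(2) xy s in \<open>auto simp flip: \<iota>(1)\<close>)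
    then have "((\<lambda>y. \<delta> (c (\<iota> (x, y)))) has_vector_derivative D (\<iota> (x, y)) k) (at y within {0<..<1})"
      unfolding \<iota>(1)[symmetric] by (rule has_vector_derivative_within_subset) auto
    then have "((\<lambda>y. \<delta> (c (\<iota> (x, y)))) has_vector_derivative D (\<iota> (x, y)) k) (at y)"
      using xy at_within_open[of y "{0<..<1}"] by simp
    then have "((\<lambda>y. \<delta> (?\<sigma> (x, y))) has_vector_derivative D (\<iota> (x, y)) k) (at y)"
      by (rule has_vector_derivative_transform_within_open[where S = "{0<..<1}"])
         (use xy s in auto)
    then show "vector_derivative (\<lambda>y. \<delta> (?\<sigma> (x, y))) (at y) = D (\<iota> (x, y)) k"
      by (rule vector_derivative_at)
  qed
  have "square_form \<alpha> \<beta> \<gamma> ?\<sigma> = integral (box (0, 0) (1, 1)) (\<lambda>q. \<alpha> (c (\<iota> q)) * minor B C h k (\<iota> q))"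
    unfolding square_form_def
  proof (rule integral_cong)
    fix q :: "real \<times> real" assume "q \<in> box (0, 0) (1, 1)"
    then obtain x y where q: "q = (x, y)" and xy: "x \<in> {0<..<1}" "y \<in> {0<..<1}"
      by (cases q) (auto simp: mem_box Basis_prod_def)
    have "(x, y) \<in> unit_square" using xy by (auto simp: cbox_Pair_eq)
    then show "(case q of (x, y) \<Rightarrow> \<alpha> (?\<sigma> (x, y)) *
     (vector_derivative (\<lambda>x. \<beta> (?\<sigma> (x, y))) (at x) * vector_derivative (\<lambda>y. \<gamma> (?\<sigma> (x, y))) (at y)
      - vector_derivative (\<lambda>y. \<beta> (?\<sigma> (x, y))) (at y) * vector_derivative (\<lambda>x. \<gamma> (?\<sigma> (x, y))) (at x)))
      = \<alpha> (c (\<iota> q)) * minor B C h k (\<iota> q)"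
      using vd[OF \<beta> xy] vd[OF \<gamma> xy] by (simp add: q minor_def)
  qed
  then show ?thesis by (simp add: integral_open_interval)
qed

lemma stokes_cube_boundary:
  assumes \<alpha>: "C1_on unit_cube (\<lambda>p. \<alpha> (c p)) A"
    and \<beta>: "C2_on unit_cube (\<lambda>p. \<beta> (c p)) B" and \<gamma>: "C2_on unit_cube (\<lambda>p. \<gamma> (c p)) C"
  shows "integral unit_cube (jacobian3 A B C) = chain_eval (square_form \<alpha> \<beta> \<gamma>) (cube_boundary c)"
proof -
  note sf = square_form_face[OF C2_onD[OF \<beta>] C2_onD[OF \<gamma>]]
  have f: "chain_eval (square_form \<alpha> \<beta> \<gamma>) (face c \<iota>)
      = integral unit_square (\<lambda>q. \<alpha> (c (\<iota> q)) * minor B C h k (\<iota> q))"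
    if "\<And>x y. \<iota> (x, y) = o' + x *\<^sub>R h + y *\<^sub>R k" "\<And>q. q \<in> unit_square \<Longrightarrow> \<iota> q \<in> unit_cube"
    for \<iota> o' h k
    unfolding face_def chain_eval_frag_of by (rule sf[OF that])
  have 1: "chain_eval (square_form \<alpha> \<beta> \<gamma>) (face c (\<lambda>(x, y). (a, x, y)))
      = integral unit_square (\<lambda>q. \<alpha> (c (a, q)) * minor B C (0, 1, 0) (0, 0, 1) (a, q))" if "a \<in> {0, 1}" for a
    by (subst f[where o' = "(a, 0, 0)" and h = "(0, 1, 0)" and k = "(0, 0, 1)"])
       (use that in \<open>auto simp: cbox_Pair_eq split_beta\<close>)
  have 2: "chain_eval (square_form \<alpha> \<beta> \<gamma>) (face c (\<lambda>(x, y). (x, a, y)))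
      = integral unit_square (\<lambda>q. \<alpha> (c (fst q, a, snd q)) * minor B C (1, 0, 0) (0, 0, 1) (fst q, a, snd q))"
    if "a \<in> {0, 1}" for a
    by (subst f[where o' = "(0, a, 0)" and h = "(1, 0, 0)" and k = "(0, 0, 1)"])
       (use that in \<open>auto simp: cbox_Pair_eq split_beta\<close>)
  have 3: "chain_eval (square_form \<alpha> \<beta> \<gamma>) (face c (\<lambda>(x, y). (x, y, a)))
      = integral unit_square (\<lambda>q. \<alpha> (c (fst q, snd q, a)) * minor B C (1, 0, 0) (0, 1, 0) (fst q, snd q, a))"
    if "a \<in> {0, 1}" for a
    by (subst f[where o' = "(0, 0, a)" and h = "(1, 0, 0)" and k = "(0, 1, 0)"])
       (use that in \<open>auto simp: cbox_Pair_eq split_beta\<close>)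
  show ?thesis
    unfolding cube_boundary_def chain_eval_add chain_eval_diff
    using 1[of 0] 1[of 1] 2[of 0] 2[of 1] 3[of 0] 3[of 1] by (simp add: stokes_cube[OF \<alpha> \<beta> \<gamma>])
qed

text \<open>The boundary term depends only on the restricted faces, hence factors through the free
  abelian group: faces that cancel there drop out, and those that remain are degenerate.\<close>

lemma stokes_cycle:
  assumes cycle: "\<And>\<sigma>. \<sigma> \<in> Poly_Mapping.keys (frag_extend cube_boundary \<Gamma>) \<Longrightarrow> degenerate \<sigma>"
    and "\<And>c. c \<in> Poly_Mapping.keys \<Gamma> \<Longrightarrow> C1_on unit_cube (\<lambda>p. \<alpha> (c p)) (A c)"
    and "\<And>c. c \<in> Poly_Mapping.keys \<Gamma> \<Longrightarrow> C2_on unit_cube (\<lambda>p. \<beta> (c p)) (B c)"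
    and "\<And>c. c \<in> Poly_Mapping.keys \<Gamma> \<Longrightarrow> C2_on unit_cube (\<lambda>p. \<gamma> (c p)) (C c)"
  shows "(\<Sum>c \<in> Poly_Mapping.keys \<Gamma>. of_int (Poly_Mapping.lookup \<Gamma> c)
      * integral unit_cube (jacobian3 (A c) (B c) (C c))) = 0"
proof -
  have "(\<Sum>c \<in> Poly_Mapping.keys \<Gamma>. of_int (Poly_Mapping.lookup \<Gamma> c)
      * integral unit_cube (jacobian3 (A c) (B c) (C c)))
    = chain_eval (square_form \<alpha> \<beta> \<gamma>) (frag_extend cube_boundary \<Gamma>)"
    unfolding chain_eval_frag_extend
    using stokes_cube_boundary assms(2-) by (intro sum.cong) auto
  also have "\<dots> = 0"
    unfolding chain_eval_def using cycle square_form_degenerate by (simp add: sum.neutral)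
  finally show ?thesis .
qed

section \<open>Period integrals over three-cycles\<close>

text \<open>By continuity y z / y p has positive real part near p, so y z = y p csqrt (F z / y p^2)
  with the principal root taken near 1, where it is holomorphic.\<close>

lemma has_derivative_sqrt_branch:
  fixes y :: "'a::real_normed_vector \<Rightarrow> complex"
  assumes F: "(F has_derivative F') (at p within S)" and c: "continuous (at p within S) y"
    and sq: "\<And>z. z \<in> S \<Longrightarrow> y z ^ 2 = F z" and p: "p \<in> S" "y p \<noteq> 0"
  shows "(y has_derivative (\<lambda>h. F' h / (2 * y p))) (at p within S)"
proof -
  have d1: "((\<lambda>z. F z / y p ^ 2) has_derivative (\<lambda>h. F' h / y p ^ 2)) (at p within S)"
    using has_derivative_mult_left[OF F, of "inverse (y p ^ 2)"] by (simp add: divide_inverse)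
  have "F p / y p ^ 2 = 1" using sq[OF p(1)] p(2) by (metis divide_self power_not_zero)
  then have d2: "(csqrt has_derivative (*) (inverse 2)) (at (F p / y p ^ 2))"
    using has_field_derivative_csqrt[of 1] by (simp add: has_field_derivative_def)
  have "((\<lambda>z. csqrt (F z / y p ^ 2)) has_derivative (\<lambda>h. inverse 2 * (F' h / y p ^ 2))) (at p within S)"
    by (rule has_derivative_compose[OF d1 d2])
  then have d: "((\<lambda>z. y p * csqrt (F z / y p ^ 2)) has_derivative (\<lambda>h. y p * (inverse 2 * (F' h / y p ^ 2)))) (at p within S)"
    by (rule has_derivative_mult_right)
  have "((\<lambda>z. y z / y p) \<longlongrightarrow> y p / y p) (at p within S)"
    using c p by (intro tendsto_intros) (auto simp: continuous_within)
  then have "\<forall>\<^sub>F z in at p within S. dist (y z / y p) 1 < 1"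
    using p by (intro tendstoD) auto
  moreover have "\<forall>\<^sub>F z in at p within S. z \<in> S"
    by (simp add: eventually_at_filter)
  ultimately have e: "\<forall>\<^sub>F z in at p within S. y p * csqrt (F z / y p ^ 2) = y z"
  proof eventually_elim
    case (elim z)
    have "\<bar>Re (y z / y p - 1)\<bar> < 1"
      using elim(1) abs_Re_le_cmod[of "y z / y p - 1"] unfolding dist_norm by linarith
    then have "Re (y z / y p) > 0" by simp
    then have "csqrt ((y z / y p) ^ 2) = y z / y p" by (intro csqrt_square) auto
    then show ?case using sq[OF elim(2)] p by (simp add: power_divide)
  qed
  have "(y has_derivative (\<lambda>h. y p * (inverse 2 * (F' h / y p ^ 2)))) (at p within S)"
    by (rule has_derivative_transform_eventually[OF d e]) (use p sq[of p] in auto)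
  then show ?thesis
    by (rule has_derivative_eq_rhs) (use p in \<open>auto simp: fun_eq_iff power2_eq_square\<close>)
qed

lemma continuous_on_poly_comp: "continuous_on S f \<Longrightarrow> continuous_on S (\<lambda>z. poly p (f z))"
  for p :: "complex poly"
  by (rule continuous_on_compose2[of UNIV "poly p"]) (auto intro: poly_isCont continuous_at_imp_continuous_on)

lemma continuous_on_reval:
  assumes "continuous_on S \<sigma>" "continuous_on S \<xi>" "continuous_on S \<eta>" "\<And>z. z \<in> S \<Longrightarrow> \<eta> z \<noteq> 0"
  shows "continuous_on S (\<lambda>z. reval e (\<sigma> z) (\<xi> z) (\<eta> z))"
  by (induction e) (use assms in \<open>auto intro!: continuous_intros continuous_on_poly_comp\<close>)

lemma has_derivative_weier:
  assumes "(\<sigma> has_derivative \<sigma>') (at p within S)" "(\<xi> has_derivative \<xi>') (at p within S)"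
  shows "((\<lambda>z. weier g2 g3 (\<sigma> z) (\<xi> z)) has_derivative
    (\<lambda>h. - (poly (pderiv g2) (\<sigma> p) * \<xi> p + poly (pderiv g3) (\<sigma> p)) * \<sigma>' h
          + (12 * \<xi> p ^ 2 - poly g2 (\<sigma> p)) * \<xi>' h)) (at p within S)"
proof -
  have q: "((\<lambda>z. poly q (\<sigma> z)) has_derivative (\<lambda>h. \<sigma>' h * poly (pderiv q) (\<sigma> p))) (at p within S)" for q
    using has_derivative_compose[OF assms(1) poly_DERIV[of q, unfolded has_field_derivative_def]]
    by (simp add: mult.commute)
  show ?thesis
    unfolding weier_def
    by (rule has_derivative_eq_rhs, (rule derivative_intros q assms)+)
       (auto simp: fun_eq_iff algebra_simps)
qed

text \<open>The product of the two twist factors. The composed parameter is t / (16 fib), and the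
  composed rescaling is (x, y) to (fib^2 x, fib^3 y); \<open>pt_s\<close>, \<open>pt_x\<close>,
  \<open>pt_y\<close> undo it.\<close>

definition fib :: "complex \<Rightarrow> complex \<Rightarrow> complex" where
  "fib u v = (u * (u + 1)) * (v * (v + 1))"

definition pt_x :: "point \<Rightarrow> complex" where
  "pt_x P = coord_X P * inverse (fib (coord_u P) (coord_v P) * fib (coord_u P) (coord_v P))"

definition pt_s :: "complex \<Rightarrow> point \<Rightarrow> complex" where
  "pt_s t P = t * inverse (16 * fib (coord_u P) (coord_v P))"

definition pt_y :: "complex poly \<Rightarrow> complex poly \<Rightarrow> complex \<Rightarrow> complex \<Rightarrow> point \<Rightarrow> complex" where
  "pt_y g2 g3 t0 t P = coord_Y (transport g2 g3 t0 t P) * inverse (fib (coord_u P) (coord_v P) ^ 3)"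

lemma cy3_coeff_eq:
  assumes "u \<notin> {0, - 1}" "v \<notin> {0, - 1}"
  shows "cy3_coeff w g t [u, v] = poly g (t * inverse (16 * fib u v)) * fib u v ^ w"
proof -
  have "u + 1 \<noteq> 0" "v + 1 \<noteq> 0" using assms by (auto simp: eq_neg_iff_add_eq_0)
  then have "twist_param (twist_param t u) v = t * inverse (16 * fib u v)"
    using assms by (simp add: twist_param_def fib_def field_simps)
  then show ?thesis
    by (simp add: cy3_coeff_def k3_coeff_def twist_coeff_def base_coeff_def fib_def Let_def
        power_mult_distrib mult_ac)
qed

lemma rescaled_cubic:
  fixes f :: complex
  assumes "f \<noteq> 0"
  shows "f ^ 6 * (4 * (X * inverse (f * f)) ^ 3 - G * (X * inverse (f * f)) - H)
    = 4 * X ^ 3 - G * f ^ 4 * X - H * f ^ 6"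
proof -
  define x where "x = X * inverse (f * f)"
  have "inverse (f * f) * (f * f) = 1" using assms by (intro left_inverse) simp
  then have X: "X = x * (f * f)" by (metis x_def mult.assoc mult_1_right)
  have "f ^ 6 * (4 * x ^ 3 - G * x - H) = 4 * X ^ 3 - G * f ^ 4 * X - H * f ^ 6"
  proof -
    have e: "X ^ 3 = f ^ 6 * x ^ 3" "f ^ 4 * X = f ^ 6 * x"
      unfolding X by (simp_all add: power_numeral_reduce)
    have "f ^ 6 * (4 * x ^ 3 - G * x - H) = 4 * (f ^ 6 * x ^ 3) - G * (f ^ 6 * x) - H * f ^ 6"
      by (simp add: algebra_simps)
    also have "\<dots> = 4 * X ^ 3 - G * f ^ 4 * X - H * f ^ 6"
      unfolding e(1)[symmetric] e(2)[symmetric] by (simp only: mult.assoc)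
    finally show ?thesis .
  qed
  then show ?thesis unfolding x_def .
qed

lemma log_derivative_algebra_aux: "A * iA = 1 \<Longrightarrow> B * iB = 1 \<Longrightarrow>
    c * (- ((iA * iB) * (A * (k * y) + (l * x) * B) * (iA * iB))) = - (c * (iA * iB)) * (l * iA * x + k * iB * y)"
    for iA iB c :: complex
proof -
  assume h: "A * iA = 1" "B * iB = 1"
  have "c * (- ((iA * iB) * (A * (k * y) + (l * x) * B) * (iA * iB)))
    = - (c * (iA * iB)) * (l * iA * x * (B * iB) + k * iB * y * (A * iA))"
    by (simp add: algebra_simps)
  then show ?thesis unfolding h by (simp only: mult_1_right)
qed

lemma log_derivative_algebra:
  fixes A B :: complex
  assumes "A \<noteq> 0" "B \<noteq> 0"
  shows "t / 16 * (- (inverse (A * B) * (A * (k * y) + (l * x) * B) * inverse (A * B)))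
    = - (t * inverse (16 * (A * B))) * (l / A * x + k / B * y)"
proof -
  have "t * inverse (16 * (A * B)) = t / 16 * (inverse A * inverse B)"
    unfolding inverse_mult_distrib divide_inverse by (simp only: mult.assoc)
  then show ?thesis
    using log_derivative_algebra_aux[OF right_inverse[OF assms(1)] right_inverse[OF assms(2)], of "t / 16" k y l x]
    unfolding inverse_mult_distrib[of A B] divide_inverse[of l] divide_inverse[of k] by (simp only:)
qed

lemma square_root_algebra:
  fixes Y f k w :: complex
  assumes "Y \<noteq> 0" "f \<noteq> 0" "k ^ 2 = f ^ 6 * w * inverse (Y ^ 2)"
  shows "(Y * k * inverse (f ^ 3)) ^ 2 = w"
proof -
  have "(Y * k * inverse (f ^ 3)) ^ 2 = Y ^ 2 * k ^ 2 * inverse (f ^ 6)"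
    by (simp add: power_mult_distrib power_inverse flip: power_mult)
  also have "\<dots> = (Y ^ 2 * inverse (Y ^ 2)) * (f ^ 6 * inverse (f ^ 6)) * w"
    unfolding assms(3) by (simp only: mult_ac)
  also have "\<dots> = w" using assms(1,2) by (simp only: right_inverse power_not_zero mult_1_left not_False_eq_True)
  finally show ?thesis .
qed

text \<open>The weights 4 and 6 of the coefficients make the cubic of the threefold equal to fib^6
  times the Weierstrass cubic at (\<open>pt_s\<close>, \<open>pt_x\<close>). At the base parameter
  it equals Y^2, which identifies the denominator under the root in
  \<open>transport\<close>.\<close>

lemma threefold_props:
  assumes "P \<in> threefold g2 g3 t"
  shows "fst P = [coord_u P, coord_v P]" "coord_u P \<notin> {0, - 1}" "coord_v P \<notin> {0, - 1}"
    "fib (coord_u P) (coord_v P) \<noteq> 0" "coord_Y P \<noteq> 0"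
    "coord_Y P ^ 2 = fib (coord_u P) (coord_v P) ^ 6 * weier g2 g3 (pt_s t P) (pt_x P)"
    "\<And>r. coord_Y (transport g2 g3 t r P) = coord_Y P *
       csqrt (fib (coord_u P) (coord_v P) ^ 6 * weier g2 g3 (pt_s r P) (pt_x P) / coord_Y P ^ 2)"
proof -
  obtain u v X Y where P: "P = ([u, v], X, Y)" and uv: "u \<notin> {0, - 1}" "v \<notin> {0, - 1}" and Y: "Y \<noteq> 0"
    and eq: "Y\<^sup>2 = 4 * X ^ 3 - cy3_coeff 4 g2 t [u, v] * X - cy3_coeff 6 g3 t [u, v]"
    using assms unfolding threefold_def by blast
  have U: "fib u v \<noteq> 0" using uv by (auto simp: fib_def eq_neg_iff_add_eq_0)
  have f: "4 * X ^ 3 - cy3_coeff 4 g2 r [u, v] * X - cy3_coeff 6 g3 r [u, v]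
      = fib u v ^ 6 * weier g2 g3 (pt_s r P) (pt_x P)" for r
    unfolding cy3_coeff_eq[OF uv] weier_def pt_s_def pt_x_def P fst_conv snd_conv
    using rescaled_cubic[OF U] by simp
  show "fst P = [coord_u P, coord_v P]" "coord_u P \<notin> {0, - 1}" "coord_v P \<notin> {0, - 1}"
    "fib (coord_u P) (coord_v P) \<noteq> 0" "coord_Y P \<noteq> 0"
    using uv U Y by (simp_all add: P)
  have sq: "Y ^ 2 = fib u v ^ 6 * weier g2 g3 (pt_s t P) (pt_x P)"
    unfolding f[symmetric] by (rule eq)
  then show "coord_Y P ^ 2 = fib (coord_u P) (coord_v P) ^ 6 * weier g2 g3 (pt_s t P) (pt_x P)"
    by (simp add: P)
  fix r
  have "coord_Y (transport g2 g3 t r P) = Y *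
      csqrt ((4 * X ^ 3 - cy3_coeff 4 g2 r [u, v] * X - cy3_coeff 6 g3 r [u, v])
        / (4 * X ^ 3 - cy3_coeff 4 g2 t [u, v] * X - cy3_coeff 6 g3 t [u, v]))"
    unfolding transport_def P by (simp add: Let_def)
  then show "coord_Y (transport g2 g3 t r P) = coord_Y P *
       csqrt (fib (coord_u P) (coord_v P) ^ 6 * weier g2 g3 (pt_s r P) (pt_x P) / coord_Y P ^ 2)"
    unfolding f sq[symmetric] by (simp add: P)
qed

text \<open>Wedging d\<alpha> with two of the three coordinate differentials isolates one
  coefficient; the minus sign comes from exchanging the first two factors.\<close>

lemma jacobian3_combination:
  "jacobian3 (\<lambda>p h. au p * B p h + av p * C p h + ax p * D p h) C D p = au p * jacobian3 B C D p"
  "jacobian3 (\<lambda>p h. au p * B p h + av p * C p h + ax p * D p h) B D p = - (av p * jacobian3 B C D p)"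
  "jacobian3 (\<lambda>p h. au p * B p h + av p * C p h + ax p * D p h) B C p = ax p * jacobian3 B C D p"
  by (simp_all add: jacobian3_def minor_def algebra_simps)

definition base_region :: "(complex \<times> complex) set" where
  "base_region = (- {0, - 1}) \<times> (- {0, - 1})"

definition base_C1 :: "(complex \<Rightarrow> complex \<Rightarrow> complex) \<Rightarrow> (complex \<Rightarrow> complex \<Rightarrow> complex) \<Rightarrow>
    (complex \<Rightarrow> complex \<Rightarrow> complex) \<Rightarrow> bool" where
  "base_C1 m mu mv \<longleftrightarrow> continuous_on base_region (\<lambda>z. mu (fst z) (snd z)) \<and>
     continuous_on base_region (\<lambda>z. mv (fst z) (snd z)) \<and>
     (\<forall>z \<in> base_region. ((\<lambda>z. m (fst z) (snd z)) has_derivative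
        (\<lambda>h. mu (fst z) (snd z) * fst h + mv (fst z) (snd z) * snd h)) (at z))"

section \<open>Differentials and branches along a fixed three-cycle\<close>

locale cycle_family =
  fixes g2 g3 :: "complex poly" and t0 :: complex and \<Gamma> :: "cube \<Rightarrow>\<^sub>0 int"
  assumes cycle: "three_cycle g2 g3 t0 \<Gamma>"
begin

abbreviation "cubes \<equiv> Poly_Mapping.keys \<Gamma>"

lemma on_threefold: "c \<in> cubes \<Longrightarrow> p \<in> unit_cube \<Longrightarrow> c p \<in> threefold g2 g3 t0"
  using cycle[unfolded three_cycle_def, THEN conjunct1] by (meson image_subset_iff)

text \<open>One derivative family is fixed for each coordinate and cube, so that all forms below are
  built from the same differentials.\<close>

definition Dcoord :: "(point \<Rightarrow> complex) \<Rightarrow> cube \<Rightarrow> (real \<times> real \<times> real) \<Rightarrow> (real \<times> real \<times> real) \<Rightarrow> complex" where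
  "Dcoord f c = (SOME D. C2_on unit_cube (\<lambda>p. f (c p)) D)"

lemma C2_coord:
  assumes "c \<in> cubes" "f \<in> {coord_u, coord_v, coord_X, coord_Y}"
  shows "C2_on unit_cube (\<lambda>p. f (c p)) (Dcoord f c)"
proof -
  have "smooth_on_cube (\<lambda>p. f (c p))"
    using bspec[OF bspec[OF cycle[unfolded three_cycle_def, THEN conjunct1] assms(1), THEN conjunct2] assms(2)] .
  then obtain D where "C2_on unit_cube (\<lambda>p. f (c p)) D" by (rule smooth_on_cube_C2)
  then show ?thesis
    unfolding Dcoord_def by (rule someI[where P = "\<lambda>D. C2_on unit_cube (\<lambda>p. f (c p)) D"])
qed

abbreviation "Du \<equiv> Dcoord coord_u"
abbreviation "Dv \<equiv> Dcoord coord_v"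

lemma coord_nz:
  assumes "c \<in> cubes" "p \<in> unit_cube"
  shows "coord_u (c p) \<notin> {0, - 1}" "coord_v (c p) \<notin> {0, - 1}" "coord_u (c p) + 1 \<noteq> 0"
    "coord_v (c p) + 1 \<noteq> 0" "fib (coord_u (c p)) (coord_v (c p)) \<noteq> 0" "coord_Y (c p) \<noteq> 0"
proof -
  note h = threefold_props[OF on_threefold[OF assms]]
  show "coord_u (c p) \<notin> {0, - 1}" "coord_v (c p) \<notin> {0, - 1}"
    "fib (coord_u (c p)) (coord_v (c p)) \<noteq> 0" "coord_Y (c p) \<noteq> 0"
    by (rule h)+
  show "coord_u (c p) + 1 \<noteq> 0" "coord_v (c p) + 1 \<noteq> 0"
    using h(2,3) by (auto simp: eq_neg_iff_add_eq_0)
qed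

text \<open>Kept in the unsimplified shape produced by the product and sum rules, zero summands
  included, so that these rules unify directly with the goal in \<open>C2_fib\<close>.\<close>

definition Dfib :: "cube \<Rightarrow> (real \<times> real \<times> real) \<Rightarrow> (real \<times> real \<times> real) \<Rightarrow> complex" where
  "Dfib c p h = (coord_u (c p) * (coord_u (c p) + 1)) * (coord_v (c p) * (Dv c p h + 0) + Dv c p h * (coord_v (c p) + 1))
     + (coord_u (c p) * (Du c p h + 0) + Du c p h * (coord_u (c p) + 1)) * (coord_v (c p) * (coord_v (c p) + 1))"

lemma C2_fib:
  assumes "c \<in> cubes"
  shows "C2_on unit_cube (\<lambda>p. fib (coord_u (c p)) (coord_v (c p))) (Dfib c)"
proof -
  have u: "C2_on unit_cube (\<lambda>p. coord_u (c p)) (Du c)" and v: "C2_on unit_cube (\<lambda>p. coord_v (c p)) (Dv c)"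
    by (rule C2_coord[OF assms], simp)+
  show ?thesis
    unfolding fib_def Dfib_def[abs_def]
    by (rule C2_on_mult[OF C2_on_mult[OF u C2_on_add[OF u C2_on_const]]
          C2_on_mult[OF v C2_on_add[OF v C2_on_const]]])
qed

definition Dx :: "cube \<Rightarrow> (real \<times> real \<times> real) \<Rightarrow> (real \<times> real \<times> real) \<Rightarrow> complex" where
  "Dx c p h = (let f = fib (coord_u (c p)) (coord_v (c p)) in
     coord_X (c p) * (- (inverse (f * f) * (f * Dfib c p h + Dfib c p h * f) * inverse (f * f)))
       + Dcoord coord_X c p h * inverse (f * f))"

lemma C2_x:
  assumes "c \<in> cubes"
  shows "C2_on unit_cube (\<lambda>p. pt_x (c p)) (Dx c)"
proof -
  have X: "C2_on unit_cube (\<lambda>p. coord_X (c p)) (Dcoord coord_X c)"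
    by (rule C2_coord[OF assms]) simp
  have i: "C2_on unit_cube (\<lambda>p. inverse (fib (coord_u (c p)) (coord_v (c p)) * fib (coord_u (c p)) (coord_v (c p))))
     (\<lambda>p h. let f = fib (coord_u (c p)) (coord_v (c p)) in
        - (inverse (f * f) * (f * Dfib c p h + Dfib c p h * f) * inverse (f * f)))"
    unfolding Let_def
    by (rule C2_on_inverse[OF C2_on_mult[OF C2_fib[OF assms] C2_fib[OF assms]]])
       (simp only: mult_eq_0_iff coord_nz(5)[OF assms] simp_thms)
  show ?thesis
    unfolding pt_x_def Dx_def[abs_def] Let_def by (rule C2_on_mult[OF X i[unfolded Let_def]])
qed

text \<open>Logarithmic differentiation of s = t / (16 u (u + 1) v (v + 1)) at fixed t. The factor s
  is what later converts s-derivatives into theta.\<close>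

definition Ds :: "complex \<Rightarrow> cube \<Rightarrow> (real \<times> real \<times> real) \<Rightarrow> (real \<times> real \<times> real) \<Rightarrow> complex" where
  "Ds t c p h = - pt_s t (c p) *
     ((2 * coord_u (c p) + 1) / (coord_u (c p) * (coord_u (c p) + 1)) * Du c p h
      + (2 * coord_v (c p) + 1) / (coord_v (c p) * (coord_v (c p) + 1)) * Dv c p h)"

lemma has_derivative_s:
  assumes c: "c \<in> cubes" "p \<in> unit_cube"
  shows "((\<lambda>p. pt_s t (c p)) has_derivative Ds t c p) (at p within unit_cube)"
proof -
  let ?f = "fib (coord_u (c p)) (coord_v (c p))"
  have "C1_on unit_cube (\<lambda>p. fib (coord_u (c p)) (coord_v (c p))) (Dfib c)"
    by (rule C2_onD[OF C2_fib[OF c(1)]])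
  from C1_onD(1)[OF C1_on_mult[OF C1_on_const C1_on_inverse[OF this coord_nz(5)[OF c(1)]]] c(2), of "t / 16"]
  have d: "((\<lambda>p. t / 16 * inverse (fib (coord_u (c p)) (coord_v (c p)))) has_derivative
      (\<lambda>h. t / 16 * (- (inverse ?f * Dfib c p h * inverse ?f)) + 0 * inverse ?f)) (at p within unit_cube)"
    by simp
  have e: "(\<lambda>h. t / 16 * (- (inverse ?f * Dfib c p h * inverse ?f)) + 0 * inverse ?f) = Ds t c p"
  proof
    fix h
    let ?u = "coord_u (c p)" and ?v = "coord_v (c p)"
    have nz: "?u * (?u + 1) \<noteq> 0" "?v * (?v + 1) \<noteq> 0"
      using coord_nz[OF c] unfolding fib_def by (metis mult_eq_0_iff)+
    have "Dfib c p h = (?u * (?u + 1)) * ((2 * ?v + 1) * Dv c p h) + ((2 * ?u + 1) * Du c p h) * (?v * (?v + 1))"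
      by (simp add: Dfib_def algebra_simps)
    then show "t / 16 * (- (inverse ?f * Dfib c p h * inverse ?f)) + 0 * inverse ?f = Ds t c p h"
      unfolding Ds_def pt_s_def fib_def using log_derivative_algebra[OF nz] by simp
  qed
  have "(\<lambda>p. t / 16 * inverse (fib (coord_u (c p)) (coord_v (c p)))) = (\<lambda>p. pt_s t (c p))"
    by (simp add: pt_s_def fun_eq_iff)
  with d e show ?thesis by simp
qed

text \<open>The radicand in \<open>transport\<close>: the cubic at t divided by its value Y^2 at
  t0.\<close>

definition ratio :: "cube \<Rightarrow> complex \<Rightarrow> (real \<times> real \<times> real) \<Rightarrow> complex" where
  "ratio c t p = fib (coord_u (c p)) (coord_v (c p)) ^ 6 * weier g2 g3 (pt_s t (c p)) (pt_x (c p))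
     * inverse (coord_Y (c p) ^ 2)"

text \<open>The open right half-plane contains neither 0 nor the cut of \<open>csqrt\<close>, so the
  transported Y is continuous and nonzero on all cubes.\<close>

definition good :: "complex \<Rightarrow> bool" where
  "good t \<longleftrightarrow> (\<forall>c \<in> cubes. \<forall>p \<in> unit_cube. Re (ratio c t p) > 0)"

lemma continuous_coords:
  assumes "c \<in> cubes"
  shows "continuous_on (T \<times> unit_cube) (\<lambda>z. coord_u (c (snd z)))"
    "continuous_on (T \<times> unit_cube) (\<lambda>z. coord_v (c (snd z)))"
    "continuous_on (T \<times> unit_cube) (\<lambda>z. coord_Y (c (snd z)))"
    "continuous_on (T \<times> unit_cube) (\<lambda>z. fib (coord_u (c (snd z))) (coord_v (c (snd z))))"
    "continuous_on (T \<times> unit_cube) (\<lambda>z. pt_x (c (snd z)))"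
proof -
  have *: "continuous_on (T \<times> unit_cube) (\<lambda>z. f (snd z))" if "C2_on unit_cube f D" for f D
    by (rule continuous_on_compose2[OF C1_onD(3)[OF C2_onD[OF that]]]) (auto intro!: continuous_intros)
  show "continuous_on (T \<times> unit_cube) (\<lambda>z. coord_u (c (snd z)))"
    "continuous_on (T \<times> unit_cube) (\<lambda>z. coord_v (c (snd z)))"
    "continuous_on (T \<times> unit_cube) (\<lambda>z. coord_Y (c (snd z)))"
    "continuous_on (T \<times> unit_cube) (\<lambda>z. fib (coord_u (c (snd z))) (coord_v (c (snd z))))"
    "continuous_on (T \<times> unit_cube) (\<lambda>z. pt_x (c (snd z)))"
    using *[OF C2_coord[OF assms]] *[OF C2_fib[OF assms]] *[OF C2_x[OF assms]] by auto
qed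

lemma continuous_s:
  assumes "c \<in> cubes"
  shows "continuous_on (T \<times> unit_cube) (\<lambda>z. pt_s (fst z) (c (snd z)))"
  unfolding pt_s_def
  by (intro continuous_intros continuous_coords assms) (use coord_nz[OF assms] in auto)

lemma continuous_ratio:
  assumes "c \<in> cubes"
  shows "continuous_on (T \<times> unit_cube) (\<lambda>z. ratio c (fst z) (snd z))"
  unfolding ratio_def weier_def
  by (intro continuous_intros continuous_coords continuous_s continuous_on_poly_comp assms)
     (use coord_nz[OF assms] in auto)

lemma ratio_t0: "c \<in> cubes \<Longrightarrow> p \<in> unit_cube \<Longrightarrow> ratio c t0 p = 1"
  unfolding ratio_def threefold_props(6)[OF on_threefold, symmetric]
  by (rule right_inverse) (use coord_nz(6) in auto)

text \<open>The ratio equals 1 at t0 and is uniformly continuous on a compact product, so it remains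
  within distance 1 of 1 for t near t0. A chain has only finitely many cubes.\<close>

lemma good_ball: obtains \<epsilon> where "\<epsilon> > 0" "\<And>t. t \<in> ball t0 \<epsilon> \<Longrightarrow> good t"
proof -
  have "\<forall>\<^sub>F t in nhds t0. \<forall>p \<in> unit_cube. Re (ratio c t p) > 0" if c: "c \<in> cubes" for c
  proof -
    have "compact (cball t0 1 \<times> unit_cube)" by (intro compact_Times compact_cball compact_cbox)
    with continuous_ratio[OF c] have "uniformly_continuous_on (cball t0 1 \<times> unit_cube) (\<lambda>z. ratio c (fst z) (snd z))"
      by (rule compact_uniformly_continuous)
    then obtain d where d: "d > 0" "\<And>z z'. z \<in> cball t0 1 \<times> unit_cube \<Longrightarrow> z' \<in> cball t0 1 \<times> unit_cube \<Longrightarrow>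
        dist z' z < d \<Longrightarrow> dist (ratio c (fst z') (snd z')) (ratio c (fst z) (snd z)) < 1"
      unfolding uniformly_continuous_on_def using zero_less_one by metis
    have "Re (ratio c t p) > 0" if t: "dist t t0 < min d 1" and p: "p \<in> unit_cube" for t p
    proof -
      have "dist (ratio c t p) (ratio c t0 p) < 1"
        using d(2)[of "(t0, p)" "(t, p)"] t p by (simp add: dist_commute dist_Pair_Pair)
      then have "cmod (ratio c t p - 1) < 1" by (simp add: ratio_t0[OF c p] dist_norm)
      then have "\<bar>Re (ratio c t p - 1)\<bar> < 1" using abs_Re_le_cmod order.strict_trans1 by blast
      then show ?thesis by simp
    qed
    moreover have "\<forall>\<^sub>F t in nhds t0. dist t t0 < min d 1"
      using d by (intro eventually_nhds_ball[of "min d 1" t0, THEN eventually_mono])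
        (auto simp: dist_commute)
    ultimately show ?thesis by (auto elim!: eventually_mono)
  qed
  then have "\<forall>\<^sub>F t in nhds t0. good t"
    unfolding good_def by (intro eventually_ball_finite) auto
  then show ?thesis using that unfolding eventually_nhds_metric by (metis mem_ball dist_commute)
qed

abbreviation "yc t c p \<equiv> pt_y g2 g3 t0 t (c p)"

lemma yc_eq:
  assumes "c \<in> cubes" "p \<in> unit_cube"
  shows "yc t c p = coord_Y (c p) * csqrt (ratio c t p) * inverse (fib (coord_u (c p)) (coord_v (c p)) ^ 3)"
  unfolding pt_y_def ratio_def threefold_props(7)[OF on_threefold[OF assms]] divide_inverse ..

lemma yc_props:
  assumes "good t" "c \<in> cubes" "p \<in> unit_cube"
  shows "yc t c p \<noteq> 0" "yc t c p ^ 2 = weier g2 g3 (pt_s t (c p)) (pt_x (c p))"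
proof -
  have "ratio c t p \<noteq> 0" using assms unfolding good_def by force
  then show "yc t c p \<noteq> 0"
    using coord_nz[OF assms(2,3)] by (simp add: yc_eq[OF assms(2,3)])
  show "yc t c p ^ 2 = weier g2 g3 (pt_s t (c p)) (pt_x (c p))"
    unfolding yc_eq[OF assms(2,3)]
    by (rule square_root_algebra[OF coord_nz(6,5)[OF assms(2,3)]]) (simp only: power2_csqrt ratio_def)
qed

lemma continuous_y:
  assumes "c \<in> cubes" "\<And>t. t \<in> T \<Longrightarrow> good t"
  shows "continuous_on (T \<times> unit_cube) (\<lambda>z. yc (fst z) c (snd z))"
proof -
  have "continuous_on (T \<times> unit_cube) (\<lambda>z. csqrt (ratio c (fst z) (snd z)))"
  proof (rule continuous_on_compose2[of "{w. Re w > 0}" csqrt])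
    show "continuous_on {w. Re w > 0} csqrt"
      by (rule continuous_on_subset[OF continuous_on_csqrt]) (auto simp: complex_nonpos_Reals_iff)
    show "(\<lambda>z. ratio c (fst z) (snd z)) ` (T \<times> unit_cube) \<subseteq> {w. Re w > 0}"
    proof (rule image_subsetI)
      fix z assume "z \<in> T \<times> unit_cube"
      then have "good (fst z)" "snd z \<in> unit_cube" using assms(2) by (auto simp only: mem_Times_iff)
      then show "ratio c (fst z) (snd z) \<in> {w. 0 < Re w}"
        using assms(1) unfolding good_def by blast
    qed
  qed (rule continuous_ratio[OF assms(1)])
  then have "continuous_on (T \<times> unit_cube) (\<lambda>z. coord_Y (c (snd z)) * csqrt (ratio c (fst z) (snd z))
      * inverse (fib (coord_u (c (snd z))) (coord_v (c (snd z))) ^ 3))"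
    by (intro continuous_intros continuous_coords assms) (use coord_nz[OF assms(1)] in auto)
  then show ?thesis
    by (rule continuous_on_eq) (use yc_eq[OF assms(1)] in auto)
qed

lemma continuous_fixed:
  assumes "continuous_on ({t} \<times> unit_cube) f"
  shows "continuous_on unit_cube (\<lambda>p. f (t, p))"
  by (rule continuous_on_compose2[OF assms]) (auto intro!: continuous_intros)

abbreviation "rv t \<psi> c p \<equiv> reval \<psi> (pt_s t (c p)) (pt_x (c p)) (yc t c p)"

lemma continuous_rev:
  assumes "c \<in> cubes" "\<And>t. t \<in> T \<Longrightarrow> good t"
  shows "continuous_on (T \<times> unit_cube) (\<lambda>z. rv (fst z) \<psi> c (snd z))"
  by (intro continuous_on_reval continuous_s continuous_coords continuous_y assms)
     (use yc_props assms in auto)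

lemma has_derivative_rev:
  assumes t: "good t" and c: "c \<in> cubes" "p \<in> unit_cube"
  shows "((\<lambda>p. rv t \<psi> c p) has_derivative (\<lambda>h. rv t (deriv_s g2 g3 \<psi>) c p * Ds t c p h
      + rv t (deriv_x g2 g3 \<psi>) c p * Dx c p h)) (at p within unit_cube)"
proof (rule has_derivative_reval)
  show s: "((\<lambda>p. pt_s t (c p)) has_derivative Ds t c p) (at p within unit_cube)"
    by (rule has_derivative_s[OF c])
  show x: "((\<lambda>p. pt_x (c p)) has_derivative Dx c p) (at p within unit_cube)"
    using C1_onD(1)[OF C2_onD[OF C2_x[OF c(1)]] c(2)] .
  have "continuous_on unit_cube (\<lambda>p. yc t c p)"
    using continuous_fixed[OF continuous_y[OF c(1), of "{t}"]] t by simp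
  then show "((\<lambda>p. yc t c p) has_derivative
     (\<lambda>h. (- (poly (pderiv g2) (pt_s t (c p)) * pt_x (c p) + poly (pderiv g3) (pt_s t (c p))) * Ds t c p h
          + (12 * pt_x (c p) ^ 2 - poly g2 (pt_s t (c p))) * Dx c p h) / (2 * yc t c p))) (at p within unit_cube)"
    by (intro has_derivative_sqrt_branch[OF has_derivative_weier[OF s x]])
       (use yc_props[OF t] c in \<open>auto simp: continuous_on_eq_continuous_within\<close>)
qed (use yc_props t c in auto)

end

section \<open>Relations between integrals over the cycle coming from exact forms\<close>

lemma exact_form_algebra:
  "M * (S * (- s * (k * U + l * V)) + X * W) + (a * U + b * V) * R
    = (a * R - M * k * (s * S)) * U + (b * R - M * l * (s * S)) * V + M * X * W"
  for M :: complex
  by (simp add: algebra_simps)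

lemma linear_solve:
  fixes a b c d k :: complex
  shows "0 = (- 1) * (1 * a + 1 * b) + (- 2) * (1 * c + 2 * d) \<Longrightarrow> a + b = - 2 * c - 4 * d"
    and "0 = (- 1) * a + (- k) * (1 * b + 1 / 2 * c) \<Longrightarrow> a = - k * (b + 1 / 2 * c)"
proof -
  assume "0 = (- 1) * (1 * a + 1 * b) + (- 2) * (1 * c + 2 * d)"
  then have "a + b + (2 * c + 4 * d) = 0" by (simp add: algebra_simps)
  then have "a + b = - (2 * c + 4 * d)" by (simp only: add_eq_0_iff2)
  then show "a + b = - 2 * c - 4 * d" by simp
next
  assume "0 = (- 1) * a + (- k) * (1 * b + 1 / 2 * c)"
  then have "- a = k * (b + 1 / 2 * c)" by simp
  then have "a = - (k * (b + 1 / 2 * c))" by (metis minus_minus)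
  then show "a = - k * (b + 1 / 2 * c)" by simp
qed

text \<open>The computation rests on (2 u + 1)^2 = 4 u (u + 1) + 1. The same identity in v drives
  \<open>reduce_v_algebra\<close>.\<close>

lemma reduce_u_algebra:
  fixes u :: complex
  assumes "u \<noteq> 0" "u + 1 \<noteq> 0"
  shows "(2 * f - (2 * u + 1) ^ 2 * inverse (u * (u + 1)) * f) * r
      - (2 * u + 1) * f * ((2 * u + 1) / (u * (u + 1))) * r'
    = (- 1) * ((inverse (u * (u + 1)) * f) * (r + r')) + (- 2) * (f * (r + 2 * r'))"
proof -
  define w where "w = inverse (u * (u + 1))"
  have w: "(2 * u + 1) ^ 2 * w = 4 + w"
  proof -
    have "(2 * u + 1) ^ 2 * w = 4 * (u * (u + 1) * w) + w"
      by (simp add: power2_eq_square algebra_simps)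
    also have "u * (u + 1) * w = 1" unfolding w_def using assms by (intro right_inverse) simp
    finally show ?thesis by simp
  qed
  have "(2 * f - (2 * u + 1) ^ 2 * inverse (u * (u + 1)) * f) * r
      - (2 * u + 1) * f * ((2 * u + 1) / (u * (u + 1))) * r'
    = (2 * f - ((2 * u + 1) ^ 2 * w) * f) * r - ((2 * u + 1) ^ 2 * w) * f * r'"
    unfolding w_def divide_inverse power2_eq_square by (simp only: mult_ac)
  also have "\<dots> = (- 1) * ((w * f) * (r + r')) + (- 2) * (f * (r + 2 * r'))"
    unfolding w by (simp add: algebra_simps)
  finally show ?thesis unfolding w_def .
qed

lemma reduce_v_algebra:
  fixes v :: complex
  assumes A: "A \<noteq> 0" and B: "v * (v + 1) \<noteq> 0"
  shows "2 * inverse A * (t * inverse (16 * (A * (v * (v + 1)))) * r)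
      - (2 * v + 1) * inverse A * ((2 * v + 1) / (v * (v + 1)))
          * (t * inverse (16 * (A * (v * (v + 1)))) * (r + r'))
    = (- 1) * (inverse (A * (v * (v + 1))) * (t * inverse (16 * (A * (v * (v + 1)))) * (r + r')))
      + (- (t / 4)) * ((inverse A * inverse (A * (v * (v + 1)))) * (r' + 1 / 2 * r))"
proof -
  define w where "w = inverse (v * (v + 1))"
  define i where "i = inverse A"
  have w: "(2 * v + 1) ^ 2 * w = 4 + w"
  proof -
    have "(2 * v + 1) ^ 2 * w = 4 * (v * (v + 1) * w) + w"
      by (simp add: power2_eq_square algebra_simps)
    also have "v * (v + 1) * w = 1" unfolding w_def using B by (rule right_inverse)
    finally show ?thesis by simp
  qed
  have s: "t * inverse (16 * (A * (v * (v + 1)))) = t / 16 * (i * w)"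
    unfolding i_def w_def inverse_mult_distrib[of 16] inverse_mult_distrib[of A] divide_inverse
    by (simp only: mult.assoc)
  have f: "inverse (A * (v * (v + 1))) = i * w"
    unfolding i_def w_def by (rule inverse_mult_distrib)
  define T where "T = t / 16"
  have t: "t / 4 = T * 4" by (simp add: T_def)
  have "2 * i * (T * (i * w) * r) - (2 * v + 1) * i * ((2 * v + 1) * w) * (T * (i * w) * (r + r'))
      = 2 * i * (T * (i * w) * r) - ((2 * v + 1) ^ 2 * w) * i * (T * (i * w) * (r + r'))"
    unfolding power2_eq_square by (simp only: mult_ac)
  also have "\<dots> = (- 1) * ((i * w) * (T * (i * w) * (r + r')))
      + (- T) * ((i * (i * w)) * (4 * (r' + 1 / 2 * r)))"
    unfolding w by (simp add: algebra_simps)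
  also have "(- T) * ((i * (i * w)) * (4 * (r' + 1 / 2 * r))) = (- (t / 4)) * ((i * (i * w)) * (r' + 1 / 2 * r))"
    unfolding t by (simp only: mult_ac mult_minus_left)
  finally show ?thesis
    unfolding s f T_def i_def[symmetric] divide_inverse[of "2 * v + 1" "v * (v + 1)"] w_def[symmetric] .
qed

context cycle_family
begin

definition jac :: "cube \<Rightarrow> real \<times> real \<times> real \<Rightarrow> complex" where
  "jac c = jacobian3 (Du c) (Dv c) (Dx c)"

definition chain_int :: "(cube \<Rightarrow> real \<times> real \<times> real \<Rightarrow> complex) \<Rightarrow> complex" where
  "chain_int f = (\<Sum>c \<in> cubes. of_int (Poly_Mapping.lookup \<Gamma> c) * integral unit_cube (\<lambda>p. jac c p * f c p))"

lemma C2_uv: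
  assumes "c \<in> cubes"
  shows "C2_on unit_cube (\<lambda>p. coord_u (c p)) (Du c)" "C2_on unit_cube (\<lambda>p. coord_v (c p)) (Dv c)"
  by (rule C2_coord[OF assms], simp)+

lemma continuous_jac:
  assumes "c \<in> cubes"
  shows "continuous_on unit_cube (jac c)"
  unfolding jac_def jacobian3_def[abs_def] minor_def[abs_def]
  by (intro continuous_intros C1_onD(2)[OF C2_onD[OF C2_uv(1)[OF assms]]]
      C1_onD(2)[OF C2_onD[OF C2_uv(2)[OF assms]]] C1_onD(2)[OF C2_onD[OF C2_x[OF assms]]])

lemma chain_int_cong:
  assumes "\<And>c p. c \<in> cubes \<Longrightarrow> p \<in> unit_cube \<Longrightarrow> f c p = g c p"
  shows "chain_int f = chain_int g"
  unfolding chain_int_def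
  by (intro sum.cong refl arg_cong2[where f = "(*)"] integral_cong) (simp only: assms)

lemma chain_int_cmul: "chain_int (\<lambda>c p. k * f c p) = k * chain_int f"
  unfolding chain_int_def by (simp add: sum_distrib_left mult.left_commute[of _ k])

lemma chain_int_add:
  assumes "\<And>c. c \<in> cubes \<Longrightarrow> continuous_on unit_cube (f c)"
    and "\<And>c. c \<in> cubes \<Longrightarrow> continuous_on unit_cube (g c)"
  shows "chain_int (\<lambda>c p. f c p + g c p) = chain_int f + chain_int g"
proof -
  have "integral unit_cube (\<lambda>p. jac c p * (f c p + g c p))
      = integral unit_cube (\<lambda>p. jac c p * f c p) + integral unit_cube (\<lambda>p. jac c p * g c p)"
    if "c \<in> cubes" for c
    unfolding distrib_left
    by (intro integral_add integrable_continuous continuous_intros continuous_jac assms that)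
  then show ?thesis
    unfolding chain_int_def by (simp add: distrib_left sum.distrib)
qed

lemma in_base_region: "c \<in> cubes \<Longrightarrow> p \<in> unit_cube \<Longrightarrow> (coord_u (c p), coord_v (c p)) \<in> base_region"
  using coord_nz(1,2) unfolding base_region_def by blast

lemma continuous_base:
  assumes "c \<in> cubes" "continuous_on base_region (\<lambda>z. m (fst z) (snd z))"
  shows "continuous_on unit_cube (\<lambda>p. m (coord_u (c p)) (coord_v (c p)))"
proof -
  have "continuous_on unit_cube (\<lambda>p. (coord_u (c p), coord_v (c p)))"
    by (intro continuous_on_Pair C1_onD(3)[OF C2_onD[OF C2_uv(1)[OF assms(1)]]]
        C1_onD(3)[OF C2_onD[OF C2_uv(2)[OF assms(1)]]])
  then have "continuous_on unit_cube (\<lambda>p. m (fst (coord_u (c p), coord_v (c p))) (snd (coord_u (c p), coord_v (c p))))"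
    by (rule continuous_on_compose2[OF assms(2)]) (use in_base_region[OF assms(1)] in blast)
  then show ?thesis by (simp only: fst_conv snd_conv)
qed

lemma continuous_rv_fixed:
  assumes "c \<in> cubes" "good t"
  shows "continuous_on unit_cube (\<lambda>p. rv t \<psi> c p)"
  using continuous_fixed[OF continuous_rev[OF assms(1), of "{t}" \<psi>]] assms(2) by simp

text \<open>The integral of m(u, v) \<psi>(s, x, y) du dv dx over the transported cycle, in the
  unscaled coordinate x. The holomorphic form du dv dX/Y is the case m = 1/fib, \<psi> =
  1/y.\<close>

definition Q :: "(complex \<Rightarrow> complex \<Rightarrow> complex) \<Rightarrow> rexp \<Rightarrow> complex \<Rightarrow> complex" where
  "Q m \<psi> t = chain_int (\<lambda>c p. m (coord_u (c p)) (coord_v (c p)) * rv t \<psi> c p)"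

text \<open>These integrate d(m \<psi>) wedged with dv dx, du dx and du dv. Since ds is - s times
  the logarithmic differential of fib at fixed t, the s-derivative of \<psi> appears only through
  theta.\<close>

lemma exact_forms:
  assumes t: "good t" and m: "base_C1 m mu mv"
  shows "chain_int (\<lambda>c p. mu (coord_u (c p)) (coord_v (c p)) * rv t \<psi> c p
      - m (coord_u (c p)) (coord_v (c p)) * ((2 * coord_u (c p) + 1) / (coord_u (c p) * (coord_u (c p) + 1)))
          * rv t (theta_s g2 g3 \<psi>) c p) = 0"
    and "chain_int (\<lambda>c p. mv (coord_u (c p)) (coord_v (c p)) * rv t \<psi> c p
      - m (coord_u (c p)) (coord_v (c p)) * ((2 * coord_v (c p) + 1) / (coord_v (c p) * (coord_v (c p) + 1)))
          * rv t (theta_s g2 g3 \<psi>) c p) = 0"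
    and "chain_int (\<lambda>c p. m (coord_u (c p)) (coord_v (c p)) * rv t (deriv_x g2 g3 \<psi>) c p) = 0"
proof -
  define au where "au = (\<lambda>(c :: cube) p. mu (coord_u (c p)) (coord_v (c p)) * rv t \<psi> c p
      - m (coord_u (c p)) (coord_v (c p)) * ((2 * coord_u (c p) + 1) / (coord_u (c p) * (coord_u (c p) + 1)))
          * rv t (theta_s g2 g3 \<psi>) c p)"
  define av where "av = (\<lambda>(c :: cube) p. mv (coord_u (c p)) (coord_v (c p)) * rv t \<psi> c p
      - m (coord_u (c p)) (coord_v (c p)) * ((2 * coord_v (c p) + 1) / (coord_v (c p) * (coord_v (c p) + 1)))
          * rv t (theta_s g2 g3 \<psi>) c p)"
  define ax where "ax = (\<lambda>(c :: cube) p. m (coord_u (c p)) (coord_v (c p)) * rv t (deriv_x g2 g3 \<psi>) c p)"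
  \<comment> \<open>The coefficient is a function on the threefold rather than on single cubes; this
    is what lets adjacent faces cancel.\<close>
  define \<alpha> where "\<alpha> = (\<lambda>P. m (coord_u P) (coord_v P) * reval \<psi> (pt_s t P) (pt_x P) (pt_y g2 g3 t0 t P))"
  define A where "A = (\<lambda>c p h. au c p * Du c p h + av c p * Dv c p h + ax c p * Dx c p h)"
  have mc: "continuous_on base_region (\<lambda>z. m (fst z) (snd z))"
    using m unfolding base_C1_def
    by (intro continuous_at_imp_continuous_on) (blast dest: has_derivative_continuous)
  have A: "C1_on unit_cube (\<lambda>p. \<alpha> (c p)) (A c)" if c: "c \<in> cubes" for c
    unfolding C1_on_def
  proof (intro conjI ballI allI)
    note uv = C1_onD[OF C2_onD[OF C2_uv(1)[OF c]]] C1_onD[OF C2_onD[OF C2_uv(2)[OF c]]]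
      C1_onD[OF C2_onD[OF C2_x[OF c]]]
    have muv: "continuous_on base_region (\<lambda>z. mu (fst z) (snd z))" "continuous_on base_region (\<lambda>z. mv (fst z) (snd z))"
      using m unfolding base_C1_def by auto
    show "continuous_on unit_cube (\<lambda>p. A c p h)" for h
      unfolding A_def au_def av_def ax_def
      by (intro continuous_intros continuous_base[OF c] continuous_rv_fixed c t mc muv uv)
         (use coord_nz[OF c] in auto)
    fix p assume p: "p \<in> unit_cube"
    let ?u = "coord_u (c p)" and ?v = "coord_v (c p)"
    have "((\<lambda>p. (coord_u (c p), coord_v (c p))) has_derivative (\<lambda>h. (Du c p h, Dv c p h))) (at p within unit_cube)"
      by (intro has_derivative_Pair uv p)
    moreover have "((\<lambda>z. m (fst z) (snd z)) has_derivative
        (\<lambda>h. mu ?u ?v * fst h + mv ?u ?v * snd h)) (at (?u, ?v))"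
      using m in_base_region[OF c p] unfolding base_C1_def by fastforce
    ultimately have dm: "((\<lambda>p. m (coord_u (c p)) (coord_v (c p))) has_derivative
        (\<lambda>h. mu ?u ?v * Du c p h + mv ?u ?v * Dv c p h)) (at p within unit_cube)"
      using has_derivative_compose by fastforce
    have "((\<lambda>p. \<alpha> (c p)) has_derivative (\<lambda>h. m ?u ?v * (rv t (deriv_s g2 g3 \<psi>) c p * Ds t c p h
        + rv t (deriv_x g2 g3 \<psi>) c p * Dx c p h)
        + (mu ?u ?v * Du c p h + mv ?u ?v * Dv c p h) * rv t \<psi> c p)) (at p within unit_cube)"
      unfolding \<alpha>_def by (rule has_derivative_mult[OF dm has_derivative_rev[OF t c p]])
    moreover have "rv t (theta_s g2 g3 \<psi>) c p = pt_s t (c p) * rv t (deriv_s g2 g3 \<psi>) c p"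
      by (simp add: theta_s_def)
    ultimately show "((\<lambda>p. \<alpha> (c p)) has_derivative A c p) (at p within unit_cube)"
      unfolding A_def au_def av_def ax_def Ds_def
      by (elim has_derivative_eq_rhs) (simp only: exact_form_algebra)
  qed
  have cyc: "\<And>\<sigma>. \<sigma> \<in> Poly_Mapping.keys (frag_extend cube_boundary \<Gamma>) \<Longrightarrow> degenerate \<sigma>"
    using cycle[unfolded three_cycle_def, THEN conjunct2] by (rule bspec)
  have au: "chain_int au = 0"
  proof -
    have "(\<Sum>c \<in> cubes. of_int (Poly_Mapping.lookup \<Gamma> c) * integral unit_cube (jacobian3 (A c) (Dv c) (Dx c))) = 0"
      by (rule stokes_cycle[where \<alpha> = \<alpha> and \<beta> = coord_v and \<gamma> = pt_x and A = A and B = Dv and C = Dx];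
          (rule cyc A C2_uv C2_x | assumption)+)
    moreover have "jacobian3 (A c) (Dv c) (Dx c) = (\<lambda>p. jac c p * au c p)" for c
      unfolding A_def jac_def by (rule ext) (simp only: jacobian3_combination mult.commute)
    ultimately show ?thesis
      unfolding chain_int_def by (simp only: )
  qed
  have av: "chain_int av = 0"
  proof -
    have "(\<Sum>c \<in> cubes. of_int (Poly_Mapping.lookup \<Gamma> c) * integral unit_cube (jacobian3 (A c) (Du c) (Dx c))) = 0"
      by (rule stokes_cycle[where \<alpha> = \<alpha> and \<beta> = coord_u and \<gamma> = pt_x and A = A and B = Du and C = Dx];
          (rule cyc A C2_uv C2_x | assumption)+)
    moreover have "jacobian3 (A c) (Du c) (Dx c) = (\<lambda>p. - (jac c p * av c p))" for c
      unfolding A_def jac_def by (rule ext) (simp only: jacobian3_combination mult.commute)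
    ultimately show ?thesis
      unfolding chain_int_def by (simp only: integral_neg mult_minus_right sum_negf neg_equal_0_iff_equal)
  qed
  have ax: "chain_int ax = 0"
  proof -
    have "(\<Sum>c \<in> cubes. of_int (Poly_Mapping.lookup \<Gamma> c) * integral unit_cube (jacobian3 (A c) (Du c) (Dv c))) = 0"
      by (rule stokes_cycle[where \<alpha> = \<alpha> and \<beta> = coord_u and \<gamma> = coord_v and A = A and B = Du and C = Dv];
          (rule cyc A C2_uv C2_x | assumption)+)
    moreover have "jacobian3 (A c) (Du c) (Dv c) = (\<lambda>p. jac c p * ax c p)" for c
      unfolding A_def jac_def by (rule ext) (simp only: jacobian3_combination mult.commute)
    ultimately show ?thesis
      unfolding chain_int_def by (simp only: )
  qed
  show "chain_int (\<lambda>c p. mu (coord_u (c p)) (coord_v (c p)) * rv t \<psi> c p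
      - m (coord_u (c p)) (coord_v (c p)) * ((2 * coord_u (c p) + 1) / (coord_u (c p) * (coord_u (c p) + 1)))
          * rv t (theta_s g2 g3 \<psi>) c p) = 0"
    using au unfolding au_def .
  show "chain_int (\<lambda>c p. mv (coord_u (c p)) (coord_v (c p)) * rv t \<psi> c p
      - m (coord_u (c p)) (coord_v (c p)) * ((2 * coord_v (c p) + 1) / (coord_v (c p) * (coord_v (c p) + 1)))
          * rv t (theta_s g2 g3 \<psi>) c p) = 0"
    using av unfolding av_def .
  show "chain_int (\<lambda>c p. m (coord_u (c p)) (coord_v (c p)) * rv t (deriv_x g2 g3 \<psi>) c p) = 0"
    using ax unfolding ax_def .
qed

lemma has_field_derivative_rv:
  assumes T: "\<And>t. t \<in> ball t0 \<epsilon> \<Longrightarrow> good t" and c: "c \<in> cubes" "p \<in> unit_cube" and t: "t \<in> ball t0 \<epsilon>"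
  shows "((\<lambda>t. rv t \<psi> c p) has_field_derivative
    rv t (deriv_s g2 g3 \<psi>) c p * inverse (16 * fib (coord_u (c p)) (coord_v (c p)))) (at t within ball t0 \<epsilon>)"
proof -
  let ?i = "inverse (16 * fib (coord_u (c p)) (coord_v (c p)))"
  have s: "((\<lambda>t. pt_s t (c p)) has_derivative (\<lambda>h. h * ?i)) (at t within ball t0 \<epsilon>)"
    unfolding pt_s_def by (auto intro!: derivative_eq_intros)
  have x: "((\<lambda>t. pt_x (c p)) has_derivative (\<lambda>h. 0)) (at t within ball t0 \<epsilon>)"
    by (rule has_derivative_const)
  have "continuous_on (ball t0 \<epsilon>) (\<lambda>t. yc (fst (t, p)) c (snd (t, p)))"
  proof (rule continuous_on_compose2[OF continuous_y[OF c(1) T]])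
    show "continuous_on (ball t0 \<epsilon>) (\<lambda>t. (t, p))" by (intro continuous_intros)
    show "(\<lambda>t. (t, p)) ` ball t0 \<epsilon> \<subseteq> ball t0 \<epsilon> \<times> unit_cube"
      using c(2) by blast
  qed
  then have "continuous (at t within ball t0 \<epsilon>) (\<lambda>t. yc t c p)"
    using t by (simp add: continuous_on_eq_continuous_within)
  then have y: "((\<lambda>t. yc t c p) has_derivative
     (\<lambda>h. (- (poly (pderiv g2) (pt_s t (c p)) * pt_x (c p) + poly (pderiv g3) (pt_s t (c p))) * (h * ?i)
          + (12 * pt_x (c p) ^ 2 - poly g2 (pt_s t (c p))) * 0) / (2 * yc t c p))) (at t within ball t0 \<epsilon>)"
    by (intro has_derivative_sqrt_branch[OF has_derivative_weier[OF s x]])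
       (use yc_props[OF T c] t in auto)
  have "((\<lambda>t. rv t \<psi> c p) has_derivative (\<lambda>h. rv t (deriv_s g2 g3 \<psi>) c p * (h * ?i)
      + rv t (deriv_x g2 g3 \<psi>) c p * 0)) (at t within ball t0 \<epsilon>)"
    by (rule has_derivative_reval[OF s x y]) (rule yc_props(1)[OF T[OF t] c])
  then show ?thesis
    unfolding has_field_derivative_def
    by (rule has_derivative_eq_rhs) (simp add: fun_eq_iff mult_ac)
qed

text \<open>Transport keeps u, v and x, so t enters only through s and the branch y, and ds/dt = 1 /
  (16 fib).\<close>

lemma Q_has_field_derivative:
  assumes T: "\<And>t. t \<in> ball t0 \<epsilon> \<Longrightarrow> good t" and m: "continuous_on base_region (\<lambda>z. m (fst z) (snd z))"
    and t: "t \<in> ball t0 \<epsilon>"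
  shows "(Q m \<psi> has_field_derivative Q (\<lambda>u v. m u v * inverse (16 * fib u v)) (deriv_s g2 g3 \<psi>) t) (at t)"
proof -
  have snd: "continuous_on (ball t0 \<epsilon> \<times> unit_cube) (\<lambda>z. f (snd z))"
      if "continuous_on unit_cube f" for f :: "_ \<Rightarrow> complex"
      by (rule continuous_on_compose2[OF that]) (auto intro!: continuous_intros)
  have "((\<lambda>t. integral unit_cube (\<lambda>p. jac c p * (m (coord_u (c p)) (coord_v (c p)) * rv t \<psi> c p)))
      has_field_derivative integral unit_cube (\<lambda>p. jac c p * ((m (coord_u (c p)) (coord_v (c p))
         * inverse (16 * fib (coord_u (c p)) (coord_v (c p)))) * rv t (deriv_s g2 g3 \<psi>) c p))) (at t within ball t0 \<epsilon>)"
    if c: "c \<in> cubes" for c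
  proof (rule leibniz_rule_field_derivative)
    fix r p assume r: "r \<in> ball t0 \<epsilon>" and p: "p \<in> unit_cube"
    show "((\<lambda>t. jac c p * (m (coord_u (c p)) (coord_v (c p)) * rv t \<psi> c p)) has_field_derivative
        jac c p * ((m (coord_u (c p)) (coord_v (c p))
         * inverse (16 * fib (coord_u (c p)) (coord_v (c p)))) * rv r (deriv_s g2 g3 \<psi>) c p)) (at r within ball t0 \<epsilon>)"
      using DERIV_cmult[OF DERIV_cmult[OF has_field_derivative_rv[OF T c p r]],
          of "jac c p" "m (coord_u (c p)) (coord_v (c p))" \<psi>] by (simp only: mult_ac)
  next
    fix r assume r: "r \<in> ball t0 \<epsilon>"
    show "(\<lambda>p. jac c p * (m (coord_u (c p)) (coord_v (c p)) * rv r \<psi> c p)) integrable_on unit_cube"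
      by (intro integrable_continuous continuous_intros continuous_jac continuous_base continuous_rv_fixed c m T r)
  next
    have "continuous_on (ball t0 \<epsilon> \<times> unit_cube) (\<lambda>z. jac c (snd z) * ((m (coord_u (c (snd z))) (coord_v (c (snd z)))
         * inverse (16 * fib (coord_u (c (snd z))) (coord_v (c (snd z))))) * rv (fst z) (deriv_s g2 g3 \<psi>) c (snd z)))"
      by (intro continuous_intros snd[OF continuous_jac[OF c]] snd[OF continuous_base[OF c m]]
          continuous_rev[OF c] continuous_coords[OF c] T)
         (use coord_nz[OF c] in auto)
    then show "continuous_on (ball t0 \<epsilon> \<times> unit_cube) (\<lambda>(t, p). jac c p * ((m (coord_u (c p)) (coord_v (c p))
         * inverse (16 * fib (coord_u (c p)) (coord_v (c p)))) * rv t (deriv_s g2 g3 \<psi>) c p))"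
      by (simp add: split_beta)
  qed (use t in auto)
  then have "((\<lambda>t. Q m \<psi> t) has_field_derivative Q (\<lambda>u v. m u v * inverse (16 * fib u v)) (deriv_s g2 g3 \<psi>) t) (at t within ball t0 \<epsilon>)"
    unfolding Q_def chain_int_def by (intro DERIV_sum DERIV_cmult)
  then show ?thesis
    using at_within_open[OF t open_ball] by simp
qed

lemma Q_theta:
  "t * Q (\<lambda>u v. m u v * inverse (16 * fib u v)) (deriv_s g2 g3 \<psi>) t = Q m (theta_s g2 g3 \<psi>) t"
  unfolding Q_def chain_int_cmul[symmetric]
  by (rule chain_int_cong) (simp add: theta_s_def pt_s_def)

abbreviation Q0 :: "rexp \<Rightarrow> complex \<Rightarrow> complex" where
  "Q0 \<equiv> Q (\<lambda>u v. inverse (fib u v))"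

text \<open>An auxiliary weight that is neither the form of the threefold nor of the K3 family:
  \<open>reduce_v\<close> passes from \<open>Q0\<close> to it, and \<open>reduce_u\<close> leads
  back.\<close>

abbreviation Q1 :: "rexp \<Rightarrow> complex \<Rightarrow> complex" where
  "Q1 \<equiv> Q (\<lambda>u v. inverse (u * (u + 1)) * inverse (fib u v))"

lemma base_region_nz:
  assumes "z \<in> base_region"
  shows "fst z \<noteq> 0" "fst z + 1 \<noteq> 0" "snd z \<noteq> 0" "snd z + 1 \<noteq> 0" "fib (fst z) (snd z) \<noteq> 0"
  using assms by (auto simp: base_region_def fib_def eq_neg_iff_add_eq_0)

lemma continuous_inverse_fib:
  "continuous_on base_region (\<lambda>z. inverse (fib (fst z) (snd z)))"
  "continuous_on base_region (\<lambda>z. inverse (fst z * (fst z + 1)) * inverse (fib (fst z) (snd z)))"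
  unfolding fib_def
  by (intro continuous_intros; use base_region_nz in \<open>force simp: fib_def\<close>)+

lemma has_derivative_base_factors:
  "((\<lambda>z. fst z * (fst z + 1)) has_derivative (\<lambda>h. (2 * fst z + 1) * fst h)) (at z)"
  "((\<lambda>z. snd z * (snd z + 1)) has_derivative (\<lambda>h. (2 * snd z + 1) * snd h)) (at z)"
  "((\<lambda>z. 2 * fst z + 1) has_derivative (\<lambda>h. 2 * fst h)) (at z)"
  "((\<lambda>z. 2 * snd z + 1) has_derivative (\<lambda>h. 2 * snd h)) (at z)"
  for z :: "complex \<times> complex"
  by (auto intro!: derivative_eq_intros simp: algebra_simps)

lemma base_C1_v:
  "base_C1 (\<lambda>u v. (2 * v + 1) * inverse (u * (u + 1)))
     (\<lambda>u v. - (2 * v + 1) * (2 * u + 1) * inverse ((u * (u + 1)) ^ 2)) (\<lambda>u v. 2 * inverse (u * (u + 1)))"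
  unfolding base_C1_def
proof (intro conjI ballI)
  have nz: "fst z * (fst z + 1) \<noteq> 0" if "z \<in> base_region" for z
    using base_region_nz(1,2)[OF that] by simp
  then have nz2: "(fst z * (fst z + 1)) ^ 2 \<noteq> 0" if "z \<in> base_region" for z
    using that power_not_zero by blast
  show "continuous_on base_region (\<lambda>z. - (2 * snd z + 1) * (2 * fst z + 1) * inverse ((fst z * (fst z + 1)) ^ 2))"
    by (intro continuous_intros ballI nz2)
  show "continuous_on base_region (\<lambda>z. 2 * inverse (fst z * (fst z + 1)))"
    by (intro continuous_intros ballI nz)
  fix z assume z: "z \<in> base_region"
  show "((\<lambda>z. (2 * snd z + 1) * inverse (fst z * (fst z + 1))) has_derivative
      (\<lambda>h. - (2 * snd z + 1) * (2 * fst z + 1) * inverse ((fst z * (fst z + 1))\<^sup>2) * fst h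
         + 2 * inverse (fst z * (fst z + 1)) * snd h)) (at z)"
  proof (rule has_derivative_eq_rhs[OF has_derivative_mult[OF has_derivative_base_factors(4)
          Deriv.has_derivative_inverse[OF nz[OF z] has_derivative_base_factors(1)]]], rule ext)
    fix h :: "complex \<times> complex"
    define i where "i = inverse (fst z * (fst z + 1))"
    have "inverse ((fst z * (fst z + 1))\<^sup>2) = i * i"
      unfolding i_def power2_eq_square by (rule inverse_mult_distrib)
    then show "(2 * snd z + 1) * - (inverse (fst z * (fst z + 1)) * ((2 * fst z + 1) * fst h) * inverse (fst z * (fst z + 1)))
          + 2 * snd h * inverse (fst z * (fst z + 1))
        = - (2 * snd z + 1) * (2 * fst z + 1) * inverse ((fst z * (fst z + 1))\<^sup>2) * fst h
         + 2 * inverse (fst z * (fst z + 1)) * snd h"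
      unfolding i_def[symmetric] by (simp add: algebra_simps)
  qed
qed

lemma base_C1_u:
  "base_C1 (\<lambda>u v. (2 * u + 1) * inverse (fib u v))
     (\<lambda>u v. 2 * inverse (fib u v) - (2 * u + 1) ^ 2 * inverse (u * (u + 1)) * inverse (fib u v))
     (\<lambda>u v. - (2 * u + 1) * (2 * v + 1) * inverse (v * (v + 1)) * inverse (fib u v))"
  unfolding base_C1_def
proof (intro conjI ballI)
  have nz: "fst z * (fst z + 1) \<noteq> 0" "snd z * (snd z + 1) \<noteq> 0" if "z \<in> base_region" for z
    using base_region_nz[OF that] by simp_all
  show "continuous_on base_region (\<lambda>z. 2 * inverse (fib (fst z) (snd z))
      - (2 * fst z + 1) ^ 2 * inverse (fst z * (fst z + 1)) * inverse (fib (fst z) (snd z)))"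
    by (intro continuous_intros continuous_inverse_fib ballI nz)
  show "continuous_on base_region (\<lambda>z. - (2 * fst z + 1) * (2 * snd z + 1) * inverse (snd z * (snd z + 1))
      * inverse (fib (fst z) (snd z)))"
    by (intro continuous_intros continuous_inverse_fib ballI nz)
  fix z assume z: "z \<in> base_region"
  show "((\<lambda>z. (2 * fst z + 1) * inverse (fib (fst z) (snd z))) has_derivative
      (\<lambda>h. (2 * inverse (fib (fst z) (snd z))
          - (2 * fst z + 1) ^ 2 * inverse (fst z * (fst z + 1)) * inverse (fib (fst z) (snd z))) * fst h
         + (- (2 * fst z + 1) * (2 * snd z + 1) * inverse (snd z * (snd z + 1))
            * inverse (fib (fst z) (snd z))) * snd h)) (at z)"
    unfolding fib_def
  proof (rule has_derivative_eq_rhs[OF has_derivative_mult[OF has_derivative_base_factors(3)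
          Deriv.has_derivative_inverse[OF _ has_derivative_mult[OF has_derivative_base_factors(1,2)]]]])
    show "fst z * (fst z + 1) * (snd z * (snd z + 1)) \<noteq> 0" using nz[OF z] by (metis mult_eq_0_iff)
    show "(\<lambda>h. (2 * fst z + 1) * - (inverse (fst z * (fst z + 1) * (snd z * (snd z + 1)))
        * (fst z * (fst z + 1) * ((2 * snd z + 1) * snd h) + (2 * fst z + 1) * fst h * (snd z * (snd z + 1)))
        * inverse (fst z * (fst z + 1) * (snd z * (snd z + 1))))
        + 2 * fst h * inverse (fst z * (fst z + 1) * (snd z * (snd z + 1))))
      = (\<lambda>h. (2 * inverse (fst z * (fst z + 1) * (snd z * (snd z + 1)))
          - (2 * fst z + 1) ^ 2 * inverse (fst z * (fst z + 1)) * inverse (fst z * (fst z + 1) * (snd z * (snd z + 1)))) * fst h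
         + (- (2 * fst z + 1) * (2 * snd z + 1) * inverse (snd z * (snd z + 1))
            * inverse (fst z * (fst z + 1) * (snd z * (snd z + 1)))) * snd h)"
    proof
      fix h :: "complex \<times> complex"
      define iA iB where "iA = inverse (fst z * (fst z + 1))" and "iB = inverse (snd z * (snd z + 1))"
      have i: "inverse (fst z * (fst z + 1) * (snd z * (snd z + 1))) = iA * iB"
        unfolding iA_def iB_def by (rule inverse_mult_distrib)
      have a: "fst z * (fst z + 1) * iA = 1" "snd z * (snd z + 1) * iB = 1"
        unfolding iA_def iB_def by (rule right_inverse, rule nz[OF z])+
      show "(2 * fst z + 1) * - (inverse (fst z * (fst z + 1) * (snd z * (snd z + 1)))
        * (fst z * (fst z + 1) * ((2 * snd z + 1) * snd h) + (2 * fst z + 1) * fst h * (snd z * (snd z + 1)))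
        * inverse (fst z * (fst z + 1) * (snd z * (snd z + 1))))
        + 2 * fst h * inverse (fst z * (fst z + 1) * (snd z * (snd z + 1)))
      = (2 * inverse (fst z * (fst z + 1) * (snd z * (snd z + 1)))
          - (2 * fst z + 1) ^ 2 * inverse (fst z * (fst z + 1)) * inverse (fst z * (fst z + 1) * (snd z * (snd z + 1)))) * fst h
         + (- (2 * fst z + 1) * (2 * snd z + 1) * inverse (snd z * (snd z + 1))
            * inverse (fst z * (fst z + 1) * (snd z * (snd z + 1)))) * snd h"
        unfolding i log_derivative_algebra_aux[OF a] unfolding iA_def[symmetric] iB_def[symmetric]
        by (simp add: power2_eq_square algebra_simps)
    qed
  qed
qed

lemma base_C1_inverse_fib:
  "base_C1 (\<lambda>u v. inverse (fib u v)) (\<lambda>u v. - inverse (fib u v) * ((2 * u + 1) * inverse (u * (u + 1))))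
     (\<lambda>u v. - inverse (fib u v) * ((2 * v + 1) * inverse (v * (v + 1))))"
  unfolding base_C1_def
proof (intro conjI ballI)
  have nz: "fst z * (fst z + 1) \<noteq> 0" "snd z * (snd z + 1) \<noteq> 0" if "z \<in> base_region" for z
    using base_region_nz[OF that] by simp_all
  show "continuous_on base_region (\<lambda>z. - inverse (fib (fst z) (snd z)) * ((2 * fst z + 1) * inverse (fst z * (fst z + 1))))"
    by (rule continuous_on_mult[OF continuous_on_minus[OF continuous_inverse_fib(1)]])
       (intro continuous_intros ballI nz)
  show "continuous_on base_region (\<lambda>z. - inverse (fib (fst z) (snd z)) * ((2 * snd z + 1) * inverse (snd z * (snd z + 1))))"
    by (rule continuous_on_mult[OF continuous_on_minus[OF continuous_inverse_fib(1)]])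
       (intro continuous_intros ballI nz)
  fix z assume z: "z \<in> base_region"
  show "((\<lambda>z. inverse (fib (fst z) (snd z))) has_derivative
      (\<lambda>h. - inverse (fib (fst z) (snd z)) * ((2 * fst z + 1) * inverse (fst z * (fst z + 1))) * fst h
         + - inverse (fib (fst z) (snd z)) * ((2 * snd z + 1) * inverse (snd z * (snd z + 1))) * snd h)) (at z)"
    unfolding fib_def
  proof (rule has_derivative_eq_rhs[OF
          Deriv.has_derivative_inverse[OF _ has_derivative_mult[OF has_derivative_base_factors(1,2)]]], goal_cases)
    case 1
    show ?case using nz[OF z] by (metis mult_eq_0_iff)
  next
    case 2
    show ?case
    proof
      fix h :: "complex \<times> complex"
      define iA iB where "iA = inverse (fst z * (fst z + 1))" and "iB = inverse (snd z * (snd z + 1))"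
      have i: "inverse (fst z * (fst z + 1) * (snd z * (snd z + 1))) = iA * iB"
        unfolding iA_def iB_def by (rule inverse_mult_distrib)
      have a: "fst z * (fst z + 1) * iA = 1" "snd z * (snd z + 1) * iB = 1"
        unfolding iA_def iB_def by (rule right_inverse, rule nz[OF z])+
      show "- (inverse (fst z * (fst z + 1) * (snd z * (snd z + 1)))
        * (fst z * (fst z + 1) * ((2 * snd z + 1) * snd h) + (2 * fst z + 1) * fst h * (snd z * (snd z + 1)))
        * inverse (fst z * (fst z + 1) * (snd z * (snd z + 1))))
      = - inverse (fst z * (fst z + 1) * (snd z * (snd z + 1))) * ((2 * fst z + 1) * inverse (fst z * (fst z + 1))) * fst h
         + - inverse (fst z * (fst z + 1) * (snd z * (snd z + 1))) * ((2 * snd z + 1) * inverse (snd z * (snd z + 1))) * snd h"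
        using log_derivative_algebra_aux[OF a, of 1 "2 * snd z + 1" "snd h" "2 * fst z + 1" "fst h"]
        unfolding i iA_def[symmetric] iB_def[symmetric]
        by (simp add: algebra_simps)
    qed
  qed
qed

lemma Q_add:
  assumes "good t" "continuous_on base_region (\<lambda>z. m (fst z) (snd z))"
    and "continuous_on base_region (\<lambda>z. m' (fst z) (snd z))"
  shows "chain_int (\<lambda>c p. k * (m (coord_u (c p)) (coord_v (c p)) * rv t \<phi> c p)
      + l * (m' (coord_u (c p)) (coord_v (c p)) * rv t \<psi> c p)) = k * Q m \<phi> t + l * Q m' \<psi> t"
  unfolding Q_def chain_int_cmul[symmetric]
  by (rule chain_int_add; intro continuous_intros continuous_base continuous_rv_fixed assms)

lemma Q_linear:
  assumes "good t" "continuous_on base_region (\<lambda>z. m (fst z) (snd z))"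
    and "\<And>s x y. reval e s x y = k * reval \<phi> s x y + l * reval \<psi> s x y"
  shows "Q m e t = k * Q m \<phi> t + l * Q m \<psi> t"
  unfolding Q_add[OF assms(1,2,2), symmetric] unfolding Q_def assms(3)
  by (rule chain_int_cong) (simp add: algebra_simps)

text \<open>The primitive is (2 u + 1) \<phi> / fib, wedged with dv dx. In operator notation, Q1
  (theta + 1) = - 4 Q0 (theta + 1/2).\<close>

lemma reduce_u:
  assumes t: "good t"
  shows "Q1 \<phi> t + Q1 (theta_s g2 g3 \<phi>) t = - 2 * Q0 \<phi> t - 4 * Q0 (theta_s g2 g3 \<phi>) t"
proof -
  let ?\<psi> = "RAdd \<phi> (theta_s g2 g3 \<phi>)" and ?\<chi> = "RAdd \<phi> (RMul (RConst 2) (theta_s g2 g3 \<phi>))"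
  have "0 = chain_int (\<lambda>c p. (- 1) * ((inverse (coord_u (c p) * (coord_u (c p) + 1))
        * inverse (fib (coord_u (c p)) (coord_v (c p)))) * rv t ?\<psi> c p)
      + (- 2) * (inverse (fib (coord_u (c p)) (coord_v (c p))) * rv t ?\<chi> c p))"
  proof (rule trans[OF exact_forms(1)[OF t base_C1_u, of \<phi>, symmetric]], rule chain_int_cong)
    fix c p assume c: "c \<in> cubes" "p \<in> unit_cube"
    have "coord_u (c p) \<noteq> 0" "coord_u (c p) + 1 \<noteq> 0" using coord_nz[OF c] by auto
    from reduce_u_algebra[OF this]
    show "(2 * inverse (fib (coord_u (c p)) (coord_v (c p))) - (2 * coord_u (c p) + 1)\<^sup>2 *
         inverse (coord_u (c p) * (coord_u (c p) + 1)) * inverse (fib (coord_u (c p)) (coord_v (c p)))) * rv t \<phi> c p -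
        (2 * coord_u (c p) + 1) * inverse (fib (coord_u (c p)) (coord_v (c p))) *
        ((2 * coord_u (c p) + 1) / (coord_u (c p) * (coord_u (c p) + 1))) * rv t (theta_s g2 g3 \<phi>) c p
      = (- 1) * ((inverse (coord_u (c p) * (coord_u (c p) + 1))
        * inverse (fib (coord_u (c p)) (coord_v (c p)))) * rv t ?\<psi> c p)
      + (- 2) * (inverse (fib (coord_u (c p)) (coord_v (c p))) * rv t ?\<chi> c p)"
      by simp
  qed
  also have "\<dots> = (- 1) * Q1 ?\<psi> t + (- 2) * Q0 ?\<chi> t"
    by (rule Q_add[OF t continuous_inverse_fib(2,1)])
  also have "Q1 ?\<psi> t = 1 * Q1 \<phi> t + 1 * Q1 (theta_s g2 g3 \<phi>) t"
    by (rule Q_linear[OF t continuous_inverse_fib(2)]) simp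
  also have "Q0 ?\<chi> t = 1 * Q0 \<phi> t + 2 * Q0 (theta_s g2 g3 \<phi>) t"
    by (rule Q_linear[OF t continuous_inverse_fib(1)]) simp
  finally show ?thesis by (rule linear_solve(1))
qed

text \<open>The primitive is (2 v + 1) s \<psi> / (u (u + 1)), wedged with du dx; the factor s
  supplies the missing 1/fib. In operator notation, Q0 theta s = - (t/4) Q1 (theta + 1/2).\<close>

lemma reduce_v:
  assumes t: "good t"
  shows "Q0 (theta_s g2 g3 (RMul RS \<psi>)) t
    = - (t / 4) * (Q1 (theta_s g2 g3 \<psi>) t + 1 / 2 * Q1 \<psi> t)"
proof -
  let ?\<chi> = "RMul RS \<psi>" and ?\<phi> = "RAdd (theta_s g2 g3 \<psi>) (RMul (RConst (1 / 2)) \<psi>)"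
  have "0 = chain_int (\<lambda>c p. (- 1) * (inverse (fib (coord_u (c p)) (coord_v (c p))) * rv t (theta_s g2 g3 ?\<chi>) c p)
      + (- (t / 4)) * ((inverse (coord_u (c p) * (coord_u (c p) + 1))
        * inverse (fib (coord_u (c p)) (coord_v (c p)))) * rv t ?\<phi> c p))"
  proof (rule trans[OF exact_forms(2)[OF t base_C1_v, of ?\<chi>, symmetric]], rule chain_int_cong)
    fix c p assume c: "c \<in> cubes" "p \<in> unit_cube"
    have nz: "coord_u (c p) * (coord_u (c p) + 1) \<noteq> 0" "coord_v (c p) * (coord_v (c p) + 1) \<noteq> 0"
      using coord_nz[OF c] by auto
    have 1: "rv t ?\<chi> c p = pt_s t (c p) * rv t \<psi> c p"
      "rv t (theta_s g2 g3 ?\<chi>) c p = pt_s t (c p) * (rv t \<psi> c p + rv t (theta_s g2 g3 \<psi>) c p)"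
      by (simp_all add: theta_s_def pderiv_pCons algebra_simps)
    have 2: "rv t ?\<phi> c p = rv t (theta_s g2 g3 \<psi>) c p + 1 / 2 * rv t \<psi> c p" by simp
    show "2 * inverse (coord_u (c p) * (coord_u (c p) + 1)) * rv t ?\<chi> c p -
        (2 * coord_v (c p) + 1) * inverse (coord_u (c p) * (coord_u (c p) + 1)) *
        ((2 * coord_v (c p) + 1) / (coord_v (c p) * (coord_v (c p) + 1))) * rv t (theta_s g2 g3 ?\<chi>) c p
      = (- 1) * (inverse (fib (coord_u (c p)) (coord_v (c p))) * rv t (theta_s g2 g3 ?\<chi>) c p)
      + (- (t / 4)) * ((inverse (coord_u (c p) * (coord_u (c p) + 1))
        * inverse (fib (coord_u (c p)) (coord_v (c p)))) * rv t ?\<phi> c p)"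
      unfolding 1 2 unfolding pt_s_def fib_def by (rule reduce_v_algebra[OF nz])
  qed
  also have "\<dots> = (- 1) * Q0 (theta_s g2 g3 ?\<chi>) t + (- (t / 4)) * Q1 ?\<phi> t"
    by (rule Q_add[OF t continuous_inverse_fib(1,2)])
  also have "Q1 ?\<phi> t = 1 * Q1 (theta_s g2 g3 \<psi>) t + 1 / 2 * Q1 \<psi> t"
    by (rule Q_linear[OF t continuous_inverse_fib(2)]) simp
  finally show ?thesis by (rule linear_solve(2))
qed

end

section \<open>The fourth-order equation for the integrals\<close>

definition combo3 :: "complex \<Rightarrow> rexp \<Rightarrow> complex \<Rightarrow> rexp \<Rightarrow> complex \<Rightarrow> rexp \<Rightarrow> rexp" where
  "combo3 k A l B m C = RAdd (RMul (RConst k) A) (RAdd (RMul (RConst l) B) (RMul (RConst m) C))"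

lemma reval_combo3:
  "reval (combo3 k A l B m C) s x y = k * reval A s x y + l * reval B s x y + m * reval C s x y"
  "reval (theta_s g2 g3 (combo3 k A l B m C)) s x y
    = k * reval (theta_s g2 g3 A) s x y + l * reval (theta_s g2 g3 B) s x y + m * reval (theta_s g2 g3 C) s x y"
  "reval (theta_s g2 g3 (theta_s g2 g3 (combo3 k A l B m C))) s x y
    = k * reval (theta_s g2 g3 (theta_s g2 g3 A)) s x y + l * reval (theta_s g2 g3 (theta_s g2 g3 B)) s x y
      + m * reval (theta_s g2 g3 (theta_s g2 g3 C)) s x y"
  by (simp_all add: combo3_def theta_s_def pderiv_pCons algebra_simps)

lemma reval_theta_add:
  "reval (theta_s g2 g3 (RAdd A B)) s x y = reval (theta_s g2 g3 A) s x y + reval (theta_s g2 g3 B) s x y"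
  by (simp add: theta_s_def algebra_simps)

text \<open>p_i belongs to theta^i (1/y) and f_j to theta^j (theta + 1/2)^2 (1/y). The innermost sum
  multiplied by t is (theta + 1/2)^2 acting after multiplication by t, that is t (theta + 3/2)^2,
  which explains the factors 2 theta + 1 and 2 theta + 3 of the last term.\<close>

lemma fourth_order_algebra:
  fixes a t :: complex
  assumes "p4 + (- 1 / a) * (t * (((a + 1) * p4 + (a + 1) * p3 + q * p2)
        + ((a + 1) * p3 + (a + 1) * p2 + q * p1) + 1 / 4 * ((a + 1) * p2 + (a + 1) * p1 + q * p0)))
      + 1 / a * (t * (t * (f0 + f1 + (f1 + f2)) + t * (f0 + f1) + 1 / 4 * (t * f0))) = 0"
    and "f0 = p2 + p1 + 1 / 4 * p0" "f1 = p3 + p2 + 1 / 4 * p1" "f2 = p4 + p3 + 1 / 4 * p2"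
  shows "p4 - t / (4 * a) * (q * p0 + (4 * q + a + 1) * p1 + (4 * q + 5 * (a + 1)) * p2 + 8 * (a + 1) * p3 + 4 * (a + 1) * p4)
      + t\<^sup>2 / (4 * a) * (9 / 4 * p0 + 12 * p1 + 22 * p2 + 16 * p3 + 4 * p4) = 0"
proof -
  have 1: "4 * (((a + 1) * p4 + (a + 1) * p3 + q * p2)
        + ((a + 1) * p3 + (a + 1) * p2 + q * p1) + 1 / 4 * ((a + 1) * p2 + (a + 1) * p1 + q * p0))
    = q * p0 + (4 * q + a + 1) * p1 + (4 * q + 5 * (a + 1)) * p2 + 8 * (a + 1) * p3 + 4 * (a + 1) * p4"
    by (simp add: algebra_simps)
  have 2: "4 * (t * (f0 + f1 + (f1 + f2)) + t * (f0 + f1) + 1 / 4 * (t * f0))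
    = t * (9 / 4 * p0 + 12 * p1 + 22 * p2 + 16 * p3 + 4 * p4)"
    unfolding assms(2-4) by (simp add: algebra_simps)
  have 3: "t / (4 * a) * (4 * X) = 1 / a * (t * X)" "t\<^sup>2 / (4 * a) * Y = t / (4 * a) * (t * Y)" for X Y
    by (simp_all add: power2_eq_square)
  show ?thesis
    unfolding 3(2) 1[symmetric] 2[symmetric] 3(1) using assms(1) by simp
qed

lemma theta_poly_degree_le:
  assumes "degree P \<le> n"
  shows "theta_poly P f t = (\<Sum>i\<le>n. coeff P i * (theta ^^ i) f t)"
  unfolding theta_poly_def
  by (rule sum.mono_neutral_left) (use assms in \<open>auto simp: coeff_eq_0\<close>)

lemma picard_fuchs4_expand:
  assumes "\<And>i. i \<le> 4 \<Longrightarrow> (theta ^^ i) f t = c i"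
  shows "picard_fuchs4 a q f t = c 4 - t / (4 * a) * (q * c 0 + (4 * q + a + 1) * c 1
      + (4 * q + 5 * (a + 1)) * c 2 + 8 * (a + 1) * c 3 + 4 * (a + 1) * c 4)
      + t\<^sup>2 / (4 * a) * (9 / 4 * c 0 + 12 * c 1 + 22 * c 2 + 16 * c 3 + 4 * c 4)"
proof -
  have P: "[:0, 1:] ^ 4 = [:0, 0, 0, 0, 1 :: complex:]"
    "[:1, 2:] ^ 2 * [:q, a + 1, a + 1:] = [:q, 4 * q + a + 1, 4 * q + 5 * (a + 1), 8 * (a + 1), 4 * (a + 1):]"
    "[:1, 2:] * [:3, 2:] * [:1 / 2, 1:] * [:3 / 2, 1:] = [:9 / 4, 12, 22, 16, 4 :: complex:]"
    by (simp_all add: eval_nat_numeral algebra_simps)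
  have deg: "degree [:c0, c1, c2, c3, c4:] \<le> 4" for c0 c1 c2 c3 c4 :: complex
    by (simp add: degree_pCons_eq_if)
  have "theta_poly [:c0, c1, c2, c3, c4:] f t = c0 * c 0 + c1 * c 1 + c2 * c 2 + c3 * c 3 + c4 * c 4"
    for c0 c1 c2 c3 c4
    unfolding theta_poly_degree_le[OF deg] using assms
    by (simp add: eval_nat_numeral)
  then show ?thesis unfolding picard_fuchs4_def P by simp
qed

context cycle_family
begin

context
  fixes \<epsilon> :: real
  assumes T: "\<And>t. t \<in> ball t0 \<epsilon> \<Longrightarrow> good t"
begin

abbreviation "\<Theta> \<equiv> theta_s g2 g3"

lemma Q_deriv:
  assumes "continuous_on base_region (\<lambda>z. m (fst z) (snd z))" "t \<in> ball t0 \<epsilon>"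
  obtains D where "(Q m \<psi> has_field_derivative D) (at t)" "t * D = Q m (\<Theta> \<psi>) t"
  using Q_has_field_derivative[OF T assms] Q_theta by blast

text \<open>This is theta t = t (theta + 1), transferred through \<open>Q_theta\<close>, which
  identifies t d/dt of an integral with theta applied to the integrand.\<close>

lemma Q0_theta_times_t:
  assumes "\<And>t. t \<in> ball t0 \<epsilon> \<Longrightarrow> Q0 e t = t * Q0 f t" and t: "t \<in> ball t0 \<epsilon>"
  shows "Q0 (\<Theta> e) t = t * (Q0 f t + Q0 (\<Theta> f) t)"
proof -
  obtain D where D: "(Q0 e has_field_derivative D) (at t)" "t * D = Q0 (\<Theta> e) t"
    by (rule Q_deriv[OF continuous_inverse_fib(1) t])
  obtain E where E: "(Q0 f has_field_derivative E) (at t)" "t * E = Q0 (\<Theta> f) t"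
    by (rule Q_deriv[OF continuous_inverse_fib(1) t])
  have "((\<lambda>t. t * Q0 f t) has_field_derivative (t * E + 1 * Q0 f t)) (at t)"
    by (rule DERIV_mult'[OF DERIV_ident E(1)])
  then have "(Q0 e has_field_derivative (t * E + 1 * Q0 f t)) (at t)"
    by (rule has_field_derivative_transform_within_open[OF _ open_ball t]) (simp add: assms(1))
  with D have "D = t * E + 1 * Q0 f t" using DERIV_unique by blast
  then show ?thesis unfolding D(2)[symmetric] E(2)[symmetric] by (simp add: algebra_simps)
qed

lemma Q0_theta_zero:
  assumes "\<And>t. t \<in> ball t0 \<epsilon> \<Longrightarrow> Q0 e t = 0" and t: "t \<in> ball t0 \<epsilon>"
  shows "Q0 (\<Theta> e) t = 0"
proof -
  obtain D where D: "(Q0 e has_field_derivative D) (at t)" "t * D = Q0 (\<Theta> e) t"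
    by (rule Q_deriv[OF continuous_inverse_fib(1) t])
  have "(Q0 e has_field_derivative 0) (at t)"
    by (rule has_field_derivative_transform_within_open[OF DERIV_const open_ball t]) (simp add: assms(1))
  with D have "D = 0" using DERIV_unique by blast
  then show ?thesis using D(2) by simp
qed

text \<open>Under the integral theta^2 s becomes t (theta + 1/2)^2. Applying t d/dt to
  \<open>reduce_v\<close> gives - (t/4) Q1 (theta + 1) (theta + 1/2), and \<open>reduce_u\<close>
  converts Q1 (theta + 1) into - 4 Q0 (theta + 1/2): one factor per twist.\<close>

lemma Q0_theta2_shift:
  assumes t: "t \<in> ball t0 \<epsilon>"
  shows "Q0 (\<Theta> (\<Theta> (RMul RS \<psi>))) t = t * (Q0 (\<Theta> (\<Theta> \<psi>)) t + Q0 (\<Theta> \<psi>) t + 1 / 4 * Q0 \<psi> t)"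
proof -
  obtain D where D: "(Q0 (\<Theta> (RMul RS \<psi>)) has_field_derivative D) (at t)" "t * D = Q0 (\<Theta> (\<Theta> (RMul RS \<psi>))) t"
    by (rule Q_deriv[OF continuous_inverse_fib(1) t])
  obtain E where E: "(Q1 (\<Theta> \<psi>) has_field_derivative E) (at t)" "t * E = Q1 (\<Theta> (\<Theta> \<psi>)) t"
    by (rule Q_deriv[OF continuous_inverse_fib(2) t])
  obtain F where F: "(Q1 \<psi> has_field_derivative F) (at t)" "t * F = Q1 (\<Theta> \<psi>) t"
    by (rule Q_deriv[OF continuous_inverse_fib(2) t])
  have "((\<lambda>t. - (t / 4) * (Q1 (\<Theta> \<psi>) t + 1 / 2 * Q1 \<psi> t)) has_field_derivative
      - (t / 4) * (E + 1 / 2 * F) + (- (1 / 4)) * (Q1 (\<Theta> \<psi>) t + 1 / 2 * Q1 \<psi> t)) (at t)"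
    by (intro DERIV_mult' DERIV_add DERIV_cmult E F) (auto intro!: derivative_eq_intros)
  then have "(Q0 (\<Theta> (RMul RS \<psi>)) has_field_derivative
      - (t / 4) * (E + 1 / 2 * F) + (- (1 / 4)) * (Q1 (\<Theta> \<psi>) t + 1 / 2 * Q1 \<psi> t)) (at t)"
    by (rule has_field_derivative_transform_within_open[OF _ open_ball t]) (simp add: reduce_v[OF T])
  with D have "D = - (t / 4) * (E + 1 / 2 * F) + (- (1 / 4)) * (Q1 (\<Theta> \<psi>) t + 1 / 2 * Q1 \<psi> t)"
    using DERIV_unique by blast
  moreover have "t * (- (t / 4) * (E + 1 / 2 * F) + (- (1 / 4)) * (A + 1 / 2 * B))
      = - (t / 4) * ((A + t * E) + 1 / 2 * (B + t * F))" for A B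
    by (simp add: algebra_simps)
  ultimately have "Q0 (\<Theta> (\<Theta> (RMul RS \<psi>))) t
      = - (t / 4) * ((Q1 (\<Theta> \<psi>) t + t * E) + 1 / 2 * (Q1 \<psi> t + t * F))"
    unfolding D(2)[symmetric] by (simp only:)
  also have "\<dots> = - (t / 4) * ((- 2 * Q0 (\<Theta> \<psi>) t - 4 * Q0 (\<Theta> (\<Theta> \<psi>)) t)
      + 1 / 2 * (- 2 * Q0 \<psi> t - 4 * Q0 (\<Theta> \<psi>) t))"
    unfolding E F reduce_u[OF T[OF t]] ..
  also have "\<dots> = t * (Q0 (\<Theta> (\<Theta> \<psi>)) t + Q0 (\<Theta> \<psi>) t + 1 / 4 * Q0 \<psi> t)"
    by (simp add: algebra_simps)
  finally show ?thesis .
qed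

lemma Q0_linear3:
  assumes "t \<in> ball t0 \<epsilon>" "\<And>s x y. reval e s x y = k * reval A s x y + l * reval B s x y + m * reval C s x y"
  shows "Q0 e t = k * Q0 A t + l * Q0 B t + m * Q0 C t"
proof -
  note g = T[OF assms(1)] continuous_inverse_fib(1)
  have "Q0 e t = 1 * Q0 (RAdd (RMul (RConst k) A) (RMul (RConst l) B)) t + m * Q0 C t"
    by (rule Q_linear[OF g]) (simp add: assms(2))
  also have "Q0 (RAdd (RMul (RConst k) A) (RMul (RConst l) B)) t = k * Q0 A t + l * Q0 B t"
    by (rule Q_linear[OF g]) simp
  finally show ?thesis by simp
qed

lemma Q0_fourth_order:
  assumes gm: "gauss_manin a q g2 g3 A E b" and a: "a \<noteq> 0" and t: "t \<in> ball t0 \<epsilon>"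
  defines "p \<equiv> (\<lambda>i. Q0 ((\<Theta> ^^ i) RIY) t)"
  shows "p 4 - t / (4 * a) * (q * p 0 + (4 * q + a + 1) * p 1 + (4 * q + 5 * (a + 1)) * p 2
      + 8 * (a + 1) * p 3 + 4 * (a + 1) * p 4)
      + t\<^sup>2 / (4 * a) * (9 / 4 * p 0 + 12 * p 1 + 22 * p 2 + 16 * p 3 + 4 * p 4) = 0"
proof -
  define \<pi> where "\<pi> = combo3 (a + 1) (\<Theta> (\<Theta> RIY)) (a + 1) (\<Theta> RIY) q RIY"
  \<comment> \<open>This is theta^2 (s/y) = s (theta + 1)^2 (1/y). The quadratic term of the
    second-order operator is then s \<rho>, ready for two successive shifts.\<close>
  define \<rho> where "\<rho> = \<Theta> (\<Theta> (RMul RS RIY))"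
  define e where "e = combo3 1 (\<Theta> (\<Theta> RIY)) (- 1 / a) (RMul RS \<pi>) (1 / a) (RMul RS \<rho>)"
  \<comment> \<open>The coefficients 1, 1, 1/4 are those of (theta + 1/2)^2.\<close>
  define f where "f = combo3 1 (\<Theta> (\<Theta> RIY)) 1 (\<Theta> RIY) (1 / 4) RIY"
  have e0: "Q0 e t = 0" if t: "t \<in> ball t0 \<epsilon>" for t
  proof -
    have "rv t e c p = rv t (deriv_x g2 g3 (exact_primitive a q g2 g3 A b)) c p"
      if c: "c \<in> cubes" "p \<in> unit_cube" for c p
    proof -
      define s x y where "s = pt_s t (c p)" and "x = pt_x (c p)" and "y = yc t c p"
      have rho: "reval \<rho> s x y = s * (reval (\<Theta> (\<Theta> RIY)) s x y + 2 * reval (\<Theta> RIY) s x y + reval RIY s x y)"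
        unfolding \<rho>_def theta_s_def by (simp add: pderiv_pCons algebra_simps)
      have "reval e s x y = reval (\<Theta> (\<Theta> RIY)) s x y
         - s / a * ((a + 1) * reval (\<Theta> (\<Theta> RIY)) s x y + (a + 1) * reval (\<Theta> RIY) s x y + q * reval RIY s x y)
         + s ^ 2 / a * (reval (\<Theta> (\<Theta> RIY)) s x y + 2 * reval (\<Theta> RIY) s x y + reval RIY s x y)"
        unfolding e_def \<pi>_def reval_combo3 reval.simps(5) rho
        by (simp add: power2_eq_square)
      also have "\<dots> = reval (deriv_x g2 g3 (exact_primitive a q g2 g3 A b)) s x y"
        unfolding s_def x_def y_def by (rule heun_exact[OF gm a yc_props[OF T[OF t] c]])
      finally show ?thesis unfolding s_def x_def y_def .
    qed
    then have "Q0 e t = Q0 (deriv_x g2 g3 (exact_primitive a q g2 g3 A b)) t"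
      unfolding Q_def by (intro chain_int_cong) simp
    also have "\<dots> = 0"
      unfolding Q_def by (rule exact_forms(3)[OF T[OF t] base_C1_inverse_fib])
    finally show ?thesis .
  qed
  \<comment> \<open>\<open>Q0 e\<close> vanishes on the whole ball, so it can be differentiated;
    this is the composition with theta^2 on the left.\<close>
  have "Q0 (\<Theta> (\<Theta> e)) t = 0"
    by (rule Q0_theta_zero[OF Q0_theta_zero[OF e0] t])
  moreover have "Q0 (\<Theta> (\<Theta> e)) t = 1 * Q0 (\<Theta> (\<Theta> (\<Theta> (\<Theta> RIY)))) t
      + (- 1 / a) * Q0 (\<Theta> (\<Theta> (RMul RS \<pi>))) t + (1 / a) * Q0 (\<Theta> (\<Theta> (RMul RS \<rho>))) t"
    unfolding e_def by (rule Q0_linear3[OF t reval_combo3(3)])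
  ultimately have main: "1 * Q0 (\<Theta> (\<Theta> (\<Theta> (\<Theta> RIY)))) t
      + (- 1 / a) * (t * (Q0 (\<Theta> (\<Theta> \<pi>)) t + Q0 (\<Theta> \<pi>) t + 1 / 4 * Q0 \<pi> t))
      + (1 / a) * (t * (Q0 (\<Theta> (\<Theta> \<rho>)) t + Q0 (\<Theta> \<rho>) t + 1 / 4 * Q0 \<rho> t)) = 0"
    unfolding Q0_theta2_shift[OF t] by simp
  have p: "p 0 = Q0 RIY t" "p 1 = Q0 (\<Theta> RIY) t" "p 2 = Q0 (\<Theta> (\<Theta> RIY)) t"
    "p 3 = Q0 (\<Theta> (\<Theta> (\<Theta> RIY))) t" "p 4 = Q0 (\<Theta> (\<Theta> (\<Theta> (\<Theta> RIY)))) t"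
    by (simp_all add: p_def eval_nat_numeral)
  have pi: "Q0 \<pi> t = (a + 1) * p 2 + (a + 1) * p 1 + q * p 0"
    "Q0 (\<Theta> \<pi>) t = (a + 1) * p 3 + (a + 1) * p 2 + q * p 1"
    "Q0 (\<Theta> (\<Theta> \<pi>)) t = (a + 1) * p 4 + (a + 1) * p 3 + q * p 2"
    unfolding p \<pi>_def by (rule Q0_linear3[OF t reval_combo3(1)] Q0_linear3[OF t reval_combo3(2)]
        Q0_linear3[OF t reval_combo3(3)])+
  have f: "Q0 f t = 1 * Q0 (\<Theta> (\<Theta> RIY)) t + 1 * Q0 (\<Theta> RIY) t + 1 / 4 * Q0 RIY t"
    "Q0 (\<Theta> f) t = 1 * Q0 (\<Theta> (\<Theta> (\<Theta> RIY))) t + 1 * Q0 (\<Theta> (\<Theta> RIY)) t + 1 / 4 * Q0 (\<Theta> RIY) t"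
    "Q0 (\<Theta> (\<Theta> f)) t = 1 * Q0 (\<Theta> (\<Theta> (\<Theta> (\<Theta> RIY)))) t + 1 * Q0 (\<Theta> (\<Theta> (\<Theta> RIY))) t
       + 1 / 4 * Q0 (\<Theta> (\<Theta> RIY)) t" if "t \<in> ball t0 \<epsilon>" for t
    unfolding f_def by (rule Q0_linear3[OF that reval_combo3(1)] Q0_linear3[OF that reval_combo3(2)]
        Q0_linear3[OF that reval_combo3(3)])+
  have r0: "Q0 \<rho> t = t * Q0 f t" if "t \<in> ball t0 \<epsilon>" for t
    unfolding \<rho>_def Q0_theta2_shift[OF that] f(1)[OF that] by simp
  have g: "Q0 (RAdd f (\<Theta> f)) t = 1 * Q0 f t + 1 * Q0 (\<Theta> f) t"
    "Q0 (\<Theta> (RAdd f (\<Theta> f))) t = 1 * Q0 (\<Theta> f) t + 1 * Q0 (\<Theta> (\<Theta> f)) t" if "t \<in> ball t0 \<epsilon>" for t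
    by (rule Q_linear[OF T[OF that] continuous_inverse_fib(1)], simp add: reval_theta_add)+
  have r1: "Q0 (\<Theta> \<rho>) t = t * Q0 (RAdd f (\<Theta> f)) t" if "t \<in> ball t0 \<epsilon>" for t
    using Q0_theta_times_t[OF r0 that] unfolding g(1)[OF that] by simp
  have r2: "Q0 (\<Theta> (\<Theta> \<rho>)) t = t * (Q0 (RAdd f (\<Theta> f)) t + Q0 (\<Theta> (RAdd f (\<Theta> f))) t)"
    by (rule Q0_theta_times_t[OF r1 t])
  show ?thesis
  proof (rule fourth_order_algebra)
    show "p 4 + (- 1 / a) * (t * (((a + 1) * p 4 + (a + 1) * p 3 + q * p 2)
        + ((a + 1) * p 3 + (a + 1) * p 2 + q * p 1) + 1 / 4 * ((a + 1) * p 2 + (a + 1) * p 1 + q * p 0)))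
      + 1 / a * (t * (t * (Q0 f t + Q0 (\<Theta> f) t + (Q0 (\<Theta> f) t + Q0 (\<Theta> (\<Theta> f)) t))
        + t * (Q0 f t + Q0 (\<Theta> f) t) + 1 / 4 * (t * Q0 f t))) = 0"
      using main unfolding pi r0[OF t] r1[OF t] r2 g[OF t] p(5)[symmetric] mult_1_left .
    show "Q0 f t = p 2 + p 1 + 1 / 4 * p 0" "Q0 (\<Theta> f) t = p 3 + p 2 + 1 / 4 * p 1"
      "Q0 (\<Theta> (\<Theta> f)) t = p 4 + p 3 + 1 / 4 * p 2"
      unfolding f[OF t] p mult_1_left by (rule refl)+
  qed
qed

lemma theta_power_Q0:
  assumes "\<And>t. t \<in> ball t0 \<epsilon> \<Longrightarrow> P t = \<kappa> * Q0 RIY t" "t \<in> ball t0 \<epsilon>"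
  shows "(theta ^^ i) P t = \<kappa> * Q0 ((\<Theta> ^^ i) RIY) t"
  using assms(2)
proof (induction i arbitrary: t)
  case (Suc i)
  obtain D where D: "(Q0 ((\<Theta> ^^ i) RIY) has_field_derivative D) (at t)" "t * D = Q0 (\<Theta> ((\<Theta> ^^ i) RIY)) t"
    by (rule Q_deriv[OF continuous_inverse_fib(1) Suc.prems])
  have "((\<lambda>t. \<kappa> * Q0 ((\<Theta> ^^ i) RIY) t) has_field_derivative \<kappa> * D) (at t)"
    by (rule DERIV_cmult[OF D(1)])
  then have "((theta ^^ i) P has_field_derivative \<kappa> * D) (at t)"
    by (rule has_field_derivative_transform_within_open[OF _ open_ball Suc.prems]) (simp add: Suc.IH)
  then have "deriv ((theta ^^ i) P) t = \<kappa> * D" by (rule DERIV_imp_deriv)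
  then show ?case
    unfolding funpow.simps o_apply theta_def[of "(theta ^^ i) P" t] D(2)[symmetric] by simp
qed (use assms in simp)

lemma picard_fuchs4_Q0:
  assumes gm: "gauss_manin a q g2 g3 A E b" and a: "a \<noteq> 0"
    and P: "\<And>t. t \<in> ball t0 \<epsilon> \<Longrightarrow> P t = \<kappa> * Q0 RIY t" and t: "t \<in> ball t0 \<epsilon>"
  shows "picard_fuchs4 a q P t = 0"
proof -
  define p where "p = (\<lambda>i. Q0 ((\<Theta> ^^ i) RIY) t)"
  have e: "(theta ^^ i) P t = \<kappa> * p i" for i
    unfolding p_def by (rule theta_power_Q0[OF P t])
  have "picard_fuchs4 a q P t = \<kappa> * (p 4 - t / (4 * a) * (q * p 0 + (4 * q + a + 1) * p 1 + (4 * q + 5 * (a + 1)) * p 2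
      + 8 * (a + 1) * p 3 + 4 * (a + 1) * p 4)
      + t\<^sup>2 / (4 * a) * (9 / 4 * p 0 + 12 * p 1 + 22 * p 2 + 16 * p 3 + 4 * p 4))"
    unfolding picard_fuchs4_expand[where c = "\<lambda>i. \<kappa> * p i", OF e] by (simp add: algebra_simps)
  also have "\<dots> = 0" unfolding p_def Q0_fourth_order[OF gm a t] by simp
  finally show ?thesis .
qed

lemma holomorphic_Q0: "Q0 \<psi> holomorphic_on ball t0 \<epsilon>"
  unfolding holomorphic_on_open[OF open_ball]
  by (intro ballI exI) (rule Q_has_field_derivative[OF T continuous_inverse_fib(1)])

end

end

section \<open>Identification of the period function with these integrals\<close>

lemma jacobian3_third_combination:
  "jacobian3 B C (\<lambda>p h. k p * D p h + a p * B p h + b p * C p h) p = k p * jacobian3 B C D p"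
  by (simp add: jacobian3_def minor_def algebra_simps)

lemma transport_coords:
  "coord_u (transport g2 g3 t0 t P) = coord_u P" "coord_v (transport g2 g3 t0 t P) = coord_v P"
  "coord_X (transport g2 g3 t0 t P) = coord_X P"
  by (simp_all add: transport_def split_beta Let_def)

lemma det_rows_jacobian3:
  "det (vector [vector [A p (1, 0, 0), A p (0, 1, 0), A p (0, 0, 1)],
      vector [B p (1, 0, 0), B p (0, 1, 0), B p (0, 0, 1)],
      vector [C p (1, 0, 0), C p (0, 1, 0), C p (0, 0, 1)]] :: complex ^ 3 ^ 3) = jacobian3 A B C p"
  by (simp add: det_3 jacobian3_def minor_def algebra_simps)

context cycle_family
begin

text \<open>From X = fib^2 x, the differential dX is fib^2 dx up to multiples of du and dv, which
  disappear in the wedge product with du dv.\<close>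

lemma Dx_relation:
  assumes "c \<in> cubes" "p \<in> unit_cube"
  shows "\<exists>a b. \<forall>h. Dcoord coord_X c p h = fib (coord_u (c p)) (coord_v (c p)) ^ 2 * Dx c p h + a * Du c p h + b * Dv c p h"
proof -
  define f where "f = fib (coord_u (c p)) (coord_v (c p))"
  define k where "k = coord_X (c p) * inverse (f * f) * (2 * f)"
  have f: "f * f \<noteq> 0" using coord_nz(5)[OF assms] by (simp add: f_def)
  have 1: "Dcoord coord_X c p h = f ^ 2 * Dx c p h + k * Dfib c p h" for h
  proof -
    define i where "i = inverse (f * f)"
    have i: "f * f * i = 1" unfolding i_def by (rule right_inverse[OF f])
    have "f ^ 2 * Dx c p h = (f * f * i) * (- (coord_X (c p) * i * (2 * f) * Dfib c p h)) + (f * f * i) * Dcoord coord_X c p h"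
      unfolding Dx_def Let_def f_def[symmetric] i_def[symmetric]
      by (simp add: power2_eq_square algebra_simps)
    then show ?thesis unfolding i k_def i_def[symmetric] by simp
  qed
  have 2: "Dfib c p h = (2 * coord_u (c p) + 1) * (coord_v (c p) * (coord_v (c p) + 1)) * Du c p h
      + (2 * coord_v (c p) + 1) * (coord_u (c p) * (coord_u (c p) + 1)) * Dv c p h" for h
    by (simp add: Dfib_def algebra_simps)
  define a b where "a = (2 * coord_u (c p) + 1) * (coord_v (c p) * (coord_v (c p) + 1))"
    and "b = (2 * coord_v (c p) + 1) * (coord_u (c p) * (coord_u (c p) + 1))"
  have "Dcoord coord_X c p h = f ^ 2 * Dx c p h + (k * a) * Du c p h + (k * b) * Dv c p h" for h
    unfolding 1 2 a_def[symmetric] b_def[symmetric] by (simp only: distrib_left mult.assoc add.assoc)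
  then show ?thesis
    unfolding f_def[symmetric] by blast
qed

text \<open>The powers fib^2 from dX and fib^-3 from 1/Y leave the weight 1/fib. On the open box the
  two-sided derivatives in \<open>period3\<close> coincide with the chosen derivatives within the
  cube.\<close>

lemma period3_transport:
  assumes t: "good t" and c: "c \<in> cubes"
  shows "period3 (transport g2 g3 t0 t \<circ> c)
    = integral unit_cube (\<lambda>p. jac c p * (inverse (fib (coord_u (c p)) (coord_v (c p))) * rv t RIY c p))"
proof -
  let ?c = "transport g2 g3 t0 t \<circ> c"
  have D: "frechet_derivative (\<lambda>p. f (?c p)) (at p) = Dcoord f c p"
    if f: "f \<in> {coord_u, coord_v, coord_X}" and p: "p \<in> box (0, 0, 0) (1, 1, 1)" for f p
  proof -
    have "f (transport g2 g3 t0 t P) = f P" for P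
      using f by (elim insertE emptyE; simp only: transport_coords)
    then have e: "(\<lambda>p. f (?c p)) = (\<lambda>p. f (c p))" by (simp only: o_apply)
    have pc: "p \<in> unit_cube" "p \<in> interior unit_cube" using p box_subset_cbox by (auto simp only: interior_cbox)
    have "((\<lambda>p. f (c p)) has_derivative Dcoord f c p) (at p within unit_cube)"
      using C1_onD(1)[OF C2_onD[OF C2_coord[OF c]] pc(1)] f by blast
    then have "((\<lambda>p. f (c p)) has_derivative Dcoord f c p) (at p)"
      unfolding at_within_interior[OF pc(2)] .
    then show ?thesis unfolding e by (rule frechet_derivative_at[symmetric])
  qed
  have "period3 ?c = integral (box (0, 0, 0) (1, 1, 1)) (\<lambda>p.
     (let D = (\<lambda>f e. frechet_derivative (\<lambda>p. f (?c p)) (at p) e);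
          row = (\<lambda>f. vector [D f (1, 0, 0), D f (0, 1, 0), D f (0, 0, 1)] :: complex ^ 3)
      in det (vector [row coord_u, row coord_v, row coord_X] :: complex ^ 3 ^ 3)) / coord_Y (?c p))"
    unfolding period3_def by (rule integral_open_interval[symmetric])
  also have "\<dots> = integral (box (0, 0, 0) (1, 1, 1))
      (\<lambda>p. jac c p * (inverse (fib (coord_u (c p)) (coord_v (c p))) * rv t RIY c p))"
  proof (rule integral_cong)
    fix p :: "real \<times> real \<times> real" assume p: "p \<in> box (0, 0, 0) (1, 1, 1)"
    then have pc: "p \<in> unit_cube" using box_subset_cbox by blast
    define f where "f = fib (coord_u (c p)) (coord_v (c p))"
    have f: "f \<noteq> 0" using coord_nz(5)[OF c pc] by (simp add: f_def)
    obtain a b where ab: "\<And>h. Dcoord coord_X c p h = f ^ 2 * Dx c p h + a * Du c p h + b * Dv c p h"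
      using Dx_relation[OF c pc] unfolding f_def by blast
    have J: "jacobian3 (Du c) (Dv c) (Dcoord coord_X c) p = f ^ 2 * jac c p"
      unfolding jac_def jacobian3_third_combination[of "Du c" "Dv c" "\<lambda>_. f ^ 2" "Dx c" "\<lambda>_. a" "\<lambda>_. b" p, symmetric]
      by (simp add: jacobian3_def minor_def ab)
    have y: "inverse f * rv t RIY c p = f ^ 2 / coord_Y (?c p)"
      unfolding reval.simps pt_y_def f_def[symmetric] o_apply
      using f by (simp add: power3_eq_cube power2_eq_square inverse_eq_divide)
    have Ds: "frechet_derivative (\<lambda>p. coord_u (?c p)) (at p) = Du c p"
      "frechet_derivative (\<lambda>p. coord_v (?c p)) (at p) = Dv c p"
      "frechet_derivative (\<lambda>p. coord_X (?c p)) (at p) = Dcoord coord_X c p"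
      by (rule D[OF _ p], blast)+
    have "(let D = (\<lambda>f e. frechet_derivative (\<lambda>p. f (?c p)) (at p) e);
          row = (\<lambda>f. vector [D f (1, 0, 0), D f (0, 1, 0), D f (0, 0, 1)] :: complex ^ 3)
      in det (vector [row coord_u, row coord_v, row coord_X] :: complex ^ 3 ^ 3)) / coord_Y (?c p)
      = jacobian3 (Du c) (Dv c) (Dcoord coord_X c) p / coord_Y (?c p)"
      unfolding Let_def Ds unfolding det_rows_jacobian3 ..
    also have "\<dots> = jac c p * (f ^ 2 / coord_Y (?c p))"
      unfolding J by simp
    finally show "(let D = (\<lambda>f e. frechet_derivative (\<lambda>p. f (?c p)) (at p) e);
          row = (\<lambda>f. vector [D f (1, 0, 0), D f (0, 1, 0), D f (0, 0, 1)] :: complex ^ 3)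
      in det (vector [row coord_u, row coord_v, row coord_X] :: complex ^ 3 ^ 3)) / coord_Y (?c p)
      = jac c p * (inverse (fib (coord_u (c p)) (coord_v (c p))) * rv t RIY c p)"
      unfolding f_def[symmetric] y .
  qed
  also have "\<dots> = integral unit_cube (\<lambda>p. jac c p * (inverse (fib (coord_u (c p)) (coord_v (c p))) * rv t RIY c p))"
    by (rule integral_open_interval)
  finally show ?thesis .
qed

lemma period_function_Q0:
  assumes "good t"
  shows "period_function g2 g3 t0 \<Gamma> t = Q0 RIY t"
  unfolding period_function_def Q_def chain_int_def
  by (rule sum.cong[OF refl]) (simp only: period3_transport[OF assms])

lemma period_function_picard_fuchs:
  assumes gm: "gauss_manin a q g2 g3 A E b" and a: "a \<noteq> 0"
  shows "(\<lambda>t. \<kappa> * period_function g2 g3 t0 \<Gamma> t) analytic_on {t0}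
    \<and> (\<forall>\<^sub>F t in nhds t0. picard_fuchs4 a q (\<lambda>t. \<kappa> * period_function g2 g3 t0 \<Gamma> t) t = 0)"
proof -
  obtain \<epsilon> where \<epsilon>: "\<epsilon> > 0" and good: "\<And>t. t \<in> ball t0 \<epsilon> \<Longrightarrow> good t"
    using good_ball by blast
  have P: "\<kappa> * period_function g2 g3 t0 \<Gamma> t = \<kappa> * Q0 RIY t" if "t \<in> ball t0 \<epsilon>" for t
    using period_function_Q0[OF good[OF that]] by simp
  have "(\<lambda>t. \<kappa> * Q0 RIY t) holomorphic_on ball t0 \<epsilon>"
    by (intro holomorphic_intros holomorphic_Q0 good)
  then have h: "(\<lambda>t. \<kappa> * period_function g2 g3 t0 \<Gamma> t) holomorphic_on ball t0 \<epsilon>"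
    by (rule holomorphic_transform) (simp add: P)
  have "(\<lambda>t. \<kappa> * period_function g2 g3 t0 \<Gamma> t) analytic_on {t0}"
    unfolding analytic_at using h \<epsilon> by (intro exI[of _ "ball t0 \<epsilon>"]) auto
  moreover have "\<forall>\<^sub>F t in nhds t0. t \<in> ball t0 \<epsilon>"
    using \<epsilon> by (intro eventually_nhds_in_open) auto
  then have "\<forall>\<^sub>F t in nhds t0. picard_fuchs4 a q (\<lambda>t. \<kappa> * period_function g2 g3 t0 \<Gamma> t) t = 0"
    by eventually_elim (rule picard_fuchs4_Q0[OF good gm a P])
  ultimately show ?thesis by blast
qed

end

section \<open>Heun series and the symmetric square\<close>

lemma fps_nth_X_mult: "fps_nth (fps_X * F) n = (case n of 0 \<Rightarrow> 0 | Suc k \<Rightarrow> fps_nth F k)" for F :: "complex fps"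
  by (cases n) auto

text \<open>
  The polynomial form of Heun's equation with \<open>\<gamma> = 1\<close>, multiplied by \<open>t (t - 1) (t - a)\<close>;
  \<open>k\<close> and \<open>l\<close> are the elementary symmetric functions of the exponents at infinity.
\<close>

definition heun_op :: "complex \<Rightarrow> complex \<Rightarrow> complex \<Rightarrow> complex \<Rightarrow> complex \<Rightarrow> complex fps \<Rightarrow> complex fps" where
  "heun_op a q k l \<delta> F =
     fps_X * (fps_X - 1) * (fps_X - fps_const a) * fps_deriv (fps_deriv F)
     + ((fps_X - 1) * (fps_X - fps_const a) + fps_const \<delta> * (fps_X * (fps_X - fps_const a))
        + fps_const (k - \<delta>) * (fps_X * (fps_X - 1))) * fps_deriv F
     + (fps_const l * fps_X - fps_const q) * F"

abbreviation heun_fps :: "complex \<Rightarrow> complex \<Rightarrow> complex \<Rightarrow> complex \<Rightarrow> complex \<Rightarrow> complex fps \<Rightarrow> complex fps" where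
  "heun_fps a q \<alpha> \<beta> \<delta> F \<equiv> heun_op a q (\<alpha> + \<beta>) (\<alpha> * \<beta>) \<delta> F"

lemma heun_equation_iff:
  assumes t: "t \<noteq> 0" "t \<noteq> 1" "t \<noteq> a"
  shows "heun_equation a q \<alpha> \<beta> 1 \<delta> f t \<longleftrightarrow>
     t * (t - 1) * (t - a) * deriv (deriv f) t
     + ((t - 1) * (t - a) + \<delta> * (t * (t - a)) + (\<alpha> + \<beta> - \<delta>) * (t * (t - 1))) * deriv f t
     + (\<alpha> * \<beta> * t - q) * f t = 0"
proof -
  have nz: "t * (t - 1) * (t - a) \<noteq> 0" using t by simp
  have e: "\<alpha> + \<beta> - 1 - \<delta> + 1 = \<alpha> + \<beta> - \<delta>" by simp
  have 1: "(t * (t - 1) * (t - a)) * (1 / t) = (t - 1) * (t - a)"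
    "(t * (t - 1) * (t - a)) * (\<delta> / (t - 1)) = \<delta> * (t * (t - a))"
    "(t * (t - 1) * (t - a)) * ((\<alpha> + \<beta> - \<delta>) / (t - a)) = (\<alpha> + \<beta> - \<delta>) * (t * (t - 1))"
    using t by (simp_all add: field_simps)
  have 2: "(t * (t - 1) * (t - a)) * ((\<alpha> * \<beta> * t - q) / (t * (t - 1) * (t - a))) = \<alpha> * \<beta> * t - q"
    by (simp only: times_divide_eq_right nonzero_mult_div_cancel_left[OF nz])
  have "t * (t - 1) * (t - a) * deriv (deriv f) t
     + ((t - 1) * (t - a) + \<delta> * (t * (t - a)) + (\<alpha> + \<beta> - \<delta>) * (t * (t - 1))) * deriv f t
     + (\<alpha> * \<beta> * t - q) * f t
    = t * (t - 1) * (t - a) * (deriv (deriv f) t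
      + (1 / t + \<delta> / (t - 1) + (\<alpha> + \<beta> - \<delta>) / (t - a)) * deriv f t
      + (\<alpha> * \<beta> * t - q) / (t * (t - 1) * (t - a)) * f t)"
    unfolding 1[symmetric] by (subst 2[symmetric]) (simp only: distrib_left distrib_right mult.assoc)
  then show ?thesis
    unfolding heun_equation_def Let_def e using nz by (metis mult_eq_0_iff)
qed

lemma heun_op_nth:
  "fps_nth (heun_op a q k l \<delta> F) (Suc n) =
     a * of_nat (n + 2) ^ 2 * fps_nth F (n + 2)
     - ((of_nat (n + 1) * (of_nat n * (a + 1) + (a + 1) + \<delta> * a + (k - \<delta>))) + q) * fps_nth F (n + 1)
     + (of_nat n ^ 2 + k * of_nat n + l) * fps_nth F n"
  "fps_nth (heun_op a q k l \<delta> F) 0 = a * fps_nth F 1 - q * fps_nth F 0"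
proof -
  have e: "heun_op a q k l \<delta> F =
     fps_X * (fps_X * (fps_X * fps_deriv (fps_deriv F))) - fps_const (a + 1) * (fps_X * (fps_X * fps_deriv (fps_deriv F)))
     + fps_const a * (fps_X * fps_deriv (fps_deriv F))
     + fps_const (1 + k) * (fps_X * (fps_X * fps_deriv F))
     - fps_const ((a + 1) + \<delta> * a + (k - \<delta>)) * (fps_X * fps_deriv F)
     + fps_const a * fps_deriv F + fps_const l * (fps_X * F) - fps_const q * F"
    unfolding heun_op_def
    by (simp add: algebra_simps flip: fps_const_add fps_const_sub fps_const_mult)
  show "fps_nth (heun_op a q k l \<delta> F) (Suc n) =
     a * of_nat (n + 2) ^ 2 * fps_nth F (n + 2)
     - ((of_nat (n + 1) * (of_nat n * (a + 1) + (a + 1) + \<delta> * a + (k - \<delta>))) + q) * fps_nth F (n + 1)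
     + (of_nat n ^ 2 + k * of_nat n + l) * fps_nth F n"
    unfolding e fps_add_nth fps_sub_nth fps_mult_left_const_nth fps_nth_X_mult fps_deriv_nth
    by (cases n; cases "n - 1"; simp add: fps_nth_X_mult power2_eq_square algebra_simps)
  show "fps_nth (heun_op a q k l \<delta> F) 0 = a * fps_nth F 1 - q * fps_nth F 0"
    unfolding e by simp
qed

lemma heun_fps_nth:
  "fps_nth (heun_fps a q \<alpha> \<beta> \<delta> F) (Suc n) =
     a * of_nat (n + 2) ^ 2 * fps_nth F (n + 2)
     - ((of_nat (n + 1) * (of_nat n * (a + 1) + (a + 1) + \<delta> * a + (\<alpha> + \<beta> - \<delta>))) + q) * fps_nth F (n + 1)
     + (of_nat n + \<alpha>) * (of_nat n + \<beta>) * fps_nth F n"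
  "fps_nth (heun_fps a q \<alpha> \<beta> \<delta> F) 0 = a * fps_nth F 1 - q * fps_nth F 0"
proof -
  have "(of_nat n + \<alpha>) * (of_nat n + \<beta>) = of_nat n ^ 2 + (\<alpha> + \<beta>) * of_nat n + \<alpha> * \<beta>"
    by (simp add: power2_eq_square algebra_simps)
  then show "fps_nth (heun_fps a q \<alpha> \<beta> \<delta> F) (Suc n) =
     a * of_nat (n + 2) ^ 2 * fps_nth F (n + 2)
     - ((of_nat (n + 1) * (of_nat n * (a + 1) + (a + 1) + \<delta> * a + (\<alpha> + \<beta> - \<delta>))) + q) * fps_nth F (n + 1)
     + (of_nat n + \<alpha>) * (of_nat n + \<beta>) * fps_nth F n"
    by (simp only: heun_op_nth)
qed (rule heun_op_nth(2))

text \<open>Because \<gamma> = 1, both exponents at 0 are 0 and the newest coefficient is multiplied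
  by a n^2, which is nonzero for n > 0.\<close>

lemma heun_fps_unique:
  assumes "heun_fps a q \<alpha> \<beta> \<delta> F = 0" "heun_fps a q \<alpha> \<beta> \<delta> G = 0" "a \<noteq> 0" "fps_nth F 0 = fps_nth G 0"
  shows "F = G"
proof (rule fps_ext)
  fix n
  show "fps_nth F n = fps_nth G n"
  proof (induction n rule: less_induct)
    case (less n)
    consider "n = 0" | "n = 1" | m where "n = m + 2" by (metis add_2_eq_Suc' not0_implies_Suc One_nat_def)
    then show ?case
    proof cases
      case 1 then show ?thesis using assms(4) by simp
    next
      case 2
      have "a * fps_nth F 1 = a * fps_nth G 1"
        using heun_fps_nth(2)[of a q \<alpha> \<beta> \<delta> F] heun_fps_nth(2)[of a q \<alpha> \<beta> \<delta> G] assms by simp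
      then show ?thesis using 2 assms(3) by simp
    next
      case 3
      have "a * of_nat (m + 2) ^ 2 * fps_nth F (m + 2) = a * of_nat (m + 2) ^ 2 * fps_nth G (m + 2)"
        using heun_fps_nth(1)[of a q \<alpha> \<beta> \<delta> F m] heun_fps_nth(1)[of a q \<alpha> \<beta> \<delta> G m]
          less.IH[of m] less.IH[of "m + 1"] 3 unfolding assms(1,2) by (simp only: fps_zero_nth) (simp add: algebra_simps)
      moreover have "a * (of_nat (m + 2)) ^ 2 \<noteq> (0 :: complex)"
        using assms(3) of_nat_neq_0[of "m + 1", where ?'a = complex] by simp
      ultimately show ?thesis using 3 mult_left_cancel by blast
    qed
  qed
qed

section \<open>Existence and convergence of the local Heun function\<close>

fun heun_coeff :: "complex \<Rightarrow> complex \<Rightarrow> complex \<Rightarrow> complex \<Rightarrow> complex \<Rightarrow> nat \<Rightarrow> complex" where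
  "heun_coeff a q \<alpha> \<beta> \<delta> 0 = 1"
| "heun_coeff a q \<alpha> \<beta> \<delta> (Suc 0) = q / a"
| "heun_coeff a q \<alpha> \<beta> \<delta> (Suc (Suc n)) =
     (((of_nat (n + 1) * (of_nat n * (a + 1) + (a + 1) + \<delta> * a + (\<alpha> + \<beta> - \<delta>))) + q) * heun_coeff a q \<alpha> \<beta> \<delta> (Suc n)
      - (of_nat n + \<alpha>) * (of_nat n + \<beta>) * heun_coeff a q \<alpha> \<beta> \<delta> n) / (a * of_nat (n + 2) ^ 2)"

lemma heun_coeff_solution:
  assumes "a \<noteq> 0"
  shows "heun_fps a q \<alpha> \<beta> \<delta> (Abs_fps (heun_coeff a q \<alpha> \<beta> \<delta>)) = 0"
proof (rule fps_ext)
  fix n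
  show "fps_nth (heun_fps a q \<alpha> \<beta> \<delta> (Abs_fps (heun_coeff a q \<alpha> \<beta> \<delta>))) n = fps_nth 0 n"
  proof (cases n)
    case 0
    then show ?thesis using assms by (simp add: heun_fps_nth)
  next
    case (Suc m)
    have nz: "a * of_nat (m + 2) ^ 2 \<noteq> (0 :: complex)"
      using assms of_nat_neq_0[of "m + 1", where ?'a = complex] by simp
    have "a * of_nat (m + 2) ^ 2 * heun_coeff a q \<alpha> \<beta> \<delta> (Suc (Suc m)) =
     ((of_nat (m + 1) * (of_nat m * (a + 1) + (a + 1) + \<delta> * a + (\<alpha> + \<beta> - \<delta>))) + q) * heun_coeff a q \<alpha> \<beta> \<delta> (Suc m)
      - (of_nat m + \<alpha>) * (of_nat m + \<beta>) * heun_coeff a q \<alpha> \<beta> \<delta> m"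
      unfolding heun_coeff.simps by (rule nonzero_mult_div_cancel_left[OF nz, folded times_divide_eq_right])
    then show ?thesis
      unfolding Suc heun_fps_nth fps_nth_Abs_fps by (simp del: heun_coeff.simps)
  qed
qed

text \<open>The polynomials in n in the recurrence have degree 2, as does the divisor a (n + 2)^2,
  so each step multiplies the bound by at most a constant.\<close>

lemma heun_coeff_bound:
  assumes a: "a \<noteq> 0"
  obtains K where "K \<ge> 1" "\<And>n. norm (heun_coeff a q \<alpha> \<beta> \<delta> n) \<le> K ^ n"
proof -
  define M1 where "M1 = norm (a + 1) + norm ((a + 1) + \<delta> * a + (\<alpha> + \<beta> - \<delta>)) + norm q"
  define M2 where "M2 = (1 + norm \<alpha>) * (1 + norm \<beta>)"
  \<comment> \<open>The summand 1 gives K \<ge> 1, so the older of the two coefficients obeys the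
    bound of the newer; the last summand covers n = 1.\<close>
  define K where "K = 1 + (M1 + M2) / norm a + norm (q / a)"
  have pos: "M1 \<ge> 0" "M2 \<ge> 0" "norm a > 0" using a by (auto simp: M1_def M2_def)
  have K: "K \<ge> 1" "M1 + M2 \<le> K * norm a" "norm (q / a) \<le> K"
    using pos by (auto simp: K_def field_simps norm_divide)
  have "norm (heun_coeff a q \<alpha> \<beta> \<delta> n) \<le> K ^ n" for n
  proof (induction n rule: less_induct)
    case (less n)
    consider "n = 0" | "n = 1" | m where "n = m + 2" by (metis add_2_eq_Suc' not0_implies_Suc One_nat_def)
    then show ?case
    proof cases
      case 3
      define N where "N = real (m + 2)"
      have N: "N \<ge> 1" "real m + 1 \<le> N" "real (m + 1) \<le> N" "real m \<le> N" by (auto simp: N_def)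
      let ?A = "(of_nat (m + 1) * (of_nat m * (a + 1) + (a + 1) + \<delta> * a + (\<alpha> + \<beta> - \<delta>))) + q"
      let ?B = "(of_nat m + \<alpha>) * (of_nat m + \<beta>)"
      have NN: "1 \<le> N ^ 2" using N(1) by (rule one_le_power)
      have A: "norm ?A \<le> M1 * N ^ 2"
      proof -
        have "norm ?A \<le> real (m + 1) * norm (of_nat m * (a + 1) + ((a + 1) + \<delta> * a + (\<alpha> + \<beta> - \<delta>))) + norm q"
          using norm_triangle_ineq[of "of_nat (m + 1) * (of_nat m * (a + 1) + (a + 1) + \<delta> * a + (\<alpha> + \<beta> - \<delta>))" q]
          by (simp only: norm_mult norm_of_nat add.assoc)
        also have "\<dots> \<le> N * (N * norm (a + 1) + norm ((a + 1) + \<delta> * a + (\<alpha> + \<beta> - \<delta>)) * N) + norm q * N ^ 2"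
        proof (intro add_mono mult_mono)
          have "norm (of_nat m * (a + 1) + ((a + 1) + \<delta> * a + (\<alpha> + \<beta> - \<delta>)))
              \<le> norm (of_nat m * (a + 1)) + norm ((a + 1) + \<delta> * a + (\<alpha> + \<beta> - \<delta>))"
            by (rule norm_triangle_ineq)
          also have "\<dots> \<le> N * norm (a + 1) + norm ((a + 1) + \<delta> * a + (\<alpha> + \<beta> - \<delta>)) * N"
            using N mult_left_mono[OF N(1), of "norm ((a + 1) + \<delta> * a + (\<alpha> + \<beta> - \<delta>))"]
            by (intro add_mono) (auto simp: norm_mult intro!: mult_right_mono)
          finally show "norm (of_nat m * (a + 1) + ((a + 1) + \<delta> * a + (\<alpha> + \<beta> - \<delta>)))
              \<le> N * norm (a + 1) + norm ((a + 1) + \<delta> * a + (\<alpha> + \<beta> - \<delta>)) * N" .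
          show "norm q \<le> norm q * N ^ 2" using NN mult_left_mono[of 1 "N ^ 2" "norm q"] by simp
        qed (use N in auto)
        also have "\<dots> = M1 * N ^ 2" by (simp add: M1_def power2_eq_square algebra_simps)
        finally show ?thesis .
      qed
      have B: "norm ?B \<le> M2 * N ^ 2"
      proof -
        have "norm (of_nat m + c) \<le> (1 + norm c) * N" for c :: complex
        proof -
          have "norm (of_nat m + c) \<le> real m + norm c"
            using norm_triangle_ineq[of "of_nat m" c] by simp
          also have "\<dots> \<le> N + norm c * N"
            using N mult_left_mono[of 1 N "norm c"] by (intro add_mono) auto
          finally show ?thesis by (simp add: algebra_simps)
        qed
        then have "norm (of_nat m + \<alpha>) * norm (of_nat m + \<beta>) \<le> ((1 + norm \<alpha>) * N) * ((1 + norm \<beta>) * N)"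
          using N by (intro mult_mono) auto
        then show ?thesis unfolding norm_mult by (simp add: M2_def power2_eq_square mult_ac)
      qed
      have IH: "norm (heun_coeff a q \<alpha> \<beta> \<delta> (Suc m)) \<le> K ^ Suc m" "norm (heun_coeff a q \<alpha> \<beta> \<delta> m) \<le> K ^ Suc m"
      proof -
        show "norm (heun_coeff a q \<alpha> \<beta> \<delta> (Suc m)) \<le> K ^ Suc m" by (rule less.IH) (simp add: 3)
        have "norm (heun_coeff a q \<alpha> \<beta> \<delta> m) \<le> K ^ m" by (rule less.IH) (simp add: 3)
        also have "\<dots> \<le> K ^ Suc m" using K by (intro power_increasing) auto
        finally show "norm (heun_coeff a q \<alpha> \<beta> \<delta> m) \<le> K ^ Suc m" .
      qed
      have "norm (?A * heun_coeff a q \<alpha> \<beta> \<delta> (Suc m) - ?B * heun_coeff a q \<alpha> \<beta> \<delta> m)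
          \<le> norm ?A * norm (heun_coeff a q \<alpha> \<beta> \<delta> (Suc m)) + norm ?B * norm (heun_coeff a q \<alpha> \<beta> \<delta> m)"
        by (rule order_trans[OF norm_triangle_ineq4]) (simp only: norm_mult order_refl)
      also have "\<dots> \<le> (M1 * N ^ 2) * K ^ Suc m + (M2 * N ^ 2) * K ^ Suc m"
        using pos by (intro add_mono mult_mono A B IH) auto
      also have "\<dots> = (M1 + M2) * (N ^ 2 * K ^ Suc m)" by (simp add: algebra_simps)
      also have "\<dots> \<le> (K * norm a) * (N ^ 2 * K ^ Suc m)"
        using K by (intro mult_right_mono) auto
      finally have main: "norm (?A * heun_coeff a q \<alpha> \<beta> \<delta> (Suc m) - ?B * heun_coeff a q \<alpha> \<beta> \<delta> m)
          \<le> K ^ n * (norm a * N ^ 2)" by (simp add: 3 mult_ac)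
      have nn: "norm (a * of_nat (m + 2) ^ 2) = norm a * N ^ 2"
        unfolding N_def norm_mult norm_power norm_of_nat ..
      have "norm a * N ^ 2 > 0" using pos NN by (intro mult_pos_pos) auto
      with main have "norm (?A * heun_coeff a q \<alpha> \<beta> \<delta> (Suc m) - ?B * heun_coeff a q \<alpha> \<beta> \<delta> m) / (norm a * N ^ 2) \<le> K ^ n"
        by (simp add: pos_divide_le_eq)
      moreover have "heun_coeff a q \<alpha> \<beta> \<delta> n
          = (?A * heun_coeff a q \<alpha> \<beta> \<delta> (Suc m) - ?B * heun_coeff a q \<alpha> \<beta> \<delta> m) / (a * of_nat (m + 2) ^ 2)"
        unfolding 3 add_2_eq_Suc' heun_coeff.simps ..
      ultimately show ?thesis by (simp only: norm_divide nn)
    qed (use K in auto)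
  qed
  with K(1) show ?thesis by (rule that)
qed

lemma fps_conv_radius_geometric_bound:
  fixes F :: "complex fps"
  assumes "K > 0" "\<And>n. norm (fps_nth F n) \<le> K ^ n"
  shows "fps_conv_radius F > 0"
proof -
  have "summable (\<lambda>n. fps_nth F n * (of_real (1 / (2 * K)) :: complex) ^ n)"
  proof (rule summable_comparison_test'[where N = 0 and g = "\<lambda>n. (1 / 2) ^ n"])
    show "summable (\<lambda>n. (1 / 2 :: real) ^ n)" by (intro summable_geometric) simp
    fix n
    have "norm (fps_nth F n * of_real (1 / (2 * K)) ^ n) = norm (fps_nth F n) * (1 / (2 * K)) ^ n"
      unfolding norm_mult norm_power norm_of_real using assms(1) by simp
    also have "\<dots> \<le> K ^ n * (1 / (2 * K)) ^ n"
      using assms by (intro mult_right_mono) auto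
    also have "\<dots> = (1 / 2) ^ n" using assms(1) by (simp flip: power_mult_distrib)
    finally show "norm (fps_nth F n * of_real (1 / (2 * K)) ^ n) \<le> (1 / 2) ^ n" .
  qed
  then have "conv_radius (fps_nth F) \<ge> norm (of_real (1 / (2 * K)) :: complex)"
    by (rule conv_radius_geI)
  moreover have "ereal (norm (of_real (1 / (2 * K)) :: complex)) > 0" using assms(1) by simp
  ultimately show ?thesis unfolding fps_conv_radius_def by order
qed

text \<open>Heun's equation has a pole at 0 and is imposed on a punctured neighbourhood; continuity
  supplies the missing value, and a power series vanishing near 0 is zero.\<close>

lemma fps_expansion_zero_iff:
  fixes g :: "complex \<Rightarrow> complex"
  assumes "g has_fps_expansion G"
  shows "G = 0 \<longleftrightarrow> (\<forall>\<^sub>F t in at 0. g t = 0)"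
proof
  assume "G = 0"
  then have "\<forall>\<^sub>F t in nhds 0. g t = 0" using assms has_fps_expansion_0_iff by blast
  then show "\<forall>\<^sub>F t in at 0. g t = 0" unfolding eventually_at_filter by (rule eventually_mono) simp
next
  assume ev: "\<forall>\<^sub>F t in at 0. g t = 0"
  have "continuous (at 0) g" using assms by (rule has_fps_expansion_imp_continuous)
  then have "(g \<longlongrightarrow> g 0) (at 0)" by (simp add: continuous_within)
  moreover have "(g \<longlongrightarrow> 0) (at 0)" by (rule tendsto_eventually[OF ev])
  ultimately have "g 0 = 0" by (rule tendsto_unique[OF at_neq_bot])
  then have "\<forall>\<^sub>F t in nhds 0. g t = 0" using ev by (simp add: eventually_nhds_conv_at)
  then have "g has_fps_expansion 0" unfolding has_fps_expansion_0_iff .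
  with assms show "G = 0" by (rule fps_expansion_unique_complex)
qed

lemma eventually_heun_iff:
  assumes a: "a \<noteq> 0" and r: "fps_conv_radius F > 0"
  shows "(\<forall>\<^sub>F t in at 0. heun_equation a q \<alpha> \<beta> 1 \<delta> (eval_fps F) t) \<longleftrightarrow> heun_fps a q \<alpha> \<beta> \<delta> F = 0"
proof -
  have ev: "\<forall>\<^sub>F t in at 0. t \<noteq> 0 \<and> t \<noteq> 1 \<and> t \<noteq> a"
    using a by (intro eventually_conj eventually_neq_at_within)
  define g where "g = (\<lambda>t. t * (t - 1) * (t - a) * deriv (deriv (eval_fps F)) t
     + ((t - 1) * (t - a) + \<delta> * (t * (t - a)) + (\<alpha> + \<beta> - \<delta>) * (t * (t - 1))) * deriv (eval_fps F) t
     + (\<alpha> * \<beta> * t - q) * eval_fps F t)"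
  have F: "eval_fps F has_fps_expansion F" using r by (simp add: has_fps_expansion_def)
  have "g has_fps_expansion heun_fps a q \<alpha> \<beta> \<delta> F"
    unfolding g_def heun_op_def by (intro fps_expansion_intros F)
  then have "heun_fps a q \<alpha> \<beta> \<delta> F = 0 \<longleftrightarrow> (\<forall>\<^sub>F t in at 0. g t = 0)" (is "?L = ?R")
    by (rule fps_expansion_zero_iff)
  also have "?R \<longleftrightarrow> (\<forall>\<^sub>F t in at 0. heun_equation a q \<alpha> \<beta> 1 \<delta> (eval_fps F) t)"
    unfolding g_def by (rule eventually_subst, rule eventually_mono[OF ev]) (simp add: heun_equation_iff)
  finally show ?thesis by simp
qed

lemma heun_local_eq:
  assumes a: "a \<noteq> 0"
  shows "heun_local a q \<alpha> \<beta> 1 \<delta> = Abs_fps (heun_coeff a q \<alpha> \<beta> \<delta>)" (is "_ = ?H")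
    and "fps_conv_radius (Abs_fps (heun_coeff a q \<alpha> \<beta> \<delta>)) > 0"
proof -
  let ?P = "\<lambda>F. fps_conv_radius F > 0 \<and> fps_nth F 0 = 1 \<and>
        (\<forall>\<^sub>F t in at 0. heun_equation a q \<alpha> \<beta> 1 \<delta> (eval_fps F) t)"
  obtain K where "K \<ge> 1" "\<And>n. norm (heun_coeff a q \<alpha> \<beta> \<delta> n) \<le> K ^ n"
    using heun_coeff_bound[OF a] by blast
  then show r: "fps_conv_radius ?H > 0" by (intro fps_conv_radius_geometric_bound[of K]) auto
  have H: "?P ?H" using r eventually_heun_iff[OF a r] heun_coeff_solution[OF a] by simp
  moreover have "F = ?H" if "?P F" for F
    using that H eventually_heun_iff[OF a] heun_fps_unique[OF _ _ a] by metis
  ultimately show "heun_local a q \<alpha> \<beta> 1 \<delta> = ?H"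
    unfolding heun_local_def by (rule the_equality)
qed

lemma heun_local_props:
  assumes a: "a \<noteq> 0"
  shows "fps_conv_radius (heun_local a q \<alpha> \<beta> 1 \<delta>) > 0" "fps_nth (heun_local a q \<alpha> \<beta> 1 \<delta>) 0 = 1"
    "heun_fps a q \<alpha> \<beta> \<delta> (heun_local a q \<alpha> \<beta> 1 \<delta>) = 0"
  unfolding heun_local_eq(1)[OF a] using heun_local_eq(2)[OF a] heun_coeff_solution[OF a] by auto

text \<open>The left side is 4 X F1 times the differential equation plus 2 X F1^2 (2 b + X b' - 2
  a1). The first hypothesis, which reflects \<delta> = \<epsilon> = 1/2, removes the second
  term.\<close>

lemma symmetric_square_algebra:
  fixes F :: "'a::comm_ring_1"
  assumes "2 * a1 = 2 * b + X * b'" "X * b * F2 + a1 * F1 + a0 * F = 0"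
  shows "X * (2 * ((b + X * b') * (F1 * F1) + X * b * (2 * (F1 * F2)))) + 2 * (X * b * (F1 * F1)) + 2 * a0 * X * (2 * (F * F1)) = 0"
proof -
  have "X * (2 * ((b + X * b') * (F1 * F1) + X * b * (2 * (F1 * F2)))) + 2 * (X * b * (F1 * F1)) + 2 * a0 * X * (2 * (F * F1))
    = 4 * X * F1 * (X * b * F2 + a1 * F1 + a0 * F) + 2 * X * F1 * F1 * (2 * b + X * b' - 2 * a1)"
    by (simp add: algebra_simps)
  then show ?thesis unfolding assms by simp
qed

text \<open>
  Writing the Heun equation with \<open>\<delta> = \<epsilon> = 1 / 2\<close> as \<open>X b F'' + (b + X b' / 2) F' + a0 F = 0\<close>,
  the square \<open>y = F\<^sup>2\<close> satisfies \<open>Z = 2 X b F'\<^sup>2\<close> and \<open>(X Z)' + 2 a0 X y' = 0\<close>,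
  where \<open>Z\<close> is the Heun operator with \<open>a0\<close> doubled.
\<close>

lemma heun_square:
  fixes a q :: complex
  assumes "heun_fps a (q / 4) (1 / 4) (3 / 4) (1 / 2) F = 0"
  defines "Z \<equiv> heun_op a (q / 2) 1 (3 / 8) (1 / 2) (F ^ 2)"
  shows "fps_X * fps_deriv Z + Z + (fps_const (3 / 8) * fps_X - fps_const (q / 2)) * fps_X * fps_deriv (F ^ 2) = 0"
proof -
  define b where "b = (fps_X - 1) * (fps_X - fps_const a)"
  define b' where "b' = fps_deriv b"
  define h where "h = fps_const (1 / 2 :: complex)"
  define a1 where "a1 = b + h * (fps_X * (fps_X - fps_const a)) + h * (fps_X * (fps_X - 1))"
  define a0 where "a0 = fps_const (3 / 16) * fps_X - fps_const (q / 4)"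
  have two: "2 = fps_const (2 :: complex)" by (simp add: numeral_fps_const)
  have h: "2 * h = 1" unfolding two h_def by simp
  have b': "b' = (fps_X - fps_const a) + (fps_X - 1)" by (simp add: b'_def b_def)
  have a1: "2 * a1 = 2 * b + fps_X * b'"
  proof -
    have "2 * a1 = 2 * b + (2 * h) * (fps_X * (fps_X - fps_const a) + fps_X * (fps_X - 1))"
      unfolding a1_def by (simp add: algebra_simps)
    then show ?thesis unfolding h b' by (simp add: algebra_simps)
  qed
  have a0: "2 * a0 = fps_const (3 / 8) * fps_X - fps_const (q / 2)"
    unfolding a0_def two right_diff_distrib mult.assoc[symmetric] by simp
  have eq: "fps_X * b * fps_deriv (fps_deriv F) + a1 * fps_deriv F + a0 * F = 0"
    using assms(1) unfolding heun_op_def a1_def a0_def b_def h_def by (simp add: mult.assoc)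
  have Z: "Z = 2 * (fps_X * b * (fps_deriv F * fps_deriv F))"
  proof -
    have "Z = fps_X * b * fps_deriv (fps_deriv (F ^ 2)) + a1 * fps_deriv (F ^ 2) + 2 * a0 * F ^ 2"
      unfolding Z_def heun_op_def a0 a1_def b_def h_def by (simp add: mult.assoc)
    also have "\<dots> = 2 * (fps_X * b * (fps_deriv F * fps_deriv F))
        + 2 * F * (fps_X * b * fps_deriv (fps_deriv F) + a1 * fps_deriv F + a0 * F)"
      by (simp add: power2_eq_square algebra_simps)
    finally show ?thesis unfolding eq by simp
  qed
  have dZ: "fps_deriv Z = 2 * ((b + fps_X * b') * (fps_deriv F * fps_deriv F)
      + fps_X * b * (2 * (fps_deriv F * fps_deriv (fps_deriv F))))"
    unfolding Z by (simp add: two b'_def algebra_simps)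
  have dy: "fps_deriv (F ^ 2) = 2 * (F * fps_deriv F)" by (simp add: power2_eq_square algebra_simps)
  show ?thesis
    unfolding dZ dy a0[symmetric] using symmetric_square_algebra[OF a1 eq] unfolding Z .
qed

text \<open>Read off from (1 - t) f' = f / 2; in closed form the coefficients are (1/2)_n /
  n!.\<close>

lemma hyp1F0_half_nth:
  "fps_nth hyp1F0_half 0 = 1"
  "of_nat (Suc n) * fps_nth hyp1F0_half (Suc n) = (of_nat n + 1 / 2) * fps_nth hyp1F0_half n"
proof -
  define f where "f = (\<lambda>t :: complex. (1 - t) powr (- 1 / 2))"
  have nz: "1 - t \<notin> \<real>\<^sub>\<le>\<^sub>0" if "t \<in> ball 0 1" for t :: complex
  proof -
    have "Re t < 1" using that complex_Re_le_cmod[of t] by simp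
    then show ?thesis by (simp add: complex_nonpos_Reals_iff)
  qed
  have d: "(f has_field_derivative 1 / 2 * (1 - t) powr (- 1 / 2 - 1)) (at t)" if "t \<in> ball 0 1" for t
    unfolding f_def using nz[OF that] by (auto intro!: derivative_eq_intros simp: field_simps)
  then have hol: "f holomorphic_on ball 0 1" unfolding holomorphic_on_open[OF open_ball] by blast
  have "f has_fps_expansion fps_expansion f 0"
    by (rule has_fps_expansion_fps_expansion[OF open_ball _ hol]) simp
  then have F: "f has_fps_expansion hyp1F0_half"
    unfolding hyp1F0_half_def f_def .
  have "f 0 = 1" by (simp add: f_def)
  then show "fps_nth hyp1F0_half 0 = 1" using has_fps_expansion_imp_0_eq_fps_nth_0[OF F] by simp
  have "(\<lambda>t. (1 - t) * deriv f t - 1 / 2 * f t) has_fps_expansion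
      (1 - fps_X) * fps_deriv hyp1F0_half - fps_const (1 / 2) * hyp1F0_half"
    by (intro fps_expansion_intros F)
  moreover have "\<forall>\<^sub>F t in nhds 0. (1 - t) * deriv f t - 1 / 2 * f t = 0"
  proof -
    have "\<forall>\<^sub>F t :: complex in nhds 0. t \<in> ball 0 1"
      by (intro eventually_nhds_in_open) auto
    then show ?thesis
    proof eventually_elim
      case (elim t)
      have "1 - t \<noteq> 0" using nz[OF elim] by auto
      then have "(1 - t) * (1 - t) powr (- 1 / 2 - 1) = (1 - t) powr (- 1 / 2)"
        using powr_add[of "1 - t" 1 "- 1 / 2 - 1"] by simp
      then show ?case unfolding DERIV_imp_deriv[OF d[OF elim]] by (simp add: f_def)
    qed
  qed
  ultimately have "(1 - fps_X) * fps_deriv hyp1F0_half - fps_const (1 / 2) * hyp1F0_half = 0"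
    using fps_expansion_zero_iff eventually_nhds_conv_at by blast
  then have "fps_nth (fps_deriv hyp1F0_half - fps_X * fps_deriv hyp1F0_half - fps_const (1 / 2) * hyp1F0_half) n = 0"
    by (simp add: algebra_simps)
  then show "of_nat (Suc n) * fps_nth hyp1F0_half (Suc n) = (of_nat n + 1 / 2) * fps_nth hyp1F0_half n"
    unfolding fps_sub_nth fps_mult_left_const_nth fps_nth_X_mult fps_deriv_nth
    by (cases n) (simp_all add: algebra_simps)
qed

lemma norm_hyp1F0_half: "norm (fps_nth hyp1F0_half n) \<le> 1"
proof (induction n)
  case (Suc n)
  have "real (Suc n) * norm (fps_nth hyp1F0_half (Suc n)) = norm (of_nat n + 1 / 2 :: complex) * norm (fps_nth hyp1F0_half n)"
    using arg_cong[OF hyp1F0_half_nth(2)[of n], of norm] by (simp only: norm_mult norm_of_nat)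
  also have "\<dots> \<le> real (Suc n) * 1"
  proof (rule mult_mono[OF _ Suc.IH])
    have "norm (of_nat n + 1 / 2 :: complex) \<le> norm (of_nat n :: complex) + norm (1 / 2 :: complex)"
      by (rule norm_triangle_ineq)
    then show "norm (of_nat n + 1 / 2 :: complex) \<le> real (Suc n)" by simp
  qed auto
  finally show ?case by (simp add: mult_le_cancel_left_pos del: of_nat_Suc)
qed (simp add: hyp1F0_half_nth)

text \<open>The equation of the square gives a three-term recurrence at N, N + 1, N + 2. Both lower
  coefficients contain the factor N + 3/2, which is what permits splitting off (1/2)_n / n!.\<close>

lemma yn_algebra:
  fixes N :: complex
  assumes "(N + 2) * (a * (N + 2) ^ 2 * y2
     - ((N + 1) * (N * (a + 1) + (a + 1) + 1 / 2 * a + (1 - 1 / 2)) + q / 2) * y1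
     + (N ^ 2 + 1 * N + 3 / 8) * y0) + 3 / 8 * N * y0 - q / 2 * (N + 1) * y1 = 0"
  shows "(N + 2) * (a * (N + 2) ^ 2 * y2)
      = (N + 3 / 2) * (((N + 1) * (N + 2) * (a + 1) + q) * y1 - (N + 1) * (N + 1 / 2) * y0)"
proof -
  have c1: "(N + 2) * ((N + 1) * (N * (a + 1) + (a + 1) + 1 / 2 * a + (1 - 1 / 2)) + q / 2) + q / 2 * (N + 1)
      = (N + 3 / 2) * ((N + 1) * (N + 2) * (a + 1) + q)"
  proof -
    define p where "p = q / 2"
    have q: "q = 2 * p" by (simp add: p_def)
    have 1: "N * (a + 1) + (a + 1) + 1 / 2 * a + (1 - 1 / 2) = (N + 3 / 2) * (a + 1)"
      by (simp add: algebra_simps)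
    have 2: "2 * p * (N + 3 / 2) = (2 * N + 3) * p" by (simp add: algebra_simps)
    have "(N + 2) * ((N + 1) * (S * (a + 1)) + p) + p * (N + 1)
        = S * ((N + 1) * (N + 2) * (a + 1)) + (2 * N + 3) * p" for S
      by (simp add: algebra_simps)
    from this[of "N + 3 / 2"] have "(N + 2) * ((N + 1) * ((N + 3 / 2) * (a + 1)) + p) + p * (N + 1)
        = (N + 3 / 2) * ((N + 1) * (N + 2) * (a + 1)) + (2 * N + 3) * p" .
    also have "\<dots> = (N + 3 / 2) * ((N + 1) * (N + 2) * (a + 1) + q)"
      unfolding 2[symmetric] q
      by (simp only: distrib_left[of "N + 3 / 2" "(N + 1) * (N + 2) * (a + 1)" "2 * p"]
          mult.commute[of "2 * p"])
    finally show ?thesis unfolding 1 p_def .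
  qed
  have c0: "(N + 2) * (N ^ 2 + 1 * N + 3 / 8) + 3 / 8 * N = (N + 3 / 2) * ((N + 1) * (N + 1 / 2))"
  proof -
    have "(N + 2) * (N ^ 2 + 1 * N + k) + k * N = (N + 1) * (N * (N + 2) + 2 * k)" for k
      by (simp add: algebra_simps power2_eq_square)
    from this[of "3 / 8"] have "(N + 2) * (N ^ 2 + 1 * N + 3 / 8) + 3 / 8 * N = (N + 1) * (N * (N + 2) + 3 / 4)"
      by simp
    also have "N * (N + 2) + 3 / 4 = (N + 3 / 2) * (N + 1 / 2)"
    proof -
      have "(N + k) * (N + l) = N * (N + (k + l)) + k * l" for k l
        by (simp add: algebra_simps)
      from this[of "3 / 2" "1 / 2"] show ?thesis by simp
    qed
    finally show ?thesis by (simp only: mult.left_commute)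
  qed
  have "X * (U - V * y1 + V0 * y0) + W0 * y0 - W1 * y1 = X * U - (X * V + W1) * y1 + (X * V0 + W0) * y0"
    for X U V V0 W0 W1 :: complex
    by (simp add: algebra_simps)
  from this[of "N + 2" "a * (N + 2) ^ 2 * y2" _ _ "3 / 8 * N" "q / 2 * (N + 1)"]
  have "(N + 2) * (a * (N + 2) ^ 2 * y2)
      - (N + 3 / 2) * ((N + 1) * (N + 2) * (a + 1) + q) * y1 + (N + 3 / 2) * ((N + 1) * (N + 1 / 2)) * y0 = 0"
    using assms unfolding c1[symmetric] c0[symmetric] by (simp only:)
  moreover have "U - S * B * y1 + S * C * y0 = 0 \<Longrightarrow> U = S * (B * y1 - C * y0)" for U S B C :: complex
    by (simp add: algebra_simps add_eq_0_iff2 eq_diff_eq)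
  ultimately show ?thesis by blast
qed

text \<open>The square is itself a Hadamard product of 1F0(1/2) with the Heun series of exponents 1,
  1. Both sides satisfy the same three-term recurrence, the ratios h (n + 1) / h n accounting for
  the half-integral factors.\<close>

lemma heun_square_coeffs:
  assumes a: "a \<noteq> 0"
  shows "fps_nth (heun_local a (q / 4) (1 / 4) (3 / 4) 1 (1 / 2) ^ 2) n
    = fps_nth hyp1F0_half n * fps_nth (heun_local a q 1 1 1 1) n"
proof -
  define F C where "F = heun_local a (q / 4) (1 / 4) (3 / 4) 1 (1 / 2)" and "C = heun_local a q 1 1 1 1"
  define y c h where "y = fps_nth (F ^ 2)" and "c = fps_nth C" and "h = fps_nth hyp1F0_half"
  define Z where "Z = heun_op a (q / 2) 1 (3 / 8) (1 / 2) (F ^ 2)"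
  have F: "heun_fps a (q / 4) (1 / 4) (3 / 4) (1 / 2) F = 0" "fps_nth F 0 = 1"
    and C: "heun_fps a q 1 1 1 C = 0" "fps_nth C 0 = 1"
    unfolding F_def C_def by (rule heun_local_props[OF a])+
  \<comment> \<open>The coefficient of X^m in \<open>heun_square\<close>: X d/dX + 1 acts as m + 1,
    and the extra factor X shifts the term with 3/8 to index m - 1.\<close>
  have Zn: "of_nat (m + 1) * fps_nth Z m
      + (case m of 0 \<Rightarrow> 0 | Suc k \<Rightarrow> 3 / 8 * of_nat k * y k) - q / 2 * of_nat m * y m = 0" for m
  proof -
    have "fps_nth (fps_X * fps_deriv Z + Z + fps_const (3 / 8) * (fps_X * (fps_X * fps_deriv (F ^ 2)))
        - fps_const (q / 2) * (fps_X * fps_deriv (F ^ 2))) m = 0"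
      using heun_square[OF F(1), folded Z_def] by (simp add: algebra_simps)
    then show ?thesis
      unfolding fps_sub_nth fps_add_nth fps_mult_left_const_nth fps_nth_X_mult fps_deriv_nth y_def
      by (cases m; cases "m - 1"; simp add: fps_nth_X_mult algebra_simps)
  qed
  have h: "h 0 = 1" "of_nat (k + 1) * h (k + 1) = (of_nat k + 1 / 2) * h k" for k
    unfolding h_def using hyp1F0_half_nth(1) hyp1F0_half_nth(2)[of k] by simp_all
  have y0: "y 0 = 1" by (simp add: y_def F(2) power2_eq_square)
  have y1: "a * y 1 = q / 2 * y 0"
    using Zn[of 0] unfolding Z_def by (simp add: heun_op_nth(2) y_def)
  have c1: "a * c 1 = q * c 0" using heun_fps_nth(2)[of a q 1 1 1 C] C by (simp add: c_def)
  have cn: "a * of_nat (m + 2) ^ 2 * c (m + 2)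
      = (of_nat (m + 1) * of_nat (m + 2) * (a + 1) + q) * c (m + 1) - of_nat (m + 1) ^ 2 * c m" for m
    using heun_fps_nth(1)[of a q 1 1 1 C m] unfolding C c_def
    by (simp add: power2_eq_square algebra_simps)
  have yn: "of_nat (m + 2) * (a * of_nat (m + 2) ^ 2 * y (m + 2))
      = (of_nat m + 3 / 2) * ((of_nat (m + 1) * of_nat (m + 2) * (a + 1) + q) * y (m + 1)
         - of_nat (m + 1) * (of_nat m + 1 / 2) * y m)" for m
  proof -
    define N where "N = (of_nat m :: complex)"
    have N: "of_nat (m + 2) = N + 2" "of_nat (m + 1) = N + 1" "of_nat (Suc m + 1) = N + 2" "of_nat (Suc m) = N + 1"
      by (simp_all add: N_def)
    have "(N + 2) * (a * (N + 2) ^ 2 * y (m + 2)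
     - ((N + 1) * (N * (a + 1) + (a + 1) + 1 / 2 * a + (1 - 1 / 2)) + q / 2) * y (m + 1)
     + (N ^ 2 + 1 * N + 3 / 8) * y m) + 3 / 8 * N * y m - q / 2 * (N + 1) * y (m + 1) = 0"
      using Zn[of "Suc m"] unfolding Z_def heun_op_nth(1) y_def[symmetric] N N_def[symmetric]
      by (simp add: N_def)
    then show ?thesis unfolding N N_def[symmetric]
      by (rule yn_algebra)
  qed
  have "y n = h n * c n"
  proof (induction n rule: less_induct)
    case (less n)
    consider "n = 0" | "n = 1" | m where "n = m + 2" by (metis add_2_eq_Suc' not0_implies_Suc One_nat_def)
    then show ?case
    proof cases
      case 1 then show ?thesis using y0 h(1) C(2) by (simp add: c_def)
    next
      case 2
      have "a * y 1 = a * (h 1 * c 1)"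
      proof -
        have "h 1 = 1 / 2" using h(2)[of 0] h(1) by simp
        then have "a * (h 1 * c 1) = 1 / 2 * (a * c 1)" by simp
        also have "\<dots> = q / 2 * y 0" unfolding c1 using y0 C(2) by (simp add: c_def)
        finally show ?thesis unfolding y1 by (rule sym)
      qed
      then show ?thesis unfolding 2 using a mult_left_cancel by blast
    next
      case 3
      define N where "N = (of_nat m :: complex)"
      have N: "of_nat (m + 2) = N + 2" "of_nat (m + 1) = N + 1"
        by (simp_all add: N_def)
      have h1: "(N + 1) * h (m + 1) = (N + 1 / 2) * h m" using h(2)[of m] by (simp only: N N_def)
      have h2: "(N + 2) * h (m + 2) = (N + 3 / 2) * h (m + 1)"
        using h(2)[of "m + 1"] by (simp add: N_def add_ac)
      have IH: "y (m + 1) = h (m + 1) * c (m + 1)" "y m = h m * c m" using less.IH 3 by auto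
      have "of_nat (m + 2) \<noteq> (0 :: complex)" unfolding of_nat_eq_0_iff by simp
      then have nz: "(N + 2) * (a * (N + 2) ^ 2) \<noteq> 0" using a unfolding N by simp
      have "(N + 2) * (a * (N + 2) ^ 2) * y (m + 2)
          = (N + 3 / 2) * (((N + 1) * (N + 2) * (a + 1) + q) * (h (m + 1) * c (m + 1))
              - (N + 1) * ((N + 1 / 2) * h m) * c m)"
        using yn[of m] unfolding N IH N_def[symmetric] by (simp only: mult.assoc)
      \<comment> \<open>\<open>h1\<close> trades (N + 1/2) h m for (N + 1) h (m + 1), completing the
        coefficient (N + 1)^2 in the recurrence for \<open>c\<close>; \<open>h2\<close> then absorbs
        N + 3/2.\<close>
      also have "\<dots> = ((N + 3 / 2) * h (m + 1)) * (((N + 1) * (N + 2) * (a + 1) + q) * c (m + 1) - (N + 1) ^ 2 * c m)"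
        unfolding h1[symmetric] by (simp add: power2_eq_square algebra_simps)
      also have "\<dots> = (N + 2) * (a * (N + 2) ^ 2) * (h (m + 2) * c (m + 2))"
        unfolding h2[symmetric] cn[of m, unfolded N, symmetric] by (simp only: mult_ac)
      finally show ?thesis using nz 3 mult_left_cancel by blast
    qed
  qed
  then show ?thesis by (simp add: y_def h_def c_def F_def C_def)
qed

lemma omega_series:
  fixes a q :: complex
  assumes a: "a \<noteq> 0"
  defines "F \<equiv> hyp1F0_half \<star> heun_local a (q / 4) (1 / 4) (3 / 4) 1 (1 / 2) ^ 2"
  shows "fps_nth F n = fps_nth hyp1F0_half n ^ 2 * fps_nth (heun_local a q 1 1 1 1) n"
    and "fps_conv_radius F > 0"
proof -
  show nth: "fps_nth F n = fps_nth hyp1F0_half n ^ 2 * fps_nth (heun_local a q 1 1 1 1) n" for n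
    unfolding F_def hadamard_def fps_nth_Abs_fps heun_square_coeffs[OF a] by (simp add: power2_eq_square)
  obtain K where K: "K \<ge> 1" "\<And>n. norm (heun_coeff a q 1 1 1 n) \<le> K ^ n"
    using heun_coeff_bound[OF a] by blast
  have "norm (fps_nth F n) \<le> K ^ n" for n
  proof -
    have "norm (fps_nth F n) = norm (fps_nth hyp1F0_half n) ^ 2 * norm (heun_coeff a q 1 1 1 n)"
      by (simp add: nth heun_local_eq(1)[OF a] norm_mult norm_power)
    also have "\<dots> \<le> 1 * K ^ n"
      using norm_hyp1F0_half by (intro mult_mono K power_le_one) auto
    finally show ?thesis by simp
  qed
  then show "fps_conv_radius F > 0" using K by (intro fps_conv_radius_geometric_bound[of K]) auto
qed

section \<open>The period over the A-cycle\<close>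

definition circle_velocity :: "real \<Rightarrow> real \<Rightarrow> complex" where
  "circle_velocity r s = 2 * of_real pi * \<i> * of_real r * exp (2 * of_real pi * \<i> * of_real s)"

lemma has_vector_derivative_circle:
  "(circlepath z r has_vector_derivative circle_velocity r s) (at s within S)"
  unfolding circle_velocity_def using has_vector_derivative_circlepath[of z r s S] by simp

lemma continuous_circle_velocity: "continuous_on S (circle_velocity r)"
  unfolding circle_velocity_def[abs_def] by (intro continuous_intros)

lemma continuous_circlepath: "continuous_on S (circlepath z r)"
  using has_vector_derivative_circle has_vector_derivative_continuous continuous_on_eq_continuous_within by metis

locale A_cycle_family =
  fixes g2 g3 :: "complex poly" and \<rho> :: real and \<Sigma>\<^sub>1 :: "complex \<Rightarrow> real \<Rightarrow> point"
  assumes A_cycle: "A_cycle g2 g3 \<rho> \<Sigma>\<^sub>1"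
begin

text \<open>One radius serves for all t: the x-projection of the cycle does not move, so
  differentiation in t acts through t and the branch y only.\<close>

definition rad :: real where
  "rad = (SOME r. (\<forall>t \<in> ball 0 \<rho>. \<forall>s \<in> {0..1}. \<exists>x y. \<Sigma>\<^sub>1 t s = ([], x, y) \<and>
          x = circlepath (node g2 g3) r s \<and> y \<noteq> 0 \<and>
          y\<^sup>2 = 4 * x ^ 3 - poly g2 t * x - poly g3 t))"

abbreviation xs :: "real \<Rightarrow> complex" where "xs \<equiv> circlepath (node g2 g3) rad"
abbreviation ys :: "complex \<Rightarrow> real \<Rightarrow> complex" where "ys t s \<equiv> snd (snd (\<Sigma>\<^sub>1 t s))"

lemma Sigma1:
  assumes "t \<in> ball 0 \<rho>" "s \<in> {0..1}"
  shows "\<Sigma>\<^sub>1 t s = ([], xs s, ys t s)" "ys t s \<noteq> 0" "ys t s ^ 2 = weier g2 g3 t (xs s)"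
proof -
  let ?Q = "\<lambda>r. (\<forall>t \<in> ball 0 \<rho>. \<forall>s \<in> {0..1}. \<exists>x y. \<Sigma>\<^sub>1 t s = ([], x, y) \<and>
          x = circlepath (node g2 g3) r s \<and> y \<noteq> 0 \<and>
          y\<^sup>2 = 4 * x ^ 3 - poly g2 t * x - poly g3 t)"
  obtain r where "?Q r" using A_cycle unfolding A_cycle_def by blast
  then have "?Q rad" unfolding rad_def by (rule someI[where P = ?Q])
  then obtain x y where "\<Sigma>\<^sub>1 t s = ([], x, y)" "x = xs s" "y \<noteq> 0"
    "y\<^sup>2 = 4 * x ^ 3 - poly g2 t * x - poly g3 t"
    using assms by blast
  then show "\<Sigma>\<^sub>1 t s = ([], xs s, ys t s)" "ys t s \<noteq> 0" "ys t s ^ 2 = weier g2 g3 t (xs s)"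
    by (simp_all add: weier_def)
qed

lemma ys_closed: "t \<in> ball 0 \<rho> \<Longrightarrow> ys t 0 = ys t 1"
  using A_cycle unfolding A_cycle_def by metis

lemma ys_continuous: "continuous_on (ball 0 \<rho> \<times> {0..1}) (\<lambda>z. ys (fst z) (snd z))"
  using A_cycle unfolding A_cycle_def split_beta by blast

text \<open>The integral of e dx over the A-cycle at t.\<close>

definition W :: "rexp \<Rightarrow> complex \<Rightarrow> complex" where
  "W e t = integral {0..1} (\<lambda>s. circle_velocity rad s * reval e t (xs s) (ys t s))"

lemma continuous_reval_cycle:
  "continuous_on (ball 0 \<rho> \<times> {0..1}) (\<lambda>z. reval e (fst z) (xs (snd z)) (ys (fst z) (snd z)))"
proof (rule continuous_on_reval)
  show "continuous_on (ball 0 \<rho> \<times> {0..1}) (\<lambda>z. xs (snd z))"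
    by (rule continuous_on_compose2[OF continuous_circlepath[of UNIV]]) (auto intro!: continuous_intros)
  show "ys (fst z) (snd z) \<noteq> 0" if "z \<in> ball 0 \<rho> \<times> {0..1}" for z
    using that Sigma1(2)[of "fst z" "snd z"] by auto
qed (auto intro!: continuous_intros ys_continuous)

lemma continuous_on_slices:
  assumes "continuous_on (A \<times> B) (\<lambda>z. f (fst z) (snd z))"
  shows "t \<in> A \<Longrightarrow> continuous_on B (f t)" "s \<in> B \<Longrightarrow> continuous_on A (\<lambda>t. f t s)"
proof -
  assume "t \<in> A"
  then have "continuous_on B (\<lambda>s. (\<lambda>z. f (fst z) (snd z)) (t, s))"
    by (intro continuous_on_compose2[OF assms]) (auto intro!: continuous_intros)
  then show "continuous_on B (f t)" by simp
next
  assume "s \<in> B"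
  then have "continuous_on A (\<lambda>t. (\<lambda>z. f (fst z) (snd z)) (t, s))"
    by (intro continuous_on_compose2[OF assms]) (auto intro!: continuous_intros)
  then show "continuous_on A (\<lambda>t. f t s)" by simp
qed

lemma W_has_field_derivative:
  assumes t: "t \<in> ball 0 \<rho>"
  shows "(W e has_field_derivative W (deriv_s g2 g3 e) t) (at t)"
proof -
  have d: "((\<lambda>t. reval e t (xs s) (ys t s)) has_field_derivative reval (deriv_s g2 g3 e) r (xs s) (ys r s)) (at r within ball 0 \<rho>)"
    if r: "r \<in> ball 0 \<rho>" and s: "s \<in> {0..1}" for r :: complex and s :: real
  proof -
    have 1: "((\<lambda>t. t) has_derivative (\<lambda>h. h)) (at r within ball 0 \<rho>)" by (rule has_derivative_ident)
    have 2: "((\<lambda>t. xs s) has_derivative (\<lambda>h. 0)) (at r within ball 0 \<rho>)" by (rule has_derivative_const)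
    have "continuous (at r within ball 0 \<rho>) (\<lambda>t. ys t s)"
      using continuous_on_slices(2)[OF ys_continuous s] r by (simp add: continuous_on_eq_continuous_within)
    then have 3: "((\<lambda>t. ys t s) has_derivative (\<lambda>h. (- (poly (pderiv g2) r * xs s + poly (pderiv g3) r) * h
          + (12 * xs s ^ 2 - poly g2 r) * 0) / (2 * ys r s))) (at r within ball 0 \<rho>)"
      by (intro has_derivative_sqrt_branch[OF has_derivative_weier[OF 1 2]]) (use Sigma1 s r in auto)
    have "((\<lambda>t. reval e t (xs s) (ys t s)) has_derivative (\<lambda>h. reval (deriv_s g2 g3 e) r (xs s) (ys r s) * h
        + reval (deriv_x g2 g3 e) r (xs s) (ys r s) * 0)) (at r within ball 0 \<rho>)"
      by (rule has_derivative_reval[OF 1 2 3 Sigma1(2)[OF r s]])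
    then show ?thesis
      unfolding has_field_derivative_def by (rule has_derivative_eq_rhs) (simp add: fun_eq_iff)
  qed
  have "((\<lambda>t. integral (cbox 0 1) (\<lambda>s. circle_velocity rad s * reval e t (xs s) (ys t s))) has_field_derivative
      integral (cbox 0 1) (\<lambda>s. circle_velocity rad s * reval (deriv_s g2 g3 e) t (xs s) (ys t s))) (at t within ball 0 \<rho>)"
  proof (rule leibniz_rule_field_derivative)
    fix r :: complex and s assume r: "r \<in> ball 0 \<rho>" and s: "s \<in> cbox (0 :: real) 1"
    then have s': "s \<in> {0..1}" by simp
    show "((\<lambda>t. circle_velocity rad s * reval e t (xs s) (ys t s)) has_field_derivative
        circle_velocity rad s * reval (deriv_s g2 g3 e) r (xs s) (ys r s)) (at r within ball 0 \<rho>)"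
      by (rule DERIV_cmult[OF d[OF r s']])
  next
    fix r :: complex assume "r \<in> ball 0 \<rho>"
    then show "(\<lambda>s. circle_velocity rad s * reval e r (xs s) (ys r s)) integrable_on cbox 0 1"
      using continuous_on_slices(1)[OF continuous_reval_cycle[of e]]
      by (intro integrable_continuous continuous_intros continuous_circle_velocity) simp
  next
    have "continuous_on (ball 0 \<rho> \<times> {0..1}) (\<lambda>z. circle_velocity rad (snd z)
        * reval (deriv_s g2 g3 e) (fst z) (xs (snd z)) (ys (fst z) (snd z)))"
      by (intro continuous_intros continuous_reval_cycle continuous_on_compose2[OF continuous_circle_velocity[of UNIV]]) auto
    then show "continuous_on (ball 0 \<rho> \<times> cbox 0 1) (\<lambda>(t, s). circle_velocity rad s
        * reval (deriv_s g2 g3 e) t (xs s) (ys t s))"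
      by (simp add: split_beta)
  qed (use t in auto)
  then show ?thesis
    using at_within_open[OF t open_ball] by (simp add: W_def[abs_def])
qed

text \<open>The lifted circle closes up in x and in y, so the integral of a total x-derivative is a
  difference of equal end values.\<close>

lemma W_deriv_x:
  assumes t: "t \<in> ball 0 \<rho>"
  shows "W (deriv_x g2 g3 e) t = 0"
proof -
  have d: "((\<lambda>s. reval e t (xs s) (ys t s)) has_vector_derivative
      circle_velocity rad s * reval (deriv_x g2 g3 e) t (xs s) (ys t s)) (at s within {0..1})"
    if s: "s \<in> {0..1}" for s
  proof -
    have 1: "((\<lambda>s :: real. t) has_derivative (\<lambda>h. 0)) (at s within {0..1})" by (rule has_derivative_const)
    have 2: "(xs has_derivative (\<lambda>h. h *\<^sub>R circle_velocity rad s)) (at s within {0..1})"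
      using has_vector_derivative_circle unfolding has_vector_derivative_def .
    have "continuous (at s within {0..1}) (\<lambda>s. ys t s)"
      using continuous_on_slices(1)[OF ys_continuous t] s by (simp add: continuous_on_eq_continuous_within)
    then have 3: "((\<lambda>s. ys t s) has_derivative (\<lambda>h. (- (poly (pderiv g2) t * xs s + poly (pderiv g3) t) * 0
          + (12 * xs s ^ 2 - poly g2 t) * (h *\<^sub>R circle_velocity rad s)) / (2 * ys t s))) (at s within {0..1})"
      by (intro has_derivative_sqrt_branch[OF has_derivative_weier[OF 1 2]]) (use Sigma1 s t in auto)
    have "((\<lambda>s. reval e t (xs s) (ys t s)) has_derivative (\<lambda>h. reval (deriv_s g2 g3 e) t (xs s) (ys t s) * 0
        + reval (deriv_x g2 g3 e) t (xs s) (ys t s) * (h *\<^sub>R circle_velocity rad s))) (at s within {0..1})"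
      by (rule has_derivative_reval[OF 1 2 3 Sigma1(2)[OF t s]])
    then show ?thesis
      unfolding has_vector_derivative_def by (rule has_derivative_eq_rhs) (simp add: fun_eq_iff mult.commute)
  qed
  have "((\<lambda>s. circle_velocity rad s * reval (deriv_x g2 g3 e) t (xs s) (ys t s)) has_integral
      reval e t (xs 1) (ys t 1) - reval e t (xs 0) (ys t 0)) {0..1}"
    by (rule fundamental_theorem_of_calculus[OF _ d]) auto
  moreover have "xs 1 = xs 0" by (simp add: circlepath)
  ultimately show ?thesis unfolding W_def using ys_closed[OF t] by (simp add: integral_unique)
qed

lemma period1_W:
  assumes t: "t \<in> ball 0 \<rho>"
  shows "period1 (\<Sigma>\<^sub>1 t) = W RIY t"
proof -
  have "period1 (\<Sigma>\<^sub>1 t) = integral {0<..<1} (\<lambda>s. vector_derivative (\<lambda>s. fst (snd (\<Sigma>\<^sub>1 t s))) (at s) / ys t s)"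
    unfolding period1_def by (rule integral_open_interval_real)
  also have "\<dots> = integral {0<..<1} (\<lambda>s. circle_velocity rad s * reval RIY t (xs s) (ys t s))"
  proof (rule integral_cong)
    fix s :: real assume s: "s \<in> {0<..<1}"
    have "((\<lambda>s. fst (snd (\<Sigma>\<^sub>1 t s))) has_vector_derivative circle_velocity rad s) (at s)"
      by (rule has_vector_derivative_transform_within_open[OF has_vector_derivative_circle[of "node g2 g3"] open_greaterThanLessThan s])
         (use Sigma1(1)[OF t] in \<open>metis atLeastAtMost_iff fst_conv greaterThanLessThan_iff less_imp_le snd_conv\<close>)
    then show "vector_derivative (\<lambda>s. fst (snd (\<Sigma>\<^sub>1 t s))) (at s) / ys t s = circle_velocity rad s * reval RIY t (xs s) (ys t s)"
      by (simp add: vector_derivative_at field_class.field_divide_inverse)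
  qed
  also have "\<dots> = W RIY t" unfolding W_def by (rule integral_open_interval_real[symmetric])
  finally show ?thesis .
qed

lemma W_integrable:
  assumes "t \<in> ball 0 \<rho>"
  shows "(\<lambda>s. circle_velocity rad s * reval e t (xs s) (ys t s)) integrable_on {0..1}"
  using continuous_on_slices(1)[OF continuous_reval_cycle[of e] assms]
  by (intro integrable_continuous_real continuous_intros continuous_circle_velocity)

lemma W_heun:
  assumes gm: "gauss_manin a q g2 g3 A E b" and a: "a \<noteq> 0" and t: "t \<in> ball 0 \<rho>" "t \<noteq> 0"
  shows "t * (t - 1) * (t - a) * W (deriv_s g2 g3 (deriv_s g2 g3 RIY)) t
     + ((t - 1) * (t - a) + t * (t - a) + t * (t - 1)) * W (deriv_s g2 g3 RIY) t + (t - q) * W RIY t = 0"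
proof -
  let ?d = "deriv_s g2 g3 RIY" and ?dd = "deriv_s g2 g3 (deriv_s g2 g3 RIY)"
  define D D' where "D = t * (t - 1) * (t - a)" and "D' = (t - 1) * (t - a) + t * (t - a) + t * (t - 1)"
  have e: "t / a * (D * reval ?dd t (xs s) (ys t s) + D' * reval ?d t (xs s) (ys t s) + (t - q) * reval RIY t (xs s) (ys t s))
      = reval (deriv_x g2 g3 (exact_primitive a q g2 g3 A b)) t (xs s) (ys t s)" if s: "s \<in> {0..1}" for s
  proof -
    have 1: "reval (theta_s g2 g3 RIY) t (xs s) (ys t s) = t * reval ?d t (xs s) (ys t s)"
      "reval (theta_s g2 g3 (theta_s g2 g3 RIY)) t (xs s) (ys t s)
        = t * (reval ?d t (xs s) (ys t s) + t * reval ?dd t (xs s) (ys t s))"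
      unfolding theta_s_def deriv_s.simps(5)[of _ _ RS] by (simp_all add: pderiv_pCons)
    show ?thesis
      using heun_exact[OF gm a Sigma1(2,3)[OF t(1) s]]
      unfolding 1 theta_combination[OF a] D_def D'_def .
  qed
  have "t / a * (D * W ?dd t + D' * W ?d t + (t - q) * W RIY t)
      = integral {0..1} (\<lambda>s. t / a * (D * (circle_velocity rad s * reval ?dd t (xs s) (ys t s))
          + D' * (circle_velocity rad s * reval ?d t (xs s) (ys t s))
          + (t - q) * (circle_velocity rad s * reval RIY t (xs s) (ys t s))))"
    unfolding W_def
    by (rule integral_unique[symmetric])
       (intro has_integral_mult_right has_integral_add integrable_integral W_integrable t(1))
  also have "\<dots> = W (deriv_x g2 g3 (exact_primitive a q g2 g3 A b)) t"
    unfolding W_def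
  proof (rule integral_cong)
    fix s :: real assume s: "s \<in> {0..1}"
    show "t / a * (D * (circle_velocity rad s * reval ?dd t (xs s) (ys t s))
          + D' * (circle_velocity rad s * reval ?d t (xs s) (ys t s))
          + (t - q) * (circle_velocity rad s * reval RIY t (xs s) (ys t s)))
      = circle_velocity rad s * reval (deriv_x g2 g3 (exact_primitive a q g2 g3 A b)) t (xs s) (ys t s)"
      unfolding e[OF s, symmetric] by (simp only: distrib_left mult.left_commute[of _ "circle_velocity rad s"])
  qed
  also have "\<dots> = 0" by (rule W_deriv_x[OF t(1)])
  finally show ?thesis using a t(2) unfolding D_def D'_def by simp
qed

text \<open>The normalized period solves Heun's equation both with q, by definition of the local
  Heun function, and with q', by exactness. Subtracting leaves (q - q') f = 0, and f is nonzero near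
  0.\<close>

lemma accessory_parameter:
  assumes gm: "gauss_manin a q' g2 g3 A E b" and a: "a \<noteq> 0" and \<rho>: "\<rho> > 0"
    and norm: "\<forall>\<^sub>F t in nhds 0. \<kappa> * period1 (\<Sigma>\<^sub>1 t) = 2 * pi * \<i> * eval_fps (heun_local a q 1 1 1 1) t"
  shows "q' = q"
proof -
  define C where "C = heun_local a q 1 1 1 1"
  define f where "f = eval_fps C"
  define k where "k = \<kappa> / (2 * pi * \<i>)"
  have r: "fps_conv_radius C > 0" and C0: "fps_nth C 0 = 1" and Ce: "heun_fps a q 1 1 1 C = 0"
    unfolding C_def by (rule heun_local_props[OF a])+
  have "\<forall>\<^sub>F t in nhds 0. t \<in> ball 0 \<rho>" using \<rho> by (intro eventually_nhds_in_open) auto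
  with norm have "\<forall>\<^sub>F t in nhds 0. f t = k * W RIY t"
  proof eventually_elim
    case (elim t)
    then have "\<kappa> * W RIY t = 2 * pi * \<i> * f t" unfolding f_def C_def by (simp add: period1_W)
    then show ?case unfolding k_def by (simp add: field_simps)
  qed
  then have "\<forall>\<^sub>F t in nhds 0. \<forall>\<^sub>F t in nhds t. f t = k * W RIY t" by (simp only: eventually_eventually)
  then obtain S where S: "open S" "0 \<in> S" "\<And>t. t \<in> S \<Longrightarrow> f t = k * W RIY t"
    unfolding eventually_eventually eventually_nhds by blast
  \<comment> \<open>Equality on an open set, rather than at single points, is what allows comparing
    first and second derivatives.\<close>
  let ?S = "S \<inter> ball 0 \<rho>"
  have oS: "open ?S" using S by auto
  have d1: "deriv f t = k * W (deriv_s g2 g3 RIY) t" if t: "t \<in> ?S" for t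
  proof (rule DERIV_imp_deriv)
    have "((\<lambda>t. k * W RIY t) has_field_derivative k * W (deriv_s g2 g3 RIY) t) (at t)"
      using t by (intro DERIV_cmult W_has_field_derivative) auto
    then show "(f has_field_derivative k * W (deriv_s g2 g3 RIY) t) (at t)"
      by (rule has_field_derivative_transform_within_open[OF _ oS t]) (use S(3) in auto)
  qed
  have d2: "deriv (deriv f) t = k * W (deriv_s g2 g3 (deriv_s g2 g3 RIY)) t" if t: "t \<in> ?S" for t
  proof (rule DERIV_imp_deriv)
    have "((\<lambda>t. k * W (deriv_s g2 g3 RIY) t) has_field_derivative k * W (deriv_s g2 g3 (deriv_s g2 g3 RIY)) t) (at t)"
      using t by (intro DERIV_cmult W_has_field_derivative) auto
    then show "(deriv f has_field_derivative k * W (deriv_s g2 g3 (deriv_s g2 g3 RIY)) t) (at t)"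
      by (rule has_field_derivative_transform_within_open[OF _ oS t]) (use d1 in auto)
  qed
  have "\<forall>\<^sub>F t in at 0. heun_equation a q 1 1 1 1 f t"
    using eventually_heun_iff[OF a r] Ce unfolding f_def by blast
  moreover have "\<forall>\<^sub>F t in at 0. t \<noteq> 0 \<and> t \<noteq> 1 \<and> t \<noteq> a"
    using a by (intro eventually_conj eventually_neq_at_within)
  moreover have "\<forall>\<^sub>F t in at 0. t \<in> ?S"
    using oS S(2) \<rho> by (intro eventually_at_in_open') auto
  moreover have "\<forall>\<^sub>F t in at 0. f t \<noteq> 0"
  proof -
    have "f has_fps_expansion C" using r by (simp add: has_fps_expansion_def f_def)
    then have "(f \<longlongrightarrow> f 0) (at 0)"
      using has_fps_expansion_imp_continuous[of f C UNIV] by (simp add: continuous_within)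
    moreover have "f 0 \<noteq> 0" by (simp add: f_def eval_fps_at_0 C0)
    ultimately show ?thesis by (rule tendsto_imp_eventually_ne)
  qed
  ultimately have "\<forall>\<^sub>F t in at (0 :: complex). q' = q"
  proof eventually_elim
    case (elim t)
    then have nz: "t \<noteq> 0" "t \<noteq> 1" "t \<noteq> a" and tS: "t \<in> ?S" by auto
    have 1: "t * (t - 1) * (t - a) * deriv (deriv f) t
     + ((t - 1) * (t - a) + t * (t - a) + t * (t - 1)) * deriv f t + (t - q) * f t = 0"
      using elim(1) unfolding heun_equation_iff[OF nz] by simp
    have "k * (t * (t - 1) * (t - a) * W (deriv_s g2 g3 (deriv_s g2 g3 RIY)) t
     + ((t - 1) * (t - a) + t * (t - a) + t * (t - 1)) * W (deriv_s g2 g3 RIY) t + (t - q') * W RIY t) = 0"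
      using W_heun[OF gm a _ nz(1)] tS by simp
    then have 2: "t * (t - 1) * (t - a) * deriv (deriv f) t
     + ((t - 1) * (t - a) + t * (t - a) + t * (t - 1)) * deriv f t + (t - q') * f t = 0"
      unfolding d1[OF tS] d2[OF tS] using S(3)[of t] tS by (simp only: distrib_left mult.left_commute[of k]) simp
    have "(t - q) * f t = (t - q') * f t" using 1 2 by (metis add_left_cancel)
    then show ?case using elim(4) by simp
  qed
  then show ?thesis by simp
qed

end

section \<open>The period over the warped product\<close>

abbreviation base_circle :: "real \<Rightarrow> complex" where "base_circle \<equiv> circlepath 0 (1 / 2)"

lemma norm_base_circle: "norm (base_circle r) = 1 / 2"
  by (simp add: circlepath norm_mult)

text \<open>On the circle both v and v + 1 have modulus at least 1/2, so dividing by 4 v (v + 1)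
  never increases the modulus. Twisted parameters thus stay in the disc over which the A-cycle is
  given.\<close>

lemma base_circle_bounds:
  "base_circle r \<noteq> 0" "base_circle r + 1 \<noteq> 0" "norm (4 * (base_circle r * (base_circle r + 1))) \<ge> 1"
proof -
  show "base_circle r \<noteq> 0" using norm_base_circle[of r] by auto
  have "norm (base_circle r + 1) \<ge> 1 - norm (base_circle r)"
    using norm_triangle_ineq4[of "base_circle r + 1" "base_circle r"] by simp
  then have 1: "norm (base_circle r + 1) \<ge> 1 / 2" unfolding norm_base_circle by simp
  then show "base_circle r + 1 \<noteq> 0" by auto
  have "4 * ((1 / 2) * (1 / 2)) \<le> 4 * (norm (base_circle r) * norm (base_circle r + 1))"
    using 1 unfolding norm_base_circle by simp
  then show "norm (4 * (base_circle r * (base_circle r + 1))) \<ge> 1"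
    by (simp add: norm_mult)
qed

lemma norm_twist_param: "norm (twist_param t (base_circle r)) \<le> norm t"
proof -
  have "norm (twist_param t (base_circle r)) = norm t / norm (4 * (base_circle r * (base_circle r + 1)))"
    by (simp add: twist_param_def norm_divide norm_mult mult.assoc)
  also have "\<dots> \<le> norm t / 1"
    using base_circle_bounds(3)[of r] by (intro divide_left_mono) auto
  finally show ?thesis by simp
qed

abbreviation base_weight :: "real \<Rightarrow> complex" where
  "base_weight r \<equiv> base_circle r * (base_circle r + 1)"

lemma base_weight_nz: "base_weight r \<noteq> 0"
  using base_circle_bounds[of r] by simp

text \<open>The value is 2 pi i times the residue at 0, the signed central binomial coefficient
  (-1)^n (2n choose n) = (-4)^n (1/2)_n / n!. The induction uses that (2 v + 1) (v (v + 1))^-(n+1)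
  has the same value at both ends of the circle.\<close>

lemma circle_residue:
  "((\<lambda>r. circle_velocity (1 / 2) r * inverse (base_weight r) ^ Suc n) has_integral
     2 * of_real pi * \<i> * (- 4) ^ n * fps_nth hyp1F0_half n) {0..1}"
proof (induction n)
  case 0
  have "((\<lambda>w. inverse (w + 1) / (w - 0)) has_contour_integral 2 * of_real pi * \<i> * inverse (0 + 1)) (circlepath 0 (1 / 2))"
  proof (rule Cauchy_integral_circlepath_simple)
    show "(\<lambda>w. inverse (w + 1)) holomorphic_on cball (0 :: complex) (1 / 2)"
    proof (intro holomorphic_intros)
      fix w :: complex assume "w \<in> cball 0 (1 / 2)"
      then have "norm w \<le> 1 / 2" by simp
      then show "w + 1 \<noteq> 0" by (auto simp: add_eq_0_iff2)
    qed
  qed auto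
  then have cI: "((\<lambda>r. inverse (base_circle r + 1) / (base_circle r - 0) * vector_derivative base_circle (at r within {0..1}))
      has_integral 2 * of_real pi * \<i>) {0..1}"
    unfolding has_contour_integral_def by simp
  have cE: "inverse (base_circle r + 1) / (base_circle r - 0) * vector_derivative base_circle (at r within {0..1})
      = circle_velocity (1 / 2) r * inverse (base_weight r) ^ Suc 0" if "r \<in> {0..1}" for r
  proof -
    have "vector_derivative base_circle (at r within {0..1}) = circle_velocity (1 / 2) r"
      by (rule vector_derivative_within_cbox[of 0 1, simplified]) (use that has_vector_derivative_circle in auto)
    then show ?thesis
      unfolding field_class.field_divide_inverse inverse_mult_distrib power_Suc power_0 mult_1_right diff_zero
      by (simp only: mult_ac)
  qed
  show ?case
    using has_integral_eq[OF cE cI] unfolding power_0 hyp1F0_half_nth(1) mult_1_right .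
next
  case (Suc n)
  let ?i = "\<lambda>r. inverse (base_weight r)"
  let ?N = "of_nat (Suc n) :: complex"
  \<comment> \<open>The derivative of that function along the circle; (2 v + 1)^2 = 4 v (v + 1) + 1
    reduces it to two consecutive inverse powers.\<close>
  define d where "d = (\<lambda>r. circle_velocity (1 / 2) r * ((2 - 4 * ?N) * ?i r ^ Suc n - ?N * ?i r ^ Suc (Suc n)))"
  have "((\<lambda>r. (2 * base_circle r + 1) * ?i r ^ Suc n) has_vector_derivative d r) (at r within {0..1})" for r
  proof -
    define v where "v = base_circle r"
    have nz: "v * (v + 1) \<noteq> 0" unfolding v_def by (rule base_weight_nz)
    define i where "i = inverse (v * (v + 1))"
    have i: "v * (v + 1) * i = 1" unfolding i_def by (rule right_inverse[OF nz])
    have D1: "((\<lambda>w. 2 * w + 1) has_field_derivative 2) (at v)"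
      by (auto intro!: derivative_eq_intros)
    have D2: "((\<lambda>w. w * (w + 1)) has_field_derivative (2 * v + 1)) (at v)"
      by (auto intro!: derivative_eq_intros)
    have D3: "((\<lambda>w. inverse (w * (w + 1))) has_field_derivative - (inverse (v * (v + 1)) * (2 * v + 1) * inverse (v * (v + 1)))) (at v)"
      by (rule DERIV_inverse'[OF D2 nz])
    have D4: "((\<lambda>w. inverse (w * (w + 1)) ^ Suc n) has_field_derivative
        ?N * (- (inverse (v * (v + 1)) * (2 * v + 1) * inverse (v * (v + 1))) * inverse (v * (v + 1)) ^ n)) (at v)"
      using DERIV_power[OF D3, of "Suc n"] by (simp del: of_nat_Suc power_Suc)
    have "((\<lambda>w. (2 * w + 1) * inverse (w * (w + 1)) ^ Suc n) has_field_derivative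
        (2 * v + 1) * (?N * (- (i * (2 * v + 1) * i) * i ^ n)) + 2 * i ^ Suc n) (at v)"
      using DERIV_mult'[OF D1 D4] unfolding i_def[symmetric] .
    moreover have "(2 * v + 1) * (?N * (- (i * (2 * v + 1) * i) * i ^ n)) + 2 * i ^ Suc n
        = (2 - 4 * ?N) * i ^ Suc n - ?N * i ^ Suc (Suc n)"
    proof -
      have "(2 * v + 1) * (?N * (- (i * (2 * v + 1) * i) * i ^ n))
          = - (?N * i ^ Suc n * (4 * (v * (v + 1) * i) + i))"
        by (simp add: algebra_simps del: of_nat_Suc)
      then show ?thesis unfolding i by (simp add: algebra_simps del: of_nat_Suc)
    qed
    ultimately have "((\<lambda>w. (2 * w + 1) * inverse (w * (w + 1)) ^ Suc n) has_field_derivative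
        (2 - 4 * ?N) * i ^ Suc n - ?N * i ^ Suc (Suc n)) (at (base_circle r))"
      by (simp only: v_def)
    from field_vector_diff_chain_within[OF has_vector_derivative_circle has_field_derivative_at_within[OF this]]
    show ?thesis unfolding d_def i_def v_def o_def by (simp only: mult.commute)
  qed
  then have "(d has_integral (2 * base_circle 1 + 1) * ?i 1 ^ Suc n - (2 * base_circle 0 + 1) * ?i 0 ^ Suc n) {0..1}"
    by (intro fundamental_theorem_of_calculus) auto
  moreover have "base_circle 1 = base_circle 0" by (simp add: circlepath)
  ultimately have d0: "(d has_integral 0) {0..1}" by simp
  have N: "?N \<noteq> 0" by (rule of_nat_neq_0)
  have "((\<lambda>r. inverse ?N * ((2 - 4 * ?N) * (circle_velocity (1 / 2) r * ?i r ^ Suc n) - d r)) has_integral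
      inverse ?N * ((2 - 4 * ?N) * (2 * of_real pi * \<i> * (- 4) ^ n * fps_nth hyp1F0_half n) - 0)) {0..1}"
    by (intro has_integral_mult_right has_integral_diff Suc.IH d0)
  moreover have "inverse ?N * ((2 - 4 * ?N) * (circle_velocity (1 / 2) r * ?i r ^ Suc n) - d r)
      = circle_velocity (1 / 2) r * ?i r ^ Suc (Suc n)" for r
  proof -
    have "(2 - 4 * ?N) * (circle_velocity (1 / 2) r * ?i r ^ Suc n) - d r = ?N * (circle_velocity (1 / 2) r * ?i r ^ Suc (Suc n))"
      unfolding d_def by (simp only: right_diff_distrib mult.left_commute[of "circle_velocity (1 / 2) r"]) simp
    then show ?thesis using N by (simp only: mult.assoc[symmetric] left_inverse mult_1_left not_False_eq_True)
  qed
  moreover have "inverse ?N * ((2 - 4 * ?N) * (2 * of_real pi * \<i> * (- 4) ^ n * fps_nth hyp1F0_half n) - 0)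
      = 2 * of_real pi * \<i> * (- 4) ^ Suc n * fps_nth hyp1F0_half (Suc n)"
  proof -
    have h: "fps_nth hyp1F0_half (Suc n) = inverse ?N * ((?N - 1 / 2) * fps_nth hyp1F0_half n)"
    proof -
      have "?N * fps_nth hyp1F0_half (Suc n) = (?N - 1 / 2) * fps_nth hyp1F0_half n"
        unfolding hyp1F0_half_nth(2) by simp
      then show ?thesis using N by (metis left_inverse mult.assoc mult_1_left)
    qed
    have "2 - 4 * ?N = (- 4) * (?N - 1 / 2)" by (simp add: algebra_simps)
    then show ?thesis unfolding h power_Suc diff_0_right by (simp only: mult_ac)
  qed
  ultimately show ?case by (simp only:)
qed

text \<open>Twisted parameters are bounded by norm t, so the series converges uniformly on the
  circle and may be integrated termwise. The factor (-4)^k of the residue cancels against (- t /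
  4)^k.\<close>

lemma twist_series:
  fixes G :: "complex fps"
  assumes t: "ereal (norm t) < fps_conv_radius G"
  shows "integral {0..1} (\<lambda>r. circle_velocity (1 / 2) r * (inverse (base_weight r) * eval_fps G (twist_param t (base_circle r))))
    = 2 * of_real pi * \<i> * eval_fps (hyp1F0_half \<star> G) t"
proof -
  define f where "f = (\<lambda>k r. circle_velocity (1 / 2) r * (inverse (base_weight r) * (fps_nth G k * twist_param t (base_circle r) ^ k)))"
  define g where "g = (\<lambda>r. circle_velocity (1 / 2) r * (inverse (base_weight r) * eval_fps G (twist_param t (base_circle r))))"
  have tw: "twist_param t (base_circle r) = - t / 4 * inverse (base_weight r)" for r
    unfolding twist_param_def field_class.field_divide_inverse inverse_mult_distrib by (simp only: mult.assoc)
  have fi: "(f k has_integral 2 * of_real pi * \<i> * (fps_nth hyp1F0_half k * fps_nth G k * t ^ k)) {0..1}" for k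
  proof -
    have "((\<lambda>r. (fps_nth G k * (- t / 4) ^ k) * (circle_velocity (1 / 2) r * inverse (base_weight r) ^ Suc k)) has_integral
        (fps_nth G k * (- t / 4) ^ k) * (2 * of_real pi * \<i> * (- 4) ^ k * fps_nth hyp1F0_half k)) {0..1}"
      by (rule has_integral_mult_right[OF circle_residue])
    moreover have "(fps_nth G k * (- t / 4) ^ k) * (circle_velocity (1 / 2) r * inverse (base_weight r) ^ Suc k) = f k r" for r
      unfolding f_def tw power_mult_distrib power_Suc by (simp only: mult_ac)
    moreover have "(fps_nth G k * (- t / 4) ^ k) * (2 * of_real pi * \<i> * (- 4) ^ k * fps_nth hyp1F0_half k)
        = 2 * of_real pi * \<i> * (fps_nth hyp1F0_half k * fps_nth G k * t ^ k)"
    proof -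
      have "(- t / 4) ^ k * (- 4) ^ k = t ^ k" by (simp flip: power_mult_distrib)
      moreover have "(fps_nth G k * X) * (2 * of_real pi * \<i> * Y * fps_nth hyp1F0_half k)
          = 2 * of_real pi * \<i> * (fps_nth hyp1F0_half k * fps_nth G k * (X * Y))" for X Y
        by (simp only: mult_ac)
      ultimately show ?thesis by (simp only:)
    qed
    ultimately show ?thesis by (simp only:)
  qed
  have "summable (\<lambda>k. norm (fps_nth G k * t ^ k))"
    using t abs_summable_in_conv_radius[of t "fps_nth G"] by (simp add: fps_conv_radius_def)
  then have "uniform_limit {0..1} (\<lambda>n r. \<Sum>k<n. fps_nth G k * twist_param t (base_circle r) ^ k)
      (\<lambda>r. suminf (\<lambda>k. fps_nth G k * twist_param t (base_circle r) ^ k)) sequentially"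
    by (rule Weierstrass_m_test[rotated])
       (auto simp: norm_mult norm_power intro!: mult_left_mono power_mono norm_twist_param)
  then have ul0: "uniform_limit {0..1} (\<lambda>n r. \<Sum>k<n. fps_nth G k * twist_param t (base_circle r) ^ k)
      (\<lambda>r. eval_fps G (twist_param t (base_circle r))) sequentially"
    by (simp add: eval_fps_def)
  have cw: "continuous_on {0..1} (\<lambda>r. circle_velocity (1 / 2) r * inverse (base_weight r))"
    by (intro continuous_intros continuous_circle_velocity continuous_circlepath) (use base_weight_nz in auto)
  have bd: "bounded ((\<lambda>r. circle_velocity (1 / 2) r * inverse (base_weight r)) ` {0..1})"
    by (intro compact_imp_bounded compact_continuous_image cw) auto
  have tc: "continuous_on {0..1} (\<lambda>r. twist_param t (base_circle r))"
    unfolding tw by (intro continuous_intros continuous_circlepath) (use base_weight_nz in auto)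
  have "bounded ((\<lambda>r. eval_fps G (twist_param t (base_circle r))) ` {0..1})"
  proof (intro compact_imp_bounded compact_continuous_image)
    have "(\<lambda>r. twist_param t (base_circle r)) ` {0..1} \<subseteq> eball 0 (fps_conv_radius G)"
    proof (rule image_subsetI)
      fix r
      have "ereal (norm (twist_param t (base_circle r))) \<le> ereal (norm t)" using norm_twist_param by simp
      also note t
      finally show "twist_param t (base_circle r) \<in> eball 0 (fps_conv_radius G)" by (simp add: in_eball_iff)
    qed
    then show "continuous_on {0..1} (\<lambda>r. eval_fps G (twist_param t (base_circle r)))"
      by (intro continuous_on_compose2[OF continuous_on_eval_fps tc])
  qed auto
  with bd have "uniform_limit {0..1} (\<lambda>n r. circle_velocity (1 / 2) r * inverse (base_weight r)
        * (\<Sum>k<n. fps_nth G k * twist_param t (base_circle r) ^ k))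
      (\<lambda>r. circle_velocity (1 / 2) r * inverse (base_weight r) * eval_fps G (twist_param t (base_circle r))) sequentially"
    by (intro uniform_lim_mult uniform_limit_const ul0)
  then have ul: "uniform_limit (cbox 0 1) (\<lambda>n r. \<Sum>k<n. f k r) g sequentially"
    unfolding f_def g_def by (simp only: mult.assoc sum_distrib_left cbox_interval)
  have "continuous_on (cbox 0 1) (\<lambda>r. \<Sum>k<n. f k r)" for n
    unfolding f_def mult.assoc[symmetric] cbox_interval
    by (intro continuous_intros cw tc)
  then obtain I J where I: "\<And>n. ((\<lambda>r. \<Sum>k<n. f k r) has_integral I n) (cbox 0 1)"
    and J: "(g has_integral J) (cbox 0 1)" and IJ: "(I \<longlongrightarrow> J) sequentially"
    using uniform_limit_integral_cbox[OF ul] by (metis sequentially_bot)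
  have "I n = (\<Sum>k<n. 2 * of_real pi * \<i> * (fps_nth hyp1F0_half k * fps_nth G k * t ^ k))" for n
  proof (rule has_integral_unique[OF I])
    show "((\<lambda>r. \<Sum>k<n. f k r) has_integral (\<Sum>k<n. 2 * of_real pi * \<i> * (fps_nth hyp1F0_half k * fps_nth G k * t ^ k))) (cbox 0 1)"
      unfolding cbox_interval by (intro has_integral_sum fi) auto
  qed
  then have "I = (\<lambda>n. \<Sum>k<n. 2 * of_real pi * \<i> * (fps_nth hyp1F0_half k * fps_nth G k * t ^ k))" by (rule ext)
  with IJ have S: "(\<lambda>k. 2 * of_real pi * \<i> * (fps_nth hyp1F0_half k * fps_nth G k * t ^ k)) sums J"
    unfolding sums_def by (simp only:)
  have nz: "2 * of_real pi * \<i> \<noteq> (0 :: complex)" by simp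
  have "(\<lambda>k. fps_nth hyp1F0_half k * fps_nth G k * t ^ k) sums (J / (2 * of_real pi * \<i>))"
    using sums_divide[OF S, of "2 * of_real pi * \<i>"]
    by (simp only: nonzero_mult_div_cancel_left[OF nz])
  then have "eval_fps (hyp1F0_half \<star> G) t = J / (2 * of_real pi * \<i>)"
    unfolding eval_fps_def hadamard_def fps_nth_Abs_fps by (rule sums_unique[symmetric])
  then have "J = 2 * of_real pi * \<i> * eval_fps (hyp1F0_half \<star> G) t" by simp
  moreover have "integral {0..1} g = J" using J by (simp add: integral_unique)
  ultimately show ?thesis unfolding g_def by simp
qed

lemma warped_product_eq:
  assumes "\<Sigma> (twist_param t (base_circle r)) p = (bs, x, y)"
  shows "warped_product \<Sigma> t (r, p) = (base_circle r # bs, base_weight r ^ 2 * x, base_weight r ^ 3 * y)"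
  using assms by (simp add: warped_product_def Let_def)

lemma box_unit_cubeI: "(x, y, z) \<in> box (0, 0, 0) (1, 1, 1) \<longleftrightarrow> x \<in> {0<..<1} \<and> y \<in> {0<..<1} \<and> z \<in> {0<..<1 :: real}"
  for x y z :: real
  by (auto simp: mem_box Basis_prod_def)

context A_cycle_family
begin

abbreviation tau :: "complex \<Rightarrow> real \<Rightarrow> real \<Rightarrow> complex" where
  "tau t r1 r2 \<equiv> twist_param (twist_param t (base_circle r1)) (base_circle r2)"

lemma tau_in_ball:
  assumes "t \<in> ball 0 \<delta>"
  shows "twist_param t (base_circle r1) \<in> ball 0 \<delta>" "tau t r1 r2 \<in> ball 0 \<delta>"
  using assms norm_twist_param[of t r1] norm_twist_param[of "twist_param t (base_circle r1)" r2]
  by (auto simp: dist_norm)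

lemma Sigma3_eq:
  assumes "t \<in> ball 0 \<rho>" "s \<in> {0..1}"
  shows "Sigma3 \<Sigma>\<^sub>1 t (r1, r2, s) = ([base_circle r1, base_circle r2],
     base_weight r1 ^ 2 * (base_weight r2 ^ 2 * xs s), base_weight r1 ^ 3 * (base_weight r2 ^ 3 * ys (tau t r1 r2) s))"
  unfolding Sigma3_def
  by (rule warped_product_eq, rule warped_product_eq, rule Sigma1(1)[OF tau_in_ball(2)[OF assms(1)] assms(2)])

text \<open>The nesting of the factors follows the iterated integral, so that each inner integral
  can be pulled out at once.\<close>

definition period_integrand :: "complex \<Rightarrow> real \<times> real \<times> real \<Rightarrow> complex" where
  "period_integrand t p = circle_velocity (1 / 2) (fst p) * (inverse (base_weight (fst p))
     * (circle_velocity (1 / 2) (fst (snd p)) * (inverse (base_weight (fst (snd p)))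
        * (circle_velocity rad (snd (snd p)) * inverse (ys (tau t (fst p) (fst (snd p))) (snd (snd p)))))))"

lemma has_derivative_lift:
  assumes "(f has_vector_derivative f') (at (\<pi> p))" "(\<pi> has_derivative \<pi>) (at p)"
  shows "((\<lambda>p. f (\<pi> p)) has_derivative (\<lambda>h. \<pi> h *\<^sub>R f')) (at p)"
  using has_derivative_compose[OF assms(2) assms(1)[unfolded has_vector_derivative_def]] .

lemma det_lower_triangular:
  "det (vector [vector [a, 0, 0], vector [0, b, 0], vector [x, y, c]] :: complex ^ 3 ^ 3) = a * b * c"
  by (simp add: det_3)

lemma square_inverse_cube:
  fixes a :: complex
  assumes "a \<noteq> 0"
  shows "a ^ 2 * inverse (a ^ 3) = inverse a"
proof -
  have "a ^ 2 * inverse (a ^ 3) = (a * a) * inverse (a * a) * inverse a"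
    unfolding power2_eq_square power3_eq_cube inverse_mult_distrib[of "a * a" a] by (rule mult.assoc[symmetric])
  also have "(a * a) * inverse (a * a) = 1" using assms by (intro right_inverse) simp
  finally show ?thesis by simp
qed

lemma weight_cancel:
  fixes a :: complex
  assumes "a \<noteq> 0" "b \<noteq> 0"
  shows "u * v * (a ^ 2 * (b ^ 2 * w)) / (a ^ 3 * (b ^ 3 * y)) = u * (inverse a * (v * (inverse b * (w * inverse y))))"
proof -
  have "u * v * (a ^ 2 * (b ^ 2 * w)) / (a ^ 3 * (b ^ 3 * y))
      = (u * v * w) * (a ^ 2 * inverse (a ^ 3)) * (b ^ 2 * inverse (b ^ 3)) * inverse y"
    unfolding field_class.field_divide_inverse inverse_mult_distrib by (simp only: mult_ac)
  also have "a ^ 2 * inverse (a ^ 3) = inverse a" by (rule square_inverse_cube[OF assms(1)])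
  also have "b ^ 2 * inverse (b ^ 3) = inverse b" by (rule square_inverse_cube[OF assms(2)])
  finally show ?thesis by (simp only: mult_ac)
qed

text \<open>The coordinate u depends on the first cube variable alone and v on the second alone, so
  the Jacobian is triangular. The rescalings contribute a square in dX and a cube in Y, leaving du /
  (u (u + 1)) and dv / (v (v + 1)).\<close>

lemma period3_Sigma3_integrand:
  assumes t: "t \<in> ball 0 \<rho>"
  shows "period3 (Sigma3 \<Sigma>\<^sub>1 t) = integral unit_cube (period_integrand t)"
proof -
  let ?c = "Sigma3 \<Sigma>\<^sub>1 t"
  have op: "open (box (0, 0, 0) (1, 1, 1) :: (real \<times> real \<times> real) set)" by (rule open_box)
  have "period3 ?c = integral (box (0, 0, 0) (1, 1, 1)) (\<lambda>p.
     (let D = (\<lambda>f e. frechet_derivative (\<lambda>p. f (?c p)) (at p) e);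
          row = (\<lambda>f. vector [D f (1, 0, 0), D f (0, 1, 0), D f (0, 0, 1)] :: complex ^ 3)
      in det (vector [row coord_u, row coord_v, row coord_X] :: complex ^ 3 ^ 3)) / coord_Y (?c p))"
    unfolding period3_def by (rule integral_open_interval[symmetric])
  also have "\<dots> = integral (box (0, 0, 0) (1, 1, 1)) (period_integrand t)"
  proof (rule integral_cong)
    fix p :: "real \<times> real \<times> real" assume p: "p \<in> box (0, 0, 0) (1, 1, 1)"
    have c: "?c q = ([base_circle (fst q), base_circle (fst (snd q))],
       base_weight (fst q) ^ 2 * (base_weight (fst (snd q)) ^ 2 * xs (snd (snd q))),
       base_weight (fst q) ^ 3 * (base_weight (fst (snd q)) ^ 3 * ys (tau t (fst q) (fst (snd q))) (snd (snd q))))"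
      if "q \<in> box (0, 0, 0) (1, 1, 1)" for q
    proof -
      have "snd (snd q) \<in> {0..1}" using that by (cases q) (auto simp: box_unit_cubeI)
      from Sigma3_eq[OF t this, of "fst q" "fst (snd q)"] show ?thesis by simp
    qed
    have l: "(fst has_derivative fst) (at p)" "((\<lambda>p. fst (snd p)) has_derivative (\<lambda>p. fst (snd p))) (at p)"
      "((\<lambda>p. snd (snd p)) has_derivative (\<lambda>p. snd (snd p))) (at p)"
      by (auto intro!: derivative_eq_intros)
    have u: "((\<lambda>p. base_circle (fst p)) has_derivative (\<lambda>h. fst h *\<^sub>R circle_velocity (1 / 2) (fst p))) (at p)"
      by (rule has_derivative_lift[OF has_vector_derivative_circle l(1)])
    have v: "((\<lambda>p. base_circle (fst (snd p))) has_derivative (\<lambda>h. fst (snd h) *\<^sub>R circle_velocity (1 / 2) (fst (snd p)))) (at p)"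
      by (rule has_derivative_lift[OF has_vector_derivative_circle l(2)])
    have x: "((\<lambda>p. xs (snd (snd p))) has_derivative (\<lambda>h. snd (snd h) *\<^sub>R circle_velocity rad (snd (snd p)))) (at p)"
      by (rule has_derivative_lift[OF has_vector_derivative_circle l(3)])
    have w: "((\<lambda>w. (w * (w + 1)) ^ 2) has_derivative (*) (2 * (z * (z + 1)) * (2 * z + 1))) (at z)" for z :: complex
      unfolding has_field_derivative_def[symmetric] by (auto intro!: derivative_eq_intros simp: algebra_simps)
    note X = has_derivative_mult[OF has_derivative_compose[OF u w] has_derivative_mult[OF has_derivative_compose[OF v w] x]]
    have Du: "frechet_derivative (\<lambda>p. coord_u (?c p)) (at p) = (\<lambda>h. fst h *\<^sub>R circle_velocity (1 / 2) (fst p))"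
      by (rule frechet_derivative_at[symmetric], rule has_derivative_transform_within_open[OF u op p]) (simp add: c)
    have Dv: "frechet_derivative (\<lambda>p. coord_v (?c p)) (at p) = (\<lambda>h. fst (snd h) *\<^sub>R circle_velocity (1 / 2) (fst (snd p)))"
      by (rule frechet_derivative_at[symmetric], rule has_derivative_transform_within_open[OF v op p]) (simp add: c)
    \<comment> \<open>The rows of u and v are diagonal, so the determinant meets the row of X only
      through this entry.\<close>
    have DX: "frechet_derivative (\<lambda>p. coord_X (?c p)) (at p) (0, 0, 1)
        = base_weight (fst p) ^ 2 * (base_weight (fst (snd p)) ^ 2 * circle_velocity rad (snd (snd p)))"
      by (subst frechet_derivative_at[symmetric, OF has_derivative_transform_within_open[OF X op p]]) (simp_all add: c)
    have "(let D = (\<lambda>f e. frechet_derivative (\<lambda>p. f (?c p)) (at p) e);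
          row = (\<lambda>f. vector [D f (1, 0, 0), D f (0, 1, 0), D f (0, 0, 1)] :: complex ^ 3)
      in det (vector [row coord_u, row coord_v, row coord_X] :: complex ^ 3 ^ 3)) / coord_Y (?c p)
      = circle_velocity (1 / 2) (fst p) * circle_velocity (1 / 2) (fst (snd p))
        * (base_weight (fst p) ^ 2 * (base_weight (fst (snd p)) ^ 2 * circle_velocity rad (snd (snd p))))
        / (base_weight (fst p) ^ 3 * (base_weight (fst (snd p)) ^ 3 * ys (tau t (fst p) (fst (snd p))) (snd (snd p))))"
      unfolding Let_def Du Dv DX fst_conv snd_conv scaleR_one scaleR_zero_left det_lower_triangular c[OF p] ..
    also have "\<dots> = period_integrand t p"
      unfolding period_integrand_def by (rule weight_cancel[OF base_weight_nz base_weight_nz])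
    finally show "(let D = (\<lambda>f e. frechet_derivative (\<lambda>p. f (?c p)) (at p) e);
          row = (\<lambda>f. vector [D f (1, 0, 0), D f (0, 1, 0), D f (0, 0, 1)] :: complex ^ 3)
      in det (vector [row coord_u, row coord_v, row coord_X] :: complex ^ 3 ^ 3)) / coord_Y (?c p)
      = period_integrand t p" .
  qed
  also have "\<dots> = integral unit_cube (period_integrand t)" by (rule integral_open_interval)
  finally show ?thesis .
qed

lemma continuous_period_integrand:
  assumes t: "t \<in> ball 0 \<rho>"
  shows "continuous_on unit_cube (period_integrand t)"
proof -
  have c: "continuous_on unit_cube (\<lambda>p. f (fst p))" "continuous_on unit_cube (\<lambda>p. f (fst (snd p)))"
    "continuous_on unit_cube (\<lambda>p. f (snd (snd p)))" if "continuous_on UNIV f" for f :: "real \<Rightarrow> complex"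
    by (rule continuous_on_compose2[OF that]; auto intro!: continuous_intros)+
  have tc: "continuous_on unit_cube (\<lambda>p. tau t (fst p) (fst (snd p)))"
    unfolding twist_param_def
    by (intro continuous_intros c continuous_circlepath) (use base_circle_bounds in auto)
  have y: "continuous_on unit_cube (\<lambda>p. ys (tau t (fst p) (fst (snd p))) (snd (snd p)))"
  proof -
    have "continuous_on unit_cube (\<lambda>p. (tau t (fst p) (fst (snd p)), snd (snd p)))"
      by (intro continuous_on_Pair tc continuous_intros)
    moreover have "(\<lambda>p. (tau t (fst p) (fst (snd p)), snd (snd p))) ` unit_cube \<subseteq> ball 0 \<rho> \<times> {0..1}"
    proof (rule image_subsetI)
      fix p :: "real \<times> real \<times> real" assume "p \<in> unit_cube"
      then have "snd (snd p) \<in> {0..1}" by (cases p) (auto simp: cbox_Pair_eq)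
      then show "(tau t (fst p) (fst (snd p)), snd (snd p)) \<in> ball 0 \<rho> \<times> {0..1}"
        using tau_in_ball(2)[OF t] by blast
    qed
    ultimately show ?thesis using continuous_on_compose2[OF ys_continuous] by fastforce
  qed
  have nz: "ys (tau t (fst p) (fst (snd p))) (snd (snd p)) \<noteq> 0" if "p \<in> unit_cube" for p
  proof -
    have "snd (snd p) \<in> {0..1}" using that by (cases p) (auto simp: cbox_Pair_eq)
    then show ?thesis by (rule Sigma1(2)[OF tau_in_ball(2)[OF t]])
  qed
  show ?thesis
    unfolding period_integrand_def[abs_def]
    by (intro continuous_intros c y continuous_circle_velocity continuous_circlepath ballI nz base_weight_nz)
qed

lemma period3_Sigma3_iterated:
  assumes t: "t \<in> ball 0 \<rho>"
  shows "period3 (Sigma3 \<Sigma>\<^sub>1 t) = integral {0..1} (\<lambda>r1. circle_velocity (1 / 2) r1 * (inverse (base_weight r1)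
    * integral {0..1} (\<lambda>r2. circle_velocity (1 / 2) r2 * (inverse (base_weight r2) * period1 (\<Sigma>\<^sub>1 (tau t r1 r2))))))"
proof -
  note cont = continuous_period_integrand[OF t]
  have "period3 (Sigma3 \<Sigma>\<^sub>1 t) = integral {0..1} (\<lambda>r1. integral unit_square (\<lambda>q. period_integrand t (r1, q)))"
    unfolding period3_Sigma3_integrand[OF t]
    using integral_prod_continuous[of 0 "(0, 0)" 1 "(1, 1)", OF cont] by simp
  also have "\<dots> = integral {0..1} (\<lambda>r1. circle_velocity (1 / 2) r1 * (inverse (base_weight r1)
    * integral {0..1} (\<lambda>r2. circle_velocity (1 / 2) r2 * (inverse (base_weight r2) * period1 (\<Sigma>\<^sub>1 (tau t r1 r2))))))"
  proof (rule integral_cong)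
    fix r1 :: real assume r1: "r1 \<in> {0..1}"
    have "integral unit_square (\<lambda>q. period_integrand t (r1, q))
        = integral {0..1} (\<lambda>r2. integral {0..1} (\<lambda>s. period_integrand t (r1, r2, s)))"
      using integral_prod_continuous[OF continuous_on_cube_slice(1)[OF cont r1]] by simp
    also have "\<dots> = integral {0..1} (\<lambda>r2. (circle_velocity (1 / 2) r1 * inverse (base_weight r1))
        * (circle_velocity (1 / 2) r2 * (inverse (base_weight r2) * period1 (\<Sigma>\<^sub>1 (tau t r1 r2)))))"
    proof (rule integral_cong)
      fix r2 :: real
      show "integral {0..1} (\<lambda>s. period_integrand t (r1, r2, s)) = (circle_velocity (1 / 2) r1 * inverse (base_weight r1))
        * (circle_velocity (1 / 2) r2 * (inverse (base_weight r2) * period1 (\<Sigma>\<^sub>1 (tau t r1 r2))))"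
        unfolding period1_W[OF tau_in_ball(2)[OF t]] W_def period_integrand_def fst_conv snd_conv reval.simps
          integral_mult_right by (simp only: mult.assoc)
    qed
    finally show "integral unit_square (\<lambda>q. period_integrand t (r1, q)) = circle_velocity (1 / 2) r1 * (inverse (base_weight r1)
      * integral {0..1} (\<lambda>r2. circle_velocity (1 / 2) r2 * (inverse (base_weight r2) * period1 (\<Sigma>\<^sub>1 (tau t r1 r2)))))"
      unfolding integral_mult_right mult.assoc .
  qed
  finally show ?thesis .
qed

text \<open>\<open>twist_series\<close> is used on the inner circle at the once twisted parameter
  and on the outer circle at t. This gives 1F0 \<star> (1F0 \<star> C), whose inner product is the
  squared Heun function.\<close>

lemma period3_Sigma3_series:
  assumes a: "a \<noteq> 0" and \<rho>: "\<rho> > 0"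
    and norm: "\<forall>\<^sub>F t in nhds 0. \<kappa> * period1 (\<Sigma>\<^sub>1 t) = 2 * pi * \<i> * eval_fps (heun_local a q 1 1 1 1) t"
  shows "\<forall>\<^sub>F t in nhds 0. \<kappa> * period3 (Sigma3 \<Sigma>\<^sub>1 t) = (2 * pi * \<i>) ^ 3
    * eval_fps (hyp1F0_half \<star> heun_local a (q / 4) (1 / 4) (3 / 4) 1 (1 / 2) ^ 2) t"
proof -
  define C where "C = heun_local a q 1 1 1 1"
  define G where "G = hyp1F0_half \<star> C"
  have F: "hyp1F0_half \<star> G = hyp1F0_half \<star> heun_local a (q / 4) (1 / 4) (3 / 4) 1 (1 / 2) ^ 2"
    unfolding G_def C_def by (rule fps_ext) (simp only: hadamard_def fps_nth_Abs_fps heun_square_coeffs[OF a])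
  have rC: "fps_conv_radius C > 0" unfolding C_def by (rule heun_local_props[OF a])
  have rG: "fps_conv_radius G > 0"
  proof -
    obtain K where K: "K \<ge> 1" "\<And>n. norm (heun_coeff a q 1 1 1 n) \<le> K ^ n"
      using heun_coeff_bound[OF a] by blast
    have "norm (fps_nth G n) \<le> K ^ n" for n
    proof -
      have "norm (fps_nth G n) = norm (fps_nth hyp1F0_half n) * norm (heun_coeff a q 1 1 1 n)"
        by (simp add: G_def C_def hadamard_def heun_local_eq(1)[OF a] norm_mult)
      also have "\<dots> \<le> 1 * K ^ n"
        using norm_hyp1F0_half by (intro mult_mono K) auto
      finally show ?thesis by simp
    qed
    then show ?thesis using K by (intro fps_conv_radius_geometric_bound[of K]) auto
  qed
  obtain S where S: "open S" "0 \<in> S" "\<And>t. t \<in> S \<Longrightarrow> \<kappa> * period1 (\<Sigma>\<^sub>1 t) = 2 * pi * \<i> * eval_fps C t"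
    using norm unfolding eventually_nhds C_def by blast
  have "open (S \<inter> ball 0 \<rho> \<inter> eball 0 (fps_conv_radius C) \<inter> eball 0 (fps_conv_radius G))"
    using S by auto
  moreover have "0 \<in> S \<inter> ball 0 \<rho> \<inter> eball 0 (fps_conv_radius C) \<inter> eball 0 (fps_conv_radius G)"
    using S \<rho> rC rG by (simp add: in_eball_iff zero_ereal_def)
  \<comment> \<open>A disc about 0 is invariant under twisting, so both series, the cycle and the
    normalization are available at all parameters that occur.\<close>
  ultimately obtain \<delta> where \<delta>: "\<delta> > 0"
    "ball 0 \<delta> \<subseteq> S \<inter> ball 0 \<rho> \<inter> eball 0 (fps_conv_radius C) \<inter> eball 0 (fps_conv_radius G)"
    using openE by blast
  have main: "\<kappa> * period3 (Sigma3 \<Sigma>\<^sub>1 t) = (2 * pi * \<i>) ^ 3 * eval_fps (hyp1F0_half \<star> G) t" if t: "t \<in> ball 0 \<delta>" for t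
  proof -
    have rad: "ereal (norm z) < fps_conv_radius C" "ereal (norm z) < fps_conv_radius G" "z \<in> S" "z \<in> ball 0 \<rho>"
      if "z \<in> ball 0 \<delta>" for z
      using that \<delta>(2) by (auto simp: in_eball_iff subset_iff)
    have inner: "\<kappa> * integral {0..1} (\<lambda>r2. circle_velocity (1 / 2) r2 * (inverse (base_weight r2) * period1 (\<Sigma>\<^sub>1 (tau t r1 r2))))
        = (2 * pi * \<i>) ^ 2 * eval_fps G (twist_param t (base_circle r1))" for r1
    proof -
      have "\<kappa> * integral {0..1} (\<lambda>r2. circle_velocity (1 / 2) r2 * (inverse (base_weight r2) * period1 (\<Sigma>\<^sub>1 (tau t r1 r2))))
        = integral {0..1} (\<lambda>r2. 2 * pi * \<i> * (circle_velocity (1 / 2) r2 * (inverse (base_weight r2) * eval_fps C (tau t r1 r2))))"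
        unfolding integral_mult_right[symmetric]
      proof (rule integral_cong)
        fix r2
        show "\<kappa> * (circle_velocity (1 / 2) r2 * (inverse (base_weight r2) * period1 (\<Sigma>\<^sub>1 (tau t r1 r2))))
          = 2 * pi * \<i> * (circle_velocity (1 / 2) r2 * (inverse (base_weight r2) * eval_fps C (tau t r1 r2)))"
          using S(3)[OF rad(3)[OF tau_in_ball(2)[OF t]], of r1 r2]
          by (simp only: mult.left_commute[of \<kappa>] mult.left_commute[of "2 * pi * \<i>"])
      qed
      also have "\<dots> = 2 * pi * \<i> * (2 * of_real pi * \<i> * eval_fps G (twist_param t (base_circle r1)))"
        unfolding integral_mult_right twist_series[OF rad(1)[OF tau_in_ball(1)[OF t]]] G_def ..
      finally show ?thesis by (simp add: power2_eq_square)
    qed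
    have "\<kappa> * period3 (Sigma3 \<Sigma>\<^sub>1 t)
      = integral {0..1} (\<lambda>r1. circle_velocity (1 / 2) r1 * (inverse (base_weight r1)
          * (\<kappa> * integral {0..1} (\<lambda>r2. circle_velocity (1 / 2) r2 * (inverse (base_weight r2) * period1 (\<Sigma>\<^sub>1 (tau t r1 r2)))))))"
      unfolding period3_Sigma3_iterated[OF rad(4)[OF t]] integral_mult_right[symmetric, where c = \<kappa>]
      by (simp only: mult.left_commute[of \<kappa>] integral_mult_right[symmetric, where c = \<kappa>])
    also have "\<dots> = integral {0..1} (\<lambda>r1. (2 * pi * \<i>) ^ 2 * (circle_velocity (1 / 2) r1 * (inverse (base_weight r1)
          * eval_fps G (twist_param t (base_circle r1)))))"
      unfolding inner by (simp only: mult.left_commute[of _ "(2 * pi * \<i>) ^ 2"])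
    also have "\<dots> = (2 * pi * \<i>) ^ 2 * (2 * of_real pi * \<i> * eval_fps (hyp1F0_half \<star> G) t)"
      unfolding integral_mult_right twist_series[OF rad(2)[OF t]] ..
    finally show ?thesis by (simp add: power2_eq_square power3_eq_cube)
  qed
  have "\<forall>\<^sub>F t in nhds 0. t \<in> ball 0 \<delta>" using \<delta> by (intro eventually_nhds_in_open) auto
  then show ?thesis unfolding F[symmetric] by eventually_elim (rule main)
qed

end

section \<open>Calabi-Yau fibres\<close>

text \<open>The form of degree w belonging to g, evaluated at (\<tau>, z). With \<tau> a multiple of
  t and z the product of the twist factors it is the twisted coefficient, now also meaningful at z =
  0, where the fibre at infinity sits.\<close>

definition homogenize :: "nat \<Rightarrow> complex poly \<Rightarrow> complex \<Rightarrow> complex \<Rightarrow> complex" where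
  "homogenize w g \<tau> z = (\<Sum>i\<le>w. coeff g i * \<tau> ^ i * z ^ (w - i))"

lemma homogenize_nonzero:
  assumes "degree g \<le> w" "z \<noteq> 0"
  shows "homogenize w g \<tau> z = z ^ w * poly g (\<tau> / z)"
proof -
  have "poly g (\<tau> / z) = (\<Sum>i\<le>w. coeff g i * (\<tau> / z) ^ i)"
    unfolding poly_altdef
    by (rule sum.mono_neutral_left) (use assms in \<open>auto simp: coeff_eq_0\<close>)
  then have "z ^ w * poly g (\<tau> / z) = (\<Sum>i\<le>w. z ^ w * (coeff g i * (\<tau> / z) ^ i))"
    by (simp only: sum_distrib_left)
  also have "\<dots> = homogenize w g \<tau> z"
    unfolding homogenize_def
  proof (rule sum.cong[OF refl])
    fix i assume "i \<in> {..w}"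
    then have "z ^ w = z ^ (w - i) * z ^ i" by (simp flip: power_add)
    then show "z ^ w * (coeff g i * (\<tau> / z) ^ i) = coeff g i * \<tau> ^ i * z ^ (w - i)"
      using assms(2) by (simp add: power_divide)
  qed
  finally show ?thesis by simp
qed

lemma homogenize_0: "homogenize w g \<tau> 0 = coeff g w * \<tau> ^ w"
  unfolding homogenize_def by (subst sum.remove[of _ w]) (auto intro!: sum.neutral)

text \<open>At z = 0 a zero of the first form contradicts the multiplicative fibre at infinity.
  Elsewhere a common zero would be a zero of the discriminant, hence lie over 0, 1 or a, where g2
  does not vanish.\<close>

lemma surface_nonvanishing:
  assumes surface: "rational_elliptic_surface a (n0, n1, na, ni) g2 g3"
    and a: "a \<noteq> 0" "a \<noteq> 1" and sum: "n0 + n1 + na + ni = 12" and \<tau>: "\<tau> \<noteq> 0"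
  shows "homogenize 4 g2 \<tau> z = 0 \<Longrightarrow> homogenize 6 g3 \<tau> z \<noteq> 0"
    and "\<exists>z. z \<noteq> 0 \<and> wdiscr (homogenize 4 g2 \<tau> z) (homogenize 6 g3 \<tau> z) \<noteq> 0"
proof -
  from surface_discriminant[OF surface a sum] obtain C where C: "C \<noteq> 0" and
    WC: "wdiscr g2 g3 = smult C ([:0, 1:] ^ n0 * [:- 1, 1:] ^ n1 * [:- a, 1:] ^ na)" .
  have surf: "degree g2 \<le> 4" "degree g3 \<le> 6" "n0 \<ge> 1" "n1 \<ge> 1" "na \<ge> 1"
    "poly g2 0 \<noteq> 0" "poly g2 1 \<noteq> 0" "poly g2 a \<noteq> 0" "coeff g2 4 \<noteq> 0"
    using surface by (auto simp: rational_elliptic_surface_def fiber_I_def fiber_I_infinity_def)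
  have W0: "poly (wdiscr g2 g3) z = 0 \<longleftrightarrow> z \<in> {0, 1, a}" for z
    unfolding WC using C surf(3-5) by (auto simp: poly_power)
  have pW: "poly (wdiscr g2 g3) z = wdiscr (poly g2 z) (poly g3 z)" for z
    unfolding wdiscr_def by (simp only: poly_diff poly_mult poly_power poly_numeral)
  show "homogenize 6 g3 \<tau> z \<noteq> 0" if h: "homogenize 4 g2 \<tau> z = 0"
  proof
    assume h': "homogenize 6 g3 \<tau> z = 0"
    show False
    proof (cases "z = 0")
      case True
      then show False using h surf(9) \<tau> by (simp add: homogenize_0)
    next
      case False
      then have g: "poly g2 (\<tau> / z) = 0" "poly g3 (\<tau> / z) = 0"
        using h h' homogenize_nonzero[OF surf(1) False] homogenize_nonzero[OF surf(2) False] by auto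
      then have "poly (wdiscr g2 g3) (\<tau> / z) = 0" unfolding pW by (simp add: wdiscr_def)
      then have "\<tau> / z \<in> {0, 1, a}" unfolding W0 .
      then show False using g surf(6-8) by auto
    qed
  qed
  have "finite {0, 1, a}" by simp
  then obtain s where s: "s \<notin> {0, 1, a}" using ex_new_if_finite infinite_UNIV_char_0 by blast
  \<comment> \<open>The parameter \<tau> / z is then s, which lies under a smooth fibre.\<close>
  define z where "z = \<tau> / s"
  have z: "z \<noteq> 0" "\<tau> / z = s" using s \<tau> by (auto simp: z_def)
  have "wdiscr (homogenize 4 g2 \<tau> z) (homogenize 6 g3 \<tau> z) = z ^ 12 * poly (wdiscr g2 g3) s"
    unfolding pW homogenize_nonzero[OF surf(1) z(1)] homogenize_nonzero[OF surf(2) z(1)] z(2)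
    by (simp add: wdiscr_def power_mult_distrib right_diff_distrib flip: power_mult)
  also have "\<dots> \<noteq> 0" using z W0 s by simp
  finally show "\<exists>z. z \<noteq> 0 \<and> wdiscr (homogenize 4 g2 \<tau> z) (homogenize 6 g3 \<tau> z) \<noteq> 0"
    using z by blast
qed

lemma quadratic_surjective: "\<exists>v :: complex. v * (v + 1) = z"
proof -
  let ?r = "csqrt (1 + 4 * z)"
  have "((?r - 1) / 2) * ((?r - 1) / 2 + 1) = (?r ^ 2 - 1) / 4"
    by (simp add: field_simps power2_eq_square)
  also have "\<dots> = z" unfolding power2_csqrt by simp
  finally show ?thesis by blast
qed

definition k3_poly :: "nat \<Rightarrow> complex poly \<Rightarrow> complex \<Rightarrow> complex poly" where
  "k3_poly w g \<tau> = (\<Sum>i\<le>w. smult (coeff g i * \<tau> ^ i) ([:0, 1, 1:] ^ (w - i)))"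

lemma poly_k3_poly: "poly (k3_poly w g \<tau>) v = homogenize w g \<tau> (v * (v + 1))"
  by (simp add: k3_poly_def homogenize_def poly_sum poly_power algebra_simps)

lemma degree_quadratic_power:
  "degree ([:0, 1, 1:] ^ k :: 'a::idom poly) = 2 * k" "coeff ([:0, 1, 1:] ^ k :: 'a::idom poly) (2 * k) = 1"
proof -
  show d: "degree ([:0, 1, 1:] ^ k :: 'a poly) = 2 * k" by (subst degree_power_eq) auto
  have "lead_coeff ([:0, 1, 1:] ^ k :: 'a poly) = 1" unfolding lead_coeff_power by simp
  then show "coeff ([:0, 1, 1:] ^ k :: 'a poly) (2 * k) = 1" unfolding d .
qed

lemma degree_k3_poly: "degree (k3_poly w g \<tau>) \<le> 2 * w"
  unfolding k3_poly_def
  by (rule degree_sum_le) (auto intro!: order_trans[OF degree_smult_le] simp: degree_quadratic_power)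

text \<open>The point v = infinity has twisted parameter 0, so the top coefficient is the value of g
  there.\<close>

lemma coeff_k3_poly: "coeff (k3_poly w g \<tau>) (2 * w) = coeff g 0"
proof -
  have "coeff ([:0, 1, 1:] ^ (w - i)) (2 * w) = (0 :: complex)" if "i \<in> {..w} - {0}" for i
    using that by (intro coeff_eq_0) (auto simp: degree_quadratic_power)
  then show ?thesis
    unfolding k3_poly_def coeff_sum
    by (subst sum.remove[of _ 0]) (auto simp: degree_quadratic_power intro!: sum.neutral)
qed

lemma twist_param_eq: "twist_param t v = (- t / 4) / (v * (v + 1))"
  by (simp add: twist_param_def)

lemma base_nonzero: "v \<notin> {0, - 1} \<Longrightarrow> v * (v + 1) \<noteq> 0" for v :: complex
  by (auto simp: eq_neg_iff_add_eq_0)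

lemma k3_coeff_homogenize:
  assumes "degree g \<le> w" "v \<notin> {0, - 1}"
  shows "k3_coeff w g t [v] = homogenize w g (- t / 4) (v * (v + 1))"
  unfolding homogenize_nonzero[OF assms(1) base_nonzero[OF assms(2)]]
  by (simp add: k3_coeff_def twist_coeff_def base_coeff_def twist_param_eq mult.commute)

text \<open>Non-minimality along a nonunit p would give a common zero of both coefficients at a root
  of p. At infinity minimality follows from the top coefficient g2(0), which makes the degree
  exactly 8.\<close>

lemma surface_is_K3:
  assumes surface: "rational_elliptic_surface a (n0, n1, na, ni) g2 g3"
    and a: "a \<noteq> 0" "a \<noteq> 1" and sum: "n0 + n1 + na + ni = 12" and t: "t \<noteq> 0"
  shows "is_K3_fiber g2 g3 t"
  unfolding is_K3_fiber_def
proof (intro exI conjI allI impI)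
  let ?G2 = "k3_poly 4 g2 (- t / 4)" and ?G3 = "k3_poly 6 g3 (- t / 4)"
  have surf: "degree g2 \<le> 4" "degree g3 \<le> 6" "poly g2 0 \<noteq> 0"
    using surface by (auto simp: rational_elliptic_surface_def fiber_I_def)
  have "- t / 4 \<noteq> 0" using t by simp
  note nv = surface_nonvanishing[OF surface a sum this]
  show "poly ?G2 v = k3_coeff 4 g2 t [v]" "poly ?G3 v = k3_coeff 6 g3 t [v]" if "v \<notin> {0, - 1}" for v
    unfolding poly_k3_poly using k3_coeff_homogenize[OF surf(1) that] k3_coeff_homogenize[OF surf(2) that] by auto
  show "jacobian_elliptic_K3 ?G2 ?G3"
    unfolding jacobian_elliptic_K3_def
  proof (intro conjI)
    show "degree ?G2 \<le> 8" "degree ?G3 \<le> 12"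
      using degree_k3_poly[of 4 g2] degree_k3_poly[of 6 g3] by simp_all
    have "coeff ?G2 8 \<noteq> 0" using coeff_k3_poly[of 4 g2] surf(3) by (simp add: poly_0_coeff_0)
    then have "degree ?G2 \<ge> 8" by (rule le_degree)
    then show "\<not> (degree ?G2 \<le> 4 \<and> degree ?G3 \<le> 6)" by simp
    obtain z where z: "wdiscr (homogenize 4 g2 (- t / 4) z) (homogenize 6 g3 (- t / 4) z) \<noteq> 0"
      using nv(2) by blast
    obtain v where v: "v * (v + 1) = z" using quadratic_surjective by blast
    have "poly (wdiscr ?G2 ?G3) v = wdiscr (poly ?G2 v) (poly ?G3 v)"
      unfolding wdiscr_def by (simp only: poly_diff poly_mult poly_power poly_numeral)
    then show "wdiscr ?G2 ?G3 \<noteq> 0" using z unfolding poly_k3_poly v by auto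
    show "\<nexists>p. \<not> p dvd 1 \<and> p ^ 4 dvd ?G2 \<and> p ^ 6 dvd ?G3"
    proof
      assume "\<exists>p. \<not> p dvd 1 \<and> p ^ 4 dvd ?G2 \<and> p ^ 6 dvd ?G3"
      then obtain p where p: "\<not> p dvd 1" "p ^ 4 dvd ?G2" "p ^ 6 dvd ?G3" by blast
      obtain v where v: "poly p v = 0" using nonunit_poly_has_root[OF p(1)] by blast
      obtain k2 k3 where k: "?G2 = p ^ 4 * k2" "?G3 = p ^ 6 * k3" using p(2,3) by (meson dvdE)
      have "poly ?G2 v = 0" unfolding k(1) using v by (simp add: poly_power)
      moreover have "poly ?G3 v = 0" unfolding k(2) using v by (simp add: poly_power)
      ultimately show False unfolding poly_k3_poly using nv(1) by blast
    qed
  qed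
qed

lemma eval2_simps:
  "eval2 (p + q) u v = eval2 p u v + eval2 q u v" "eval2 (p - q) u v = eval2 p u v - eval2 q u v"
  "eval2 (p * q) u v = eval2 p u v * eval2 q u v" "eval2 (p ^ n) u v = eval2 p u v ^ n"
  "eval2 (smult c p) u v = poly c u * eval2 p u v" "eval2 (sum f S) u v = (\<Sum>i\<in>S. eval2 (f i) u v)"
  "eval2 (numeral k) u v = numeral k"
  by (simp_all add: eval2_def poly_sum poly_power)

lemma eval2_map_poly: "eval2 p u v = poly (map_poly (\<lambda>c. poly c u) p) v"
  unfolding eval2_def by (induction p) (simp_all add: map_poly_pCons)

text \<open>If v occurs, u is chosen off the finitely many zeros of the leading coefficient, so the
  degree in v survives specialization and the fundamental theorem of algebra applies.\<close>

lemma nonunit_poly2_has_root: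
  fixes p :: "complex poly poly"
  assumes "\<not> p dvd 1"
  shows "\<exists>u v. eval2 p u v = 0"
proof (cases "degree p = 0")
  case True
  then obtain r where p: "p = [:r:]" by (rule degree_eq_zeroE)
  then have "\<not> r dvd 1" using assms by (simp add: is_unit_const_poly_iff)
  then obtain u where "poly r u = 0" using nonunit_poly_has_root by blast
  then show ?thesis by (auto simp: p eval2_def)
next
  case False
  then have "lead_coeff p \<noteq> 0" by auto
  then have "finite {u. poly (lead_coeff p) u = 0}" by (rule poly_roots_finite)
  then obtain u where u: "poly (lead_coeff p) u \<noteq> 0" using ex_new_if_finite infinite_UNIV_char_0 by blast
  let ?q = "map_poly (\<lambda>c. poly c u) p"
  have "coeff ?q (degree p) \<noteq> 0" using u by (simp add: coeff_map_poly)
  then have "degree ?q \<noteq> 0" using False le_degree by fastforce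
  then have "\<exists>v. poly ?q v = 0"
    using fundamental_theorem_of_algebra[of ?q] by (simp add: constant_degree)
  then show ?thesis unfolding eval2_map_poly by blast
qed

definition cy3_poly :: "nat \<Rightarrow> complex poly \<Rightarrow> complex \<Rightarrow> complex poly poly" where
  "cy3_poly w g \<tau> = (\<Sum>i\<le>w. smult ([:coeff g i * \<tau> ^ i:] * [:0, 1, 1:] ^ (w - i)) ([:0, 1, 1:] ^ (w - i)))"

lemma eval2_cy3_poly: "eval2 (cy3_poly w g \<tau>) u v = homogenize w g \<tau> ((u * (u + 1)) * (v * (v + 1)))"
proof -
  have e: "eval2 [:0, 1, 1:] u v = v * (v + 1)" "poly [:0, 1, 1:] u = u * (u + 1)" "poly [:c:] u = c" for c
    by (simp_all add: eval2_def algebra_simps)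
  show ?thesis
    unfolding cy3_poly_def homogenize_def eval2_simps poly_mult poly_power power_mult_distrib[of "u * (u + 1)"] e
    by (simp only: mult.assoc)
qed

lemma degree_coeff_quadratic_power: "degree (coeff ([:0, 1, 1:] ^ k :: complex poly poly) j) = 0"
proof (induction k arbitrary: j)
  case (Suc k)
  let ?q = "[:0, 1, 1:] ^ k :: complex poly poly"
  have "[:0, 1, 1:] ^ Suc k = pCons 0 (?q + pCons 0 ?q)" by simp
  moreover have "degree (coeff ?q i + coeff (pCons 0 ?q) i) = 0" for i
    using degree_add_le[of "coeff ?q i" 0 "coeff (pCons 0 ?q) i"] Suc.IH
    by (auto simp: coeff_pCons split: nat.split)
  ultimately show ?case by (auto simp: coeff_pCons split: nat.split)
qed (auto simp: coeff_1)

lemma coeff_cy3_poly: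
  "coeff (cy3_poly w g \<tau>) (2 * w) = smult (coeff g 0) ([:0, 1, 1:] ^ w)"
proof -
  have "coeff ([:0, 1, 1:] ^ (w - i)) (2 * w) = (0 :: complex poly)" if "i \<in> {..w} - {0}" for i
    using that by (intro coeff_eq_0) (auto simp: degree_quadratic_power)
  then show ?thesis
    unfolding cy3_poly_def coeff_sum
    by (subst sum.remove[of _ 0]) (auto simp: degree_quadratic_power intro!: sum.neutral)
qed

lemma degree_cy3_poly: "degree (cy3_poly w g \<tau>) \<le> 2 * w" "degree (coeff (cy3_poly w g \<tau>) j) \<le> 2 * w"
proof -
  show "degree (cy3_poly w g \<tau>) \<le> 2 * w"
    unfolding cy3_poly_def
    by (rule degree_sum_le) (auto intro!: order_trans[OF degree_smult_le] simp: degree_quadratic_power)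
  show "degree (coeff (cy3_poly w g \<tau>) j) \<le> 2 * w"
    unfolding cy3_poly_def coeff_sum coeff_smult
  proof (rule degree_sum_le)
    fix i assume "i \<in> {..w}"
    have "degree ([:coeff g i * \<tau> ^ i:] * [:0, 1, 1:] ^ (w - i) * coeff ([:0, 1, 1:] ^ (w - i)) j) \<le> 0 + 2 * (w - i) + 0"
      using degree_coeff_quadratic_power[of "w - i" j]
      by (intro order_trans[OF degree_mult_le] add_mono) (simp_all add: degree_quadratic_power)
    then show "degree ([:coeff g i * \<tau> ^ i:] * [:0, 1, 1:] ^ (w - i) * coeff ([:0, 1, 1:] ^ (w - i)) j) \<le> 2 * w"
      by simp
  qed simp
qed

lemma cy3_coeff_homogenize:
  assumes "degree g \<le> w" "u \<notin> {0, - 1}" "v \<notin> {0, - 1}"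
  shows "cy3_coeff w g t [u, v] = homogenize w g (t / 16) ((u * (u + 1)) * (v * (v + 1)))"
proof -
  let ?A = "u * (u + 1)" and ?B = "v * (v + 1)"
  have nz: "?A \<noteq> 0" "?B \<noteq> 0" "?A * ?B \<noteq> 0"
    using base_nonzero[OF assms(2)] base_nonzero[OF assms(3)] by (blast, blast, metis mult_eq_0_iff)
  have "twist_param (twist_param t u) v = t / 16 / (?A * ?B)"
    unfolding twist_param_eq by simp
  then show ?thesis
    unfolding homogenize_nonzero[OF assms(1) nz(3)]
    by (simp add: cy3_coeff_def k3_coeff_def twist_coeff_def base_coeff_def Let_def power_mult_distrib mult_ac)
qed

text \<open>The argument for K3 surfaces carries over. Both divisors at infinity are handled by the
  coefficient of v^8, which is g2(0) (u + u^2)^4 and has full degree 8 in u.\<close>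

lemma surface_is_CY3:
  assumes surface: "rational_elliptic_surface a (n0, n1, na, ni) g2 g3"
    and a: "a \<noteq> 0" "a \<noteq> 1" and sum: "n0 + n1 + na + ni = 12" and t: "t \<noteq> 0"
  shows "is_CY3_fiber g2 g3 t"
  unfolding is_CY3_fiber_def
proof (intro exI conjI allI impI)
  let ?G2 = "cy3_poly 4 g2 (t / 16)" and ?G3 = "cy3_poly 6 g3 (t / 16)"
  have surf: "degree g2 \<le> 4" "degree g3 \<le> 6" "poly g2 0 \<noteq> 0"
    using surface by (auto simp: rational_elliptic_surface_def fiber_I_def)
  have "t / 16 \<noteq> 0" using t by simp
  note nv = surface_nonvanishing[OF surface a sum this]
  show "eval2 ?G2 u v = cy3_coeff 4 g2 t [u, v]" "eval2 ?G3 u v = cy3_coeff 6 g3 t [u, v]"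
    if "u \<notin> {0, - 1}" "v \<notin> {0, - 1}" for u v
    unfolding eval2_cy3_poly
    using cy3_coeff_homogenize[OF surf(1) that] cy3_coeff_homogenize[OF surf(2) that] by auto
  have c8: "coeff ?G2 8 = smult (coeff g2 0) ([:0, 1, 1:] ^ 4)" using coeff_cy3_poly[of 4 g2] by simp
  have c0: "coeff g2 0 \<noteq> 0" using surf(3) by (simp add: poly_0_coeff_0)
  show "jacobian_elliptic_CY3 ?G2 ?G3"
    unfolding jacobian_elliptic_CY3_def
  proof (intro conjI allI)
    show "degree ?G2 \<le> 8" "degree ?G3 \<le> 12" "degree (coeff ?G2 i) \<le> 8" "degree (coeff ?G3 i) \<le> 12" for i
      using degree_cy3_poly[of 4 g2] degree_cy3_poly[of 6 g3] by simp_all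
    have d8: "degree (coeff ?G2 8) = 8" unfolding c8 using c0 by (simp add: degree_quadratic_power)
    then have "coeff ?G2 8 \<noteq> 0" by auto
    then have "degree ?G2 \<ge> 8" by (rule le_degree)
    then show "\<not> (degree ?G2 \<le> 4 \<and> degree ?G3 \<le> 6)" by simp
    show "\<not> ((\<forall>i. degree (coeff ?G2 i) \<le> 4) \<and> (\<forall>i. degree (coeff ?G3 i) \<le> 6))"
    proof
      assume "(\<forall>i. degree (coeff ?G2 i) \<le> 4) \<and> (\<forall>i. degree (coeff ?G3 i) \<le> 6)"
      then have "degree (coeff ?G2 8) \<le> 4" by blast
      with d8 show False by simp
    qed
    obtain z where z: "wdiscr (homogenize 4 g2 (t / 16) z) (homogenize 6 g3 (t / 16) z) \<noteq> 0"
      using nv(2) by blast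
    \<comment> \<open>The slice u = 1 has u (u + 1) = 2, hence the division by 2.\<close>
    obtain v where v: "v * (v + 1) = z / 2" using quadratic_surjective by blast
    have "eval2 (wdiscr ?G2 ?G3) 1 v = wdiscr (eval2 ?G2 1 v) (eval2 ?G3 1 v)"
      unfolding wdiscr_def eval2_simps ..
    also have "\<dots> \<noteq> 0" using z unfolding eval2_cy3_poly v by simp
    finally show "wdiscr ?G2 ?G3 \<noteq> 0" by (auto simp: eval2_def)
    show "\<nexists>p. \<not> p dvd 1 \<and> p ^ 4 dvd ?G2 \<and> p ^ 6 dvd ?G3"
    proof
      assume "\<exists>p. \<not> p dvd 1 \<and> p ^ 4 dvd ?G2 \<and> p ^ 6 dvd ?G3"
      then obtain p where p: "\<not> p dvd 1" "p ^ 4 dvd ?G2" "p ^ 6 dvd ?G3" by blast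
      obtain u v where v: "eval2 p u v = 0" using nonunit_poly2_has_root[OF p(1)] by blast
      obtain k2 k3 where k: "?G2 = p ^ 4 * k2" "?G3 = p ^ 6 * k3" using p(2,3) by (meson dvdE)
      have "eval2 ?G2 u v = 0" unfolding k(1) eval2_simps v by simp
      moreover have "eval2 ?G3 u v = 0" unfolding k(2) eval2_simps v by simp
      ultimately show False unfolding eval2_cy3_poly using nv(1) by blast
    qed
  qed
qed

section \<open>The main result\<close>

lemma extremal_data_props:
  assumes "(a, q, n0, n1, na, ni) \<in> extremal_data"
  shows "a \<noteq> 0" "a \<noteq> 1" "n0 + n1 + na + ni = 12"
proof -
  have r3: "(1 + \<i> * sqrt 3) / 2 \<noteq> (0 :: complex)" "(1 + \<i> * sqrt 3) / 2 \<noteq> (1 :: complex)"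
    "(1 - \<i> * sqrt 3) / 2 \<noteq> (0 :: complex)" "(1 - \<i> * sqrt 3) / 2 \<noteq> (1 :: complex)"
    by (simp_all add: complex_eq_iff)
  \<comment> \<open>15125 is the square of 55 sqrt 5, while 123^2 = 15129 and 125^2 = 15625; these
    exclude a = 0 and a = 1.\<close>
  have irr: "55 * sqrt 5 \<noteq> c" if "c ^ 2 \<noteq> 15125" for c :: real
    using that by (auto simp: power_mult_distrib)
  have irr': "- (55 * sqrt 5) \<noteq> c" if "c ^ 2 \<noteq> 15125" for c :: real
    using that by (auto simp: power_mult_distrib)
  have r5: "(- 123 + 55 * sqrt 5) / 2 \<noteq> (0 :: real)" "(- 123 + 55 * sqrt 5) / 2 \<noteq> (1 :: real)"
    "(- 123 - 55 * sqrt 5) / 2 \<noteq> (0 :: real)" "(- 123 - 55 * sqrt 5) / 2 \<noteq> (1 :: real)"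
    using irr[of 123] irr[of 125] irr'[of 123] irr'[of 125] by auto
  have r5': "(- 123 + 55 * complex_of_real (sqrt 5)) / 2 = complex_of_real ((- 123 + 55 * sqrt 5) / 2)"
    "(- 123 - 55 * complex_of_real (sqrt 5)) / 2 = complex_of_real ((- 123 - 55 * sqrt 5) / 2)"
    by simp_all
  show "a \<noteq> 0" using assms r3 r5 unfolding extremal_data_def r5' by (auto simp del: of_real_divide of_real_add of_real_diff of_real_mult)
  have r8: "- (1 / 8) \<noteq> (1 :: complex)" "(-1 / 8) \<noteq> (1 :: complex)" "-8 \<noteq> (1 :: complex)"
    by (simp_all add: complex_eq_iff)
  show "a \<noteq> 1" using assms r3 r5 r8 unfolding extremal_data_def r5' by (auto simp del: of_real_divide of_real_add of_real_diff of_real_mult)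
  show "n0 + n1 + na + ni = 12" using assms unfolding extremal_data_def by auto
qed

theorem corollary10p9:
  fixes a q \<kappa> :: complex and n0 n1 na ni :: nat and g2 g3 :: "complex poly"
    and \<rho> :: real and \<Sigma>\<^sub>1 :: "complex \<Rightarrow> real \<Rightarrow> point"
  assumes data: "(a, q, n0, n1, na, ni) \<in> extremal_data"
    and surface: "rational_elliptic_surface a (n0, n1, na, ni) g2 g3"
    and cycle: "\<rho> > 0" "A_cycle g2 g3 \<rho> \<Sigma>\<^sub>1"
    and normalized: "\<forall>\<^sub>F t in nhds 0.
      \<kappa> * period1 (\<Sigma>\<^sub>1 t) = 2 * pi * \<i> * eval_fps (heun_local a q 1 1 1 1) t"
  shows "(\<forall>t. t \<notin> {0, 1, a} \<longrightarrow> is_K3_fiber g2 g3 t)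
    \<and> (\<forall>t. t \<notin> {0, 1, a} \<longrightarrow> is_CY3_fiber g2 g3 t)
    \<and> (\<forall>t0 \<Gamma>. t0 \<notin> {0, 1, a} \<longrightarrow> three_cycle g2 g3 t0 \<Gamma> \<longrightarrow>
         (let P = (\<lambda>t. \<kappa> * period_function g2 g3 t0 \<Gamma> t)
          in P analytic_on {t0} \<and> (\<forall>\<^sub>F t in nhds t0. picard_fuchs4 a q P t = 0)))
    \<and> (let P = (\<lambda>t. \<kappa> * period3 (Sigma3 \<Sigma>\<^sub>1 t));
           F = hyp1F0_half \<star> (heun_local a (q / 4) (1 / 4) (3 / 4) 1 (1 / 2)) ^ 2
       in P analytic_on {0} \<and> fps_conv_radius F > 0
          \<and> (\<forall>\<^sub>F t in nhds 0. P t = (2 * pi * \<i>) ^ 3 * eval_fps F t))"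
proof -
  note a = extremal_data_props[OF data]
  interpret A_cycle_family g2 g3 \<rho> \<Sigma>\<^sub>1 by unfold_locales (rule cycle(2))
  \<comment> \<open>The surface yields an accessory parameter q' without naming it; the
    normalization then identifies it with the tabulated q.\<close>
  obtain q' A E b where gm': "gauss_manin a q' g2 g3 A E b"
    using surface_gauss_manin[OF surface a] by blast
  then have gm: "gauss_manin a q g2 g3 A E b"
    using accessory_parameter[OF gm' a(1) cycle(1) normalized] by simp
  let ?F = "hyp1F0_half \<star> (heun_local a (q / 4) (1 / 4) (3 / 4) 1 (1 / 2)) ^ 2"
  have r: "fps_conv_radius ?F > 0" by (rule omega_series(2)[OF a(1)])
  have P: "\<forall>\<^sub>F t in nhds 0. \<kappa> * period3 (Sigma3 \<Sigma>\<^sub>1 t) = (2 * pi * \<i>) ^ 3 * eval_fps ?F t"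
    by (rule period3_Sigma3_series[OF a(1) cycle(1) normalized])
  have "eval_fps ?F has_fps_expansion ?F" using r by (simp add: has_fps_expansion_def)
  then have "eval_fps ?F analytic_on {0}" by (rule has_fps_expansion_imp_analytic_0)
  then have "(\<lambda>t. (2 * pi * \<i>) ^ 3 * eval_fps ?F t) analytic_on {0}"
    by (intro analytic_on_mult analytic_on_const)
  then have an: "(\<lambda>t. \<kappa> * period3 (Sigma3 \<Sigma>\<^sub>1 t)) analytic_on {0}"
    using analytic_at_cong[OF P refl] by blast
  have cyc: "(\<lambda>t. \<kappa> * period_function g2 g3 t0 \<Gamma> t) analytic_on {t0}
    \<and> (\<forall>\<^sub>F t in nhds t0. picard_fuchs4 a q (\<lambda>t. \<kappa> * period_function g2 g3 t0 \<Gamma> t) t = 0)"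
    if "three_cycle g2 g3 t0 \<Gamma>" for t0 \<Gamma>
  proof -
    interpret cycle_family g2 g3 t0 \<Gamma> by unfold_locales (rule that)
    show ?thesis by (rule period_function_picard_fuchs[OF gm a(1)])
  qed
  show ?thesis
    unfolding Let_def
    using surface_is_K3[OF surface a] surface_is_CY3[OF surface a] cyc an r P by blast
qed

end
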